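(* Let $X$ be a holomorphic vector field in a neighborhood of $0$ in $\mathbb{C}^n$ with $X(0)=0$, let $X^{(1)}$ be its linear part at $0$, and let $r$ and $\mathcal{Q}$ be the toric degree and the lattice attached to $X^{(1)}$. Then $X$ admits a convergent (local holomorphic) Poincaré-Dulac normalization if and only if, in a neighborhood of $0$ in $\mathbb{C}^n$, $X$ is preserved by an effective holomorphic action of a real torus $\mathbb{T}^r$ of dimension $r$ which has $0$ as a fixed point and whose linear part at $0$ has the weights given by the lattice $\mathcal{Q}$ (that is, the linear part of the action at $0$ is generated by $\sqrt{-1}Z_1,\dots,\sqrt{-1}Z_r$).
   Context: Normal form. In a holomorphic coordinate system centered at $0$ write $X=X^{(1)}+X^{(2)}+\cdots$ with $X^{(k)}$ homogeneous of degree $k$, and let $X^{(1)}=X^s+X^{nil}$ be the Jordan decomposition of the linear vector field $X^{(1)}$ into commuting semisimple and nilpotent parts. $X$ is in Poincaré-Dulac normal form in these coordinates if $[X,X^s]=0$. A convergent Poincaré-Dulac normalization is a local holomorphic change of coordinates, fixing $0$, which puts $X$ in Poincaré-Dulac normal form. Resonances. There is a complex linear coordinate system $(x_j)$ in which $X^s=\sum_{j=1}^n\gamma_jx_j\,\partial/\partial x_j$; the $\gamma_j\in\mathbb{C}$ are the eigenvalues of $X$ at $0$. A resonance relation is an $n$-tuple of integers $(c_j)$ with $\sum_jc_j\gamma_j=0$, $c_j\ge-1$ for all $j$, $\sum_jc_j\ge1$, and at most one $c_j$ negative. Let $\mathcal{R}\subset\mathbb{Z}^n$ be the set of all resonance relations.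 Lattice and toric degree. $\mathcal{Q}\subset\mathbb{Z}^n$ is the sublattice of all $(\rho_j)\in\mathbb{Z}^n$ such that $\sum_{j=1}^n\rho_jc_j=0$ for all $(c_j)\in\mathcal{R}$, and $\rho_j=\rho_k$ whenever $\gamma_j=\gamma_k$. The toric degree of $X$ (or $X^{(1)}$) is the rank $r=\dim_{\mathbb{Z}}\mathcal{Q}$. Fix a basis $(\rho^1_j),\dots,(\rho^r_j)$ of $\mathcal{Q}$ and set $Z_k=\sum_{j=1}^n\rho^k_jx_j\,\partial/\partial x_j$ for $k=1,\dots,r$ (in the linear coordinates $(x_j)$ diagonalizing $X^s$). The flows of (the real parts of) $\sqrt{-1}Z_1,\dots,\sqrt{-1}Z_r$ are $2\pi$-periodic and together generate an effective linear action of $\mathbb{T}^r=(\mathbb{R}/2\pi\mathbb{Z})^r$ on $\mathbb{C}^n$, in which $(t_1,\dots,t_r)$ multiplies $x_j$ by $\exp(\sqrt{-1}\sum_k\rho^k_jt_k)$. A holomorphic action of a real torus is one in which each torus element acts by a holomorphic transformation; it preserves $X$ if each such transformation sends $X$ to itself. *)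

theory Defs
  imports "HOL-Analysis.Analysis" "HOL-Library.Real_Mod"
begin

section \<open>Holomorphic maps and vector fields on open subsets of complex n-space\<close>

text \<open>A vector field on a subset of \<open>\<complex>\<^sup>n\<close> is given by its coefficient map \<open>complex ^ 'n \<Rightarrow> complex ^ 'n\<close>.
  In \<open>complex ^ 'n\<close> the operation \<open>*s\<close> is multiplication by complex scalars, so the derivative
  below is required to be complex linear.\<close>

definition holomorphic_map_on ::
    "(complex ^ 'n \<Rightarrow> complex ^ 'm) \<Rightarrow> (complex ^ 'n) set \<Rightarrow> bool" where
  "holomorphic_map_on f U \<longleftrightarrow> open U \<and>
     (\<forall>x\<in>U. \<exists>f'. Vector_Spaces.linear (*s) (*s) f' \<and> (f has_derivative f') (at x))"

definition linear_part :: "(complex ^ 'n \<Rightarrow> complex ^ 'n) \<Rightarrow> complex ^ 'n ^ 'n" where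
  "linear_part X = matrix (frechet_derivative X (at 0))"

definition lie_bracket ::
    "(complex ^ 'n \<Rightarrow> complex ^ 'n) \<Rightarrow> (complex ^ 'n \<Rightarrow> complex ^ 'n) \<Rightarrow> complex ^ 'n \<Rightarrow> complex ^ 'n" where
  "lie_bracket X Y x = frechet_derivative Y (at x) (X x) - frechet_derivative X (at x) (Y x)"

text \<open>The push-forward of \<open>X\<close> under a diffeomorphism \<open>\<phi>\<close> with inverse \<open>\<psi>\<close>, that is, the
  expression of \<open>X\<close> in the coordinates \<open>\<phi>\<close>.\<close>

definition push_forward ::
    "(complex ^ 'n \<Rightarrow> complex ^ 'n) \<Rightarrow> (complex ^ 'n \<Rightarrow> complex ^ 'n) \<Rightarrow>
     (complex ^ 'n \<Rightarrow> complex ^ 'n) \<Rightarrow> complex ^ 'n \<Rightarrow> complex ^ 'n" where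
  "push_forward \<phi> \<psi> X y = frechet_derivative \<phi> (at (\<psi> y)) (X (\<psi> y))"

definition biholomorphism ::
    "(complex ^ 'n) set \<Rightarrow> (complex ^ 'n) set \<Rightarrow>
     (complex ^ 'n \<Rightarrow> complex ^ 'n) \<Rightarrow> (complex ^ 'n \<Rightarrow> complex ^ 'n) \<Rightarrow> bool" where
  "biholomorphism U V \<phi> \<psi> \<longleftrightarrow>
     homeomorphism U V \<phi> \<psi> \<and> holomorphic_map_on \<phi> U \<and> holomorphic_map_on \<psi> V"


section \<open>Poincare-Dulac normal form\<close>

definition diagonal_matrix :: "complex ^ 'n \<Rightarrow> complex ^ 'n ^ 'n" where
  "diagonal_matrix \<gamma> = (\<chi> i j. if i = j then \<gamma> $ i else 0)"

definition diagonalizes :: "complex ^ 'n ^ 'n \<Rightarrow> complex ^ 'n ^ 'n \<Rightarrow> complex ^ 'n \<Rightarrow> bool" where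
  "diagonalizes P S \<gamma> \<longleftrightarrow> invertible P \<and> P ** S ** matrix_inv P = diagonal_matrix \<gamma>"

text \<open>Over \<open>\<complex>\<close>, semisimple means diagonalizable.\<close>

definition semisimple_matrix :: "complex ^ 'n ^ 'n \<Rightarrow> bool" where
  "semisimple_matrix S \<longleftrightarrow> (\<exists>P \<gamma>. diagonalizes P S \<gamma>)"

text \<open>The iterate is spelled out because \<open>N ^ m\<close> would be the entrywise power.\<close>

definition nilpotent_matrix :: "complex ^ 'n ^ 'n \<Rightarrow> bool" where
  "nilpotent_matrix N \<longleftrightarrow> (\<exists>m. ((**) N ^^ m) (mat 1) = 0)"

definition jordan_decomposition ::
    "complex ^ 'n ^ 'n \<Rightarrow> complex ^ 'n ^ 'n \<Rightarrow> complex ^ 'n ^ 'n \<Rightarrow> bool" where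
  "jordan_decomposition A S N \<longleftrightarrow>
     A = S + N \<and> semisimple_matrix S \<and> nilpotent_matrix N \<and> S ** N = N ** S"

text \<open>Since the Jordan decomposition exists and is unique, the existential quantifier merely
  introduces a name for the semisimple part.\<close>

definition poincare_dulac_normal_form :: "(complex ^ 'n \<Rightarrow> complex ^ 'n) \<Rightarrow> bool" where
  "poincare_dulac_normal_form X \<longleftrightarrow>
     (\<exists>S N. jordan_decomposition (linear_part X) S N \<and>
            (\<forall>\<^sub>F x in nhds 0. lie_bracket X ((*v) S) x = 0))"

text \<open>\<open>D\<close> is the neighbourhood of \<open>0\<close> on which \<open>X\<close> is given.\<close>

definition admits_convergent_normalization ::
    "(complex ^ 'n) set \<Rightarrow> (complex ^ 'n \<Rightarrow> complex ^ 'n) \<Rightarrow> bool" where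
  "admits_convergent_normalization D X \<longleftrightarrow>
     (\<exists>U V \<phi> \<psi>. 0 \<in> U \<and> U \<subseteq> D \<and> biholomorphism U V \<phi> \<psi> \<and> \<phi> 0 = 0 \<and>
        poincare_dulac_normal_form (push_forward \<phi> \<psi> X))"


section \<open>Resonances, the lattice and the toric degree\<close>

definition resonances :: "complex ^ 'n \<Rightarrow> (int ^ 'n) set" where
  "resonances \<gamma> = {c. (\<Sum>j\<in>UNIV. of_int (c $ j) * \<gamma> $ j) = 0 \<and> (\<forall>j. c $ j \<ge> -1) \<and>
                      (\<Sum>j\<in>UNIV. c $ j) \<ge> 1 \<and> card {j. c $ j < 0} \<le> 1}"

definition resonance_lattice :: "complex ^ 'n \<Rightarrow> (int ^ 'n) set" where
  "resonance_lattice \<gamma> = {\<rho>. (\<forall>c\<in>resonances \<gamma>. (\<Sum>j\<in>UNIV. \<rho> $ j * c $ j) = 0) \<and>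
                             (\<forall>j k. \<gamma> $ j = \<gamma> $ k \<longrightarrow> \<rho> $ j = \<rho> $ k)}"

global_interpretation int_vec: module "(*s) :: int \<Rightarrow> int ^ 'n \<Rightarrow> int ^ 'n"
  by unfold_locales (simp_all add: vec_eq_iff algebra_simps)

definition lattice_rank :: "(int ^ 'n) set \<Rightarrow> nat" where
  "lattice_rank L = (THE r. \<exists>B. finite B \<and> int_vec.independent B \<and> int_vec.span B = L \<and> card B = r)"

definition toric_degree :: "complex ^ 'n \<Rightarrow> nat" where
  "toric_degree \<gamma> = lattice_rank (resonance_lattice \<gamma>)"

text \<open>Basis vectors are numbered \<open>\<rho> 0, \<dots>, \<rho> (r - 1)\<close>; other values of \<open>\<rho>\<close> are irrelevant.\<close>

definition lattice_basis :: "nat \<Rightarrow> (nat \<Rightarrow> int ^ 'n) \<Rightarrow> (int ^ 'n) set \<Rightarrow> bool" where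
  "lattice_basis r \<rho> L \<longleftrightarrow> inj_on \<rho> {..<r} \<and> int_vec.independent (\<rho> ` {..<r}) \<and>
                           int_vec.span (\<rho> ` {..<r}) = L"

text \<open>The linear vector field \<open>\<Sum>j. \<rho>\<^sub>j x\<^sub>j \<partial>/\<partial>x\<^sub>j\<close> in the linear coordinates \<open>x = P z\<close>, expressed in the
  standard coordinates \<open>z\<close>.\<close>

definition torus_generator :: "complex ^ 'n ^ 'n \<Rightarrow> int ^ 'n \<Rightarrow> complex ^ 'n \<Rightarrow> complex ^ 'n" where
  "torus_generator P \<rho> z = matrix_inv P *v (\<chi> j. of_int (\<rho> $ j) * (P *v z) $ j)"


section \<open>Torus actions\<close>

text \<open>A point of \<open>(\<real>/2\<pi>\<int>)\<^sup>r\<close> is represented by a sequence \<open>t\<close> of reals, of which only \<open>t 0, \<dots>, t (r - 1)\<close>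
  modulo \<open>2\<pi>\<close> matter. (A finite index type would exclude \<open>r = 0\<close>, which occurs when all
  eigenvalues vanish.) The resulting map from \<open>nat \<Rightarrow> real\<close> onto the torus is an open surjection, so joint
  continuity on \<open>UNIV \<times> U\<close> is joint continuity on the torus times \<open>U\<close>.\<close>

definition torus_eq :: "nat \<Rightarrow> (nat \<Rightarrow> real) \<Rightarrow> (nat \<Rightarrow> real) \<Rightarrow> bool" where
  "torus_eq r s t \<longleftrightarrow> (\<forall>k<r. [s k = t k] (rmod (2 * pi)))"

definition holomorphic_torus_action ::
    "nat \<Rightarrow> (complex ^ 'n) set \<Rightarrow> ((nat \<Rightarrow> real) \<Rightarrow> complex ^ 'n \<Rightarrow> complex ^ 'n) \<Rightarrow> bool" where
  "holomorphic_torus_action r U \<alpha> \<longleftrightarrow>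
     (\<forall>s t. torus_eq r s t \<longrightarrow> (\<forall>x\<in>U. \<alpha> s x = \<alpha> t x)) \<and>
     (\<forall>t. \<alpha> t ` U \<subseteq> U) \<and>
     (\<forall>x\<in>U. \<alpha> (\<lambda>_. 0) x = x) \<and>
     (\<forall>s t. \<forall>x\<in>U. \<alpha> (\<lambda>k. s k + t k) x = \<alpha> s (\<alpha> t x)) \<and>
     continuous_on (UNIV \<times> U) (\<lambda>(t, x). \<alpha> t x) \<and>
     (\<forall>t. holomorphic_map_on (\<alpha> t) U)"

definition effective_action ::
    "nat \<Rightarrow> (complex ^ 'n) set \<Rightarrow> ((nat \<Rightarrow> real) \<Rightarrow> complex ^ 'n \<Rightarrow> complex ^ 'n) \<Rightarrow> bool" where
  "effective_action r U \<alpha> \<longleftrightarrow> (\<forall>t. (\<forall>x\<in>U. \<alpha> t x = x) \<longrightarrow> torus_eq r t (\<lambda>_. 0))"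

definition action_preserves ::
    "(complex ^ 'n) set \<Rightarrow> ((nat \<Rightarrow> real) \<Rightarrow> complex ^ 'n \<Rightarrow> complex ^ 'n) \<Rightarrow>
     (complex ^ 'n \<Rightarrow> complex ^ 'n) \<Rightarrow> bool" where
  "action_preserves U \<alpha> X \<longleftrightarrow>
     (\<forall>t. \<forall>x\<in>U. frechet_derivative (\<alpha> t) (at x) (X x) = X (\<alpha> t x))"

text \<open>For each \<open>k < r\<close>, the linear part at \<open>0\<close> of the \<open>k\<close>-th circle subgroup is the flow of (the real
  part of) the linear vector field \<open>\<i> Z k\<close>.\<close>

definition linear_part_generated_by ::
    "nat \<Rightarrow> ((nat \<Rightarrow> real) \<Rightarrow> complex ^ 'n \<Rightarrow> complex ^ 'n) \<Rightarrow>
     (nat \<Rightarrow> complex ^ 'n \<Rightarrow> complex ^ 'n) \<Rightarrow> bool" where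
  "linear_part_generated_by r \<alpha> Z \<longleftrightarrow>
     (\<forall>k<r. \<forall>z s. ((\<lambda>s. frechet_derivative (\<alpha> ((\<lambda>_. 0)(k := s))) (at 0) z) has_vector_derivative
        \<i> *s Z k (frechet_derivative (\<alpha> ((\<lambda>_. 0)(k := s))) (at 0) z)) (at s))"

end

theory Submission
  imports Defs "HOL-Complex_Analysis.Cauchy_Integral_Formula"
begin

text \<open>Let \<open>T\<^sub>t\<close> be the diagonal linear torus action with the weights of the lattice, in coordinates that
  diagonalize the semisimple part. The bridge between the two sides of the equivalence is that a
  vector field commutes with the semisimple linear field \<open>\<Gamma>\<close> with eigenvalues \<open>\<gamma>\<close> if and only if it
  is invariant under all \<open>T\<^sub>t\<close>.

  Suppose that \<open>W\<close> is in normal form, so \<open>[W, \<Gamma>] = 0\<close>. Then only monomials \<open>x\<^sup>m \<partial>/\<partial>x\<^sub>k\<close> with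
  \<open>\<Sum>m\<^sub>i \<gamma>\<^sub>i = \<gamma>\<^sub>k\<close> occur in \<open>W\<close>. Such a monomial either comes from a resonance relation or is linear
  with two equal eigenvalues, and in both cases every \<open>\<rho>\<close> in the lattice satisfies
  \<open>\<Sum>m\<^sub>i \<rho>\<^sub>i = \<rho>\<^sub>k\<close> (\<open>resonant_monomial\<close>); hence \<open>T\<^sub>t\<close> preserves \<open>W\<close>. To avoid power series in
  several variables, the expansion is carried out one variable at a time, by induction on the set of
  variables involved (\<open>euler_eigenfunction_equivariant\<close>). The torus acts on a polydisc in the
  normalizing coordinates, and this action is carried back to the given ones. It is effective because
  the lattice is cut out by integral linear equations and is therefore saturated in \<open>\<int>\<^sup>n\<close>. The
  normalizing coordinates need not be tangent to the identity; uniqueness of the Jordan decomposition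
  (\<open>jordan_semisimple_part_unique\<close>) shows that the semisimple part found in them is the
  conjugate of the given one, so that the weights are the right ones with respect to the given
  diagonalizing matrix.

  Conversely, a torus action that preserves \<open>X\<close> is conjugated to its linear part by averaging,
  one circle factor after the other (\<open>linearizing_map\<close>). The averaged map is tangent to the
  identity, so it is a local biholomorphism, and in the new coordinates \<open>X\<close> commutes with each linear
  circle action and thus with each generator \<open>Z\<^sub>k\<close>. The vector \<open>\<gamma>\<close> is a complex combination of lattice
  vectors, since it solves the integral linear equations that define the lattice
  (\<open>eigenvalues_in_span_of_lattice\<close>). So \<open>\<Gamma>\<close> is a combination of the \<open>Z\<^sub>k\<close> and commutes with \<open>X\<close>.

  Both directions rest on one analytic fact: the integral of a family of holomorphic maps over a
  compact interval is holomorphic and may be differentiated under the integral sign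
  (\<open>holomorphic_map_integral\<close>). By Cauchy's formula on complex lines it implies that derivatives of
  holomorphic maps are holomorphic.\<close>

section \<open>Complex-linear and holomorphic maps\<close>

abbreviation clinear :: "(complex ^ 'n \<Rightarrow> complex ^ 'm) \<Rightarrow> bool" where
  "clinear f \<equiv> Vector_Spaces.linear (*s) (*s) f"

lemma clinear_iff:
  fixes f :: "complex ^ 'n \<Rightarrow> complex ^ 'm"
  shows "clinear f \<longleftrightarrow> (\<forall>x y. f (x + y) = f x + f y) \<and> (\<forall>c x. f (c *s x) = c *s f x)"
  by (auto simp: Vector_Spaces.linear_iff vec.vector_space_axioms)

lemma clinear_comp: "clinear f \<Longrightarrow> clinear g \<Longrightarrow> clinear (\<lambda>x. f (g x))"
  by (simp add: clinear_iff)

lemma clinear_sum: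
  assumes "clinear f" shows "f (\<Sum>i\<in>I. g i) = (\<Sum>i\<in>I. f (g i))"
proof -
  have "f 0 = 0" using assms clinear_iff by (metis add_cancel_right_right)
  then show ?thesis using assms clinear_iff[of f]
    by (induction I rule: infinite_finite_induct) auto
qed

lemma norm_smult_vec: "norm (c *s (x :: complex ^ 'n)) = norm c * norm x"
proof -
  have "norm (c *s x) = L2_set (\<lambda>i. norm c * norm (x $ i)) UNIV"
    by (simp add: norm_vec_def norm_mult)
  also have "\<dots> = norm c * norm x"
    by (simp add: norm_vec_def L2_set_right_distrib)
  finally show ?thesis .
qed

interpretation smult: bounded_bilinear "(*s) :: complex \<Rightarrow> complex ^ 'n \<Rightarrow> complex ^ 'n"
proof
  show "\<exists>K. \<forall>a b. norm (a *s (b :: complex ^ 'n)) \<le> norm a * norm b * K"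
    by (rule exI[of _ 1]) (simp add: norm_smult_vec)
qed (auto simp: vec_eq_iff algebra_simps)

lemma holomorphic_map_openD: "holomorphic_map_on f U \<Longrightarrow> open U"
  by (simp add: holomorphic_map_on_def)

lemma holomorphic_map_has_derivative:
  assumes "holomorphic_map_on f U" "x \<in> U"
  shows "(f has_derivative frechet_derivative f (at x)) (at x)"
  using assms unfolding holomorphic_map_on_def by (metis frechet_derivative_at)

lemma holomorphic_map_clinear:
  assumes "holomorphic_map_on f U" "x \<in> U"
  shows "clinear (frechet_derivative f (at x))"
  using assms unfolding holomorphic_map_on_def by (metis frechet_derivative_at)

lemma holomorphic_map_onI:
  assumes "open U" "\<And>x. x \<in> U \<Longrightarrow> (f has_derivative f' x) (at x)" "\<And>x. x \<in> U \<Longrightarrow> clinear (f' x)"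
  shows "holomorphic_map_on f U"
  using assms unfolding holomorphic_map_on_def by blast

lemma holomorphic_map_on_subset:
  "holomorphic_map_on f U \<Longrightarrow> open V \<Longrightarrow> V \<subseteq> U \<Longrightarrow> holomorphic_map_on f V"
  unfolding holomorphic_map_on_def by blast

lemma holomorphic_map_on_cong:
  assumes "holomorphic_map_on f U" "\<And>x. x \<in> U \<Longrightarrow> f x = g x"
  shows "holomorphic_map_on g U"
proof (rule holomorphic_map_onI)
  show "open U" using assms holomorphic_map_openD by blast
  show "(g has_derivative frechet_derivative f (at x)) (at x)" if "x \<in> U" for x
    using holomorphic_map_has_derivative[OF assms(1) that] assms(2) that \<open>open U\<close>
    by (blast intro: has_derivative_transform_within_open)
qed (use assms holomorphic_map_clinear in blast)

lemma holomorphic_map_local: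
  assumes "\<And>x. x \<in> U \<Longrightarrow> \<exists>V. x \<in> V \<and> V \<subseteq> U \<and> holomorphic_map_on f V"
  shows "holomorphic_map_on f U"
  unfolding holomorphic_map_on_def
proof (intro conjI ballI)
  show "open U" using assms holomorphic_map_openD by (meson open_subopen)
  fix x assume "x \<in> U"
  then show "\<exists>f'. clinear f' \<and> (f has_derivative f') (at x)"
    using assms unfolding holomorphic_map_on_def by blast
qed

lemma holomorphic_map_continuous: "holomorphic_map_on f U \<Longrightarrow> continuous_on U f"
  by (meson continuous_at_imp_continuous_on has_derivative_continuous holomorphic_map_has_derivative)

lemma holomorphic_map_clinear_map:
  fixes f :: "complex ^ 'n \<Rightarrow> complex ^ 'm"
  assumes "clinear f" shows "holomorphic_map_on f UNIV" "(f has_derivative f) (at x)"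
proof -
  have "f = (*v) (matrix f)" using matrix_works[OF assms] by auto
  then have "bounded_linear f" by (metis matrix_vector_mul_bounded_linear)
  then show "(f has_derivative f) (at x)" for x by (rule bounded_linear_imp_has_derivative)
  then show "holomorphic_map_on f UNIV" using assms by (rule holomorphic_map_onI[OF open_UNIV, where f' = "\<lambda>_. f"])
qed

lemma frechet_derivative_comp:
  assumes "holomorphic_map_on f U" "holomorphic_map_on g V" "x \<in> U" "f x \<in> V"
  shows "frechet_derivative (\<lambda>x. g (f x)) (at x) v
         = frechet_derivative g (at (f x)) (frechet_derivative f (at x) v)"
proof -
  have "((\<lambda>x. g (f x)) has_derivative
      (\<lambda>v. frechet_derivative g (at (f x)) (frechet_derivative f (at x) v))) (at x)"
    using holomorphic_map_has_derivative[OF assms(1,3)] holomorphic_map_has_derivative[OF assms(2,4)]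
    by (rule has_derivative_compose)
  from frechet_derivative_at[OF this] show ?thesis by metis
qed

lemma holomorphic_map_comp:
  assumes "holomorphic_map_on f U" "holomorphic_map_on g V" "f ` U \<subseteq> V"
  shows "holomorphic_map_on (\<lambda>x. g (f x)) U"
proof (rule holomorphic_map_onI)
  show "open U" using assms holomorphic_map_openD by blast
  fix x assume x: "x \<in> U"
  then have fx: "f x \<in> V" using assms by blast
  show "((\<lambda>x. g (f x)) has_derivative
      (\<lambda>v. frechet_derivative g (at (f x)) (frechet_derivative f (at x) v))) (at x)"
    using holomorphic_map_has_derivative[OF assms(1) x] holomorphic_map_has_derivative[OF assms(2) fx]
    by (rule has_derivative_compose)
  show "clinear (\<lambda>v. frechet_derivative g (at (f x)) (frechet_derivative f (at x) v))"
    by (rule clinear_comp[OF holomorphic_map_clinear[OF assms(2) fx] holomorphic_map_clinear[OF assms(1) x]])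
qed

lemma holomorphic_map_affine_preimage:
  assumes "holomorphic_map_on f U" 
  shows "holomorphic_map_on (\<lambda>x. f (x + v)) ((\<lambda>x. x + v) -` U)"
    and "x + v \<in> U \<Longrightarrow> frechet_derivative (\<lambda>x. f (x + v)) (at x) = frechet_derivative f (at (x + v))"
proof -
  have D: "((\<lambda>x. f (x + v)) has_derivative frechet_derivative f (at (x + v))) (at x)"
    if "x + v \<in> U" for x
  proof -
    have "((\<lambda>x. x + v) has_derivative (\<lambda>h. h)) (at x)" by (auto intro!: derivative_eq_intros)
    from has_derivative_compose[OF this holomorphic_map_has_derivative[OF assms that]]
    show ?thesis by simp
  qed
  have "continuous_on UNIV (\<lambda>x. x + v)" by (intro continuous_intros)
  then have "open ((\<lambda>x. x + v) -` U)"
    using holomorphic_map_openD[OF assms] by (simp add: open_vimage)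
  then show "holomorphic_map_on (\<lambda>x. f (x + v)) ((\<lambda>x. x + v) -` U)"
    by (rule holomorphic_map_onI) (use D holomorphic_map_clinear[OF assms] in auto)
  show "x + v \<in> U \<Longrightarrow> frechet_derivative (\<lambda>x. f (x + v)) (at x) = frechet_derivative f (at (x + v))"
    using frechet_derivative_at[OF D] by simp
qed

lemma holomorphic_map_smult:
  assumes "holomorphic_map_on f U" 
  shows "holomorphic_map_on (\<lambda>x. c *s f x) U"
    and "x \<in> U \<Longrightarrow> frechet_derivative (\<lambda>x. c *s f x) (at x) v = c *s frechet_derivative f (at x) v"
proof -
  have D: "((\<lambda>x. c *s f x) has_derivative (\<lambda>v. c *s frechet_derivative f (at x) v)) (at x)"
    if "x \<in> U" for x
    using smult.FDERIV[OF has_derivative_const[of c] holomorphic_map_has_derivative[OF assms that]]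
    by (simp)
  show "holomorphic_map_on (\<lambda>x. c *s f x) U"
  proof (rule holomorphic_map_onI[OF holomorphic_map_openD[OF assms] D])
    fix x assume "x \<in> U"
    with holomorphic_map_clinear[OF assms this] show "clinear (\<lambda>v. c *s frechet_derivative f (at x) v)"
      by (auto simp: clinear_iff vec_eq_iff algebra_simps)
  qed
  show "x \<in> U \<Longrightarrow> frechet_derivative (\<lambda>x. c *s f x) (at x) v = c *s frechet_derivative f (at x) v"
    using frechet_derivative_at[OF D] by metis
qed

section \<open>Circle averages and holomorphic dependence on parameters\<close>

text \<open>Cauchy's formula for the higher derivatives at the centre of the circle of radius \<open>R\<close>, with the
  circle parametrized by \<open>[0, 1]\<close>. All contour integrals below are used in this form.\<close>

lemma taylor_coeff_circle:
  assumes h: "h holomorphic_on A" "open A" "cball 0 R \<subseteq> A" and R: "0 < R"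
  shows "(deriv ^^ p) h 0 / fact p = integral {0..1} (\<lambda>s. h (R * cis (2 * pi * s)) / (R * cis (2 * pi * s)) ^ p)"
proof -
  \<comment> \<open>The exponent is \<open>Suc p\<close> because the derivative of the parametrization cancels one power.\<close>
  have "((\<lambda>u. h u / (u - 0) ^ Suc p) has_contour_integral (2 * pi * \<i>) / fact p * (deriv ^^ p) h 0) (circlepath 0 R)"
  proof (rule Cauchy_has_contour_integral_higher_derivative_circlepath)
    show "continuous_on (cball 0 R) h"
      using h by (meson continuous_on_subset holomorphic_on_imp_continuous_on)
    show "h holomorphic_on ball 0 R"
      using h ball_subset_cball by (meson holomorphic_on_subset order_trans)
  qed (use R in auto)
  then have I: "((\<lambda>s. h (circlepath 0 R s) / (circlepath 0 R s - 0) ^ Suc p * vector_derivative (circlepath 0 R) (at s within {0..1}))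
      has_integral (2 * pi * \<i>) / fact p * (deriv ^^ p) h 0) {0..1}"
    by (simp add: has_contour_integral_def)
  have "((\<lambda>s. (2 * pi * \<i>) * (h (R * cis (2 * pi * s)) / (R * cis (2 * pi * s)) ^ p))
      has_integral (2 * pi * \<i>) / fact p * (deriv ^^ p) h 0) {0..1}"
  proof (rule has_integral_eq[OF _ I])
    fix s :: real assume s: "s \<in> {0..1}"
    have e: "exp (2 * of_real pi * \<i> * of_real s) = cis (2 * pi * s)"
      by (simp add: cis_conv_exp mult_ac)
    have vd: "vector_derivative (circlepath 0 R) (at s within {0..1}) = 2 * pi * \<i> * R * cis (2 * pi * s)"
      using vector_derivative_circlepath01[of s 0 R] s by (simp add: e)
    have cp: "circlepath 0 R s = R * cis (2 * pi * s)" unfolding circlepath by (simp add: e)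
    show "h (circlepath 0 R s) / (circlepath 0 R s - 0) ^ Suc p * vector_derivative (circlepath 0 R) (at s within {0..1})
       = (2 * pi * \<i>) * (h (R * cis (2 * pi * s)) / (R * cis (2 * pi * s)) ^ p)"
      unfolding cp vd using R by (simp add: field_simps)
  qed
  from has_integral_mult_right[OF this, of "1 / (2 * pi * \<i>)"]
  have "((\<lambda>s. h (R * cis (2 * pi * s)) / (R * cis (2 * pi * s)) ^ p)
      has_integral (deriv ^^ p) h 0 / fact p) {0..1}"
    by (simp add: field_simps)
  then show ?thesis by (simp add: integral_unique)
qed


lemma integral_vec_nth:
  fixes f :: "real \<Rightarrow> complex ^ 'n"
  assumes "f integrable_on S"
  shows "integral S f $ i = integral S (\<lambda>s. f s $ i)"
  using integral_linear[OF assms bounded_linear_vec_nth[of i]] by (simp add: o_def)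

lemma holomorphic_slice:
  assumes "holomorphic_map_on f U"
  shows "open {\<zeta>. x + \<zeta> *s v \<in> U}"
    and "x + \<zeta> *s v \<in> U \<Longrightarrow> ((\<lambda>\<zeta>. f (x + \<zeta> *s v) $ i) has_field_derivative
           frechet_derivative f (at (x + \<zeta> *s v)) v $ i) (at \<zeta>)"
    and "(\<lambda>\<zeta>. f (x + \<zeta> *s v) $ i) holomorphic_on {\<zeta>. x + \<zeta> *s v \<in> U}"
proof -
  have "continuous_on UNIV (\<lambda>\<zeta>. x + \<zeta> *s v)" by (intro continuous_intros smult.continuous_on)
  then show "open {\<zeta>. x + \<zeta> *s v \<in> U}"
    using holomorphic_map_openD[OF assms] open_vimage[of U "\<lambda>\<zeta>. x + \<zeta> *s v"] by (simp add: vimage_def)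
  show D: "((\<lambda>\<zeta>. f (x + \<zeta> *s v) $ i) has_field_derivative
           frechet_derivative f (at (x + \<zeta> *s v)) v $ i) (at \<zeta>)" if "x + \<zeta> *s v \<in> U" for \<zeta>
  proof -
    have d: "((\<lambda>\<zeta>. x + \<zeta> *s v) has_derivative (\<lambda>h. h *s v)) (at \<zeta>)"
      using has_derivative_add[OF has_derivative_const smult.FDERIV[OF has_derivative_ident has_derivative_const[of v]]]
      by simp
    have "((\<lambda>\<zeta>. f (x + \<zeta> *s v)) has_derivative (\<lambda>h. frechet_derivative f (at (x + \<zeta> *s v)) (h *s v))) (at \<zeta>)"
      by (rule has_derivative_compose[OF d holomorphic_map_has_derivative[OF assms that]])
    then have "((\<lambda>\<zeta>. f (x + \<zeta> *s v) $ i) has_derivative (\<lambda>h. frechet_derivative f (at (x + \<zeta> *s v)) (h *s v) $ i)) (at \<zeta>)"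
      by (rule bounded_linear.has_derivative[OF bounded_linear_vec_nth])
    then show ?thesis
      using holomorphic_map_clinear[OF assms that] unfolding has_field_derivative_def clinear_iff
      by (simp add: mult.commute[of _ "frechet_derivative f (at (x + \<zeta> *s v)) v $ i"])
  qed
  show "(\<lambda>\<zeta>. f (x + \<zeta> *s v) $ i) holomorphic_on {\<zeta>. x + \<zeta> *s v \<in> U}"
    using D by (auto simp: holomorphic_on_def field_differentiable_def intro: has_field_derivative_at_within)
qed

text \<open>The one-variable Cauchy formula on the complex line through \<open>x\<close> in direction \<open>v\<close>. It expresses
  the derivative by values of \<open>f\<close> alone, which makes its dependence on \<open>x\<close> and on parameters
  accessible.\<close>

lemma cauchy_directional_derivative:
  assumes "holomorphic_map_on f U" "0 < \<epsilon>" and U: "\<And>\<zeta>. norm \<zeta> \<le> \<epsilon> \<Longrightarrow> x + \<zeta> *s v \<in> U"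
  shows "frechet_derivative f (at x) v =
    integral {0..1} (\<lambda>s. (1 / (\<epsilon> * cis (2 * pi * s))) *s f (x + (\<epsilon> * cis (2 * pi * s)) *s v))"
proof -
  let ?F = "\<lambda>s. (1 / (\<epsilon> * cis (2 * pi * s))) *s f (x + (\<epsilon> * cis (2 * pi * s)) *s v)"
  have "continuous_on {0..1} ?F"
  proof (intro smult.continuous_on continuous_intros continuous_on_compose2[OF holomorphic_map_continuous[OF assms(1)]])
    show "(\<lambda>s. x + (complex_of_real \<epsilon> * cis (2 * pi * s)) *s v) ` {0..1} \<subseteq> U"
      using U \<open>0 < \<epsilon>\<close> by (auto simp: norm_mult)
  qed (use \<open>0 < \<epsilon>\<close> in auto)
  then have int: "?F integrable_on {0..1}"
    using integrable_continuous_interval by blast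
  show ?thesis
  proof (rule vec_eq_iff[THEN iffD2], rule allI)
    fix i
    have "((\<lambda>\<zeta>. f (x + \<zeta> *s v) $ i) has_field_derivative frechet_derivative f (at x) v $ i) (at 0)"
      using holomorphic_slice(2)[OF assms(1), of x 0 v i] U[of 0] \<open>0 < \<epsilon>\<close> by simp
    then have "frechet_derivative f (at x) v $ i = (deriv ^^ 1) (\<lambda>\<zeta>. f (x + \<zeta> *s v) $ i) 0 / fact 1"
      by (simp add: DERIV_imp_deriv)
    also have "\<dots> = integral {0..1} (\<lambda>s. f (x + (\<epsilon> * cis (2 * pi * s)) *s v) $ i / (\<epsilon> * cis (2 * pi * s)) ^ 1)"
      by (rule taylor_coeff_circle[OF holomorphic_slice(3)[OF assms(1)] holomorphic_slice(1)[OF assms(1)]])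
         (use U \<open>0 < \<epsilon>\<close> in auto)
    also have "\<dots> = integral {0..1} ?F $ i"
      by (simp add: integral_vec_nth[OF int])
    finally show "frechet_derivative f (at x) v $ i = integral {0..1} ?F $ i" .
  qed
qed

text \<open>Provides one radius for which the discs in direction \<open>v\<close> around all points near \<open>x0\<close> stay in
  \<open>U\<close>, so that Cauchy's formula can be applied uniformly.\<close>

lemma uniform_polydisc_radius:
  fixes x0 v :: "complex ^ 'n"
  assumes "open U" "x0 \<in> U"
  obtains \<delta> \<epsilon> where "0 < \<delta>" "0 < \<epsilon>" "ball x0 \<delta> \<subseteq> U"
    "\<And>x \<zeta>. x \<in> ball x0 \<delta> \<Longrightarrow> norm \<zeta> \<le> \<epsilon> \<Longrightarrow> x + \<zeta> *s v \<in> U"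
proof -
  obtain e where e: "e > 0" "ball x0 e \<subseteq> U" using assms open_contains_ball by blast
  let ?\<epsilon> = "e / (2 * (norm v + 1))"
  have nv: "norm v + 1 > 0" by (smt (verit) norm_ge_zero)
  show ?thesis
  proof (rule that[of "e / 2" ?\<epsilon>])
    fix x :: "complex ^ 'n" and \<zeta> :: complex assume x: "x \<in> ball x0 (e / 2)" and z: "norm \<zeta> \<le> ?\<epsilon>"
    have "norm (\<zeta> *s v) \<le> ?\<epsilon> * norm v" using mult_right_mono[OF z norm_ge_zero] by (simp only: norm_smult_vec)
    also have "\<dots> \<le> e / 2"
      using nv e(1) by (simp add: field_simps)
    finally have "dist x0 (x + \<zeta> *s v) < e"
      using x dist_triangle[of x0 "x + \<zeta> *s v" x] by (simp add: dist_norm)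
    then show "x + \<zeta> *s v \<in> U" using e by auto
  qed (use e nv in auto)
qed

text \<open>Joint continuity passes from \<open>g\<close> to its derivative because the derivative is an integral of
  \<open>g\<close> over a small circle. This is what the Leibniz rule needs as a hypothesis.\<close>

lemma continuous_on_frechet_derivative_param:
  fixes g :: "real \<Rightarrow> complex ^ 'n \<Rightarrow> complex ^ 'm"
  assumes cont: "continuous_on (K \<times> U) (\<lambda>(s, x). g s x)"
    and hol: "\<And>s. s \<in> K \<Longrightarrow> holomorphic_map_on (g s) U"
  shows "continuous_on (K \<times> U) (\<lambda>(s, x). frechet_derivative (g s) (at x) v)"
proof (cases "K = {}")
  case False
  then have "open U" using hol holomorphic_map_openD by blast
  show ?thesis
    unfolding continuous_on_eq_continuous_within
  proof clarify
    fix s0 x0 assume s0: "s0 \<in> K" and x0: "x0 \<in> U"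
    obtain \<delta> \<epsilon> where \<delta>: "0 < \<delta>" "0 < \<epsilon>" "ball x0 \<delta> \<subseteq> U"
      "\<And>x \<zeta>. x \<in> ball x0 \<delta> \<Longrightarrow> norm \<zeta> \<le> \<epsilon> \<Longrightarrow> x + \<zeta> *s v \<in> U"
      using uniform_polydisc_radius[OF \<open>open U\<close> x0, of v] by blast
    let ?B = "ball x0 \<delta>"
    let ?f = "\<lambda>p u. (1 / (\<epsilon> * cis (2 * pi * u))) *s g (fst p) (snd p + (\<epsilon> * cis (2 * pi * u)) *s v)"
    have "continuous_on ((K \<times> ?B) \<times> cbox 0 1) (\<lambda>(p, u). ?f p u)"
      unfolding split_beta
    proof (intro smult.continuous_on continuous_intros
        continuous_on_compose2[OF cont[unfolded split_beta],
          where f = "\<lambda>q. (fst (fst q), snd (fst q) + (\<epsilon> * cis (2 * pi * snd q)) *s v)", simplified])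
      show "(\<lambda>q. (fst (fst q), snd (fst q) + (\<epsilon> * cis (2 * pi * snd q)) *s v)) ` ((K \<times> ?B) \<times> cbox 0 1) \<subseteq> K \<times> U"
      proof (rule image_subsetI)
        fix q assume "q \<in> (K \<times> ?B) \<times> cbox 0 (1::real)"
        then show "(fst (fst q), snd (fst q) + (\<epsilon> * cis (2 * pi * snd q)) *s v) \<in> K \<times> U"
          using \<delta>(4)[of "snd (fst q)" "\<epsilon> * cis (2 * pi * snd q)"] \<delta>(2) by (auto simp: norm_mult)
      qed
    qed (use \<delta>(2) in auto)
    then have "continuous_on (K \<times> ?B) (\<lambda>p. integral (cbox 0 1) (?f p))"
      by (rule integral_continuous_on_param)
    then have "continuous_on (K \<times> ?B) (\<lambda>(s, x). frechet_derivative (g s) (at x) v)"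
    proof (rule continuous_on_eq)
      fix p assume "p \<in> K \<times> ?B"
      then obtain s x where p: "p = (s, x)" "s \<in> K" "x \<in> ?B" by auto
      show "integral (cbox 0 1) (?f p) = (\<lambda>(s, x). frechet_derivative (g s) (at x) v) p"
        using cauchy_directional_derivative[OF hol[OF p(2)] \<delta>(2), of x v] \<delta>(4)[OF p(3)] p(1) by simp
    qed
    then have "continuous (at (s0, x0) within (K \<times> ?B)) (\<lambda>(s, x). frechet_derivative (g s) (at x) v)"
      using s0 \<delta>(1) by (auto simp: continuous_on_eq_continuous_within)
    moreover have "at (s0, x0) within (K \<times> U) = at (s0, x0) within (K \<times> ?B)"
      by (rule at_within_nhd[where S = "UNIV \<times> ?B"]) (use \<delta> in \<open>auto intro: open_Times\<close>)
    ultimately show "continuous (at (s0, x0) within (K \<times> U)) (\<lambda>(s, x). frechet_derivative (g s) (at x) v)"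
      by simp
  qed
qed auto

lemma holomorphic_map_bounded_linear:
  assumes "holomorphic_map_on f U" "x \<in> U"
  shows "bounded_linear (frechet_derivative f (at x))"
  using has_derivative_bounded_linear[OF holomorphic_map_has_derivative[OF assms]] .

lemma continuous_on_blinfun_frechet_derivative:
  fixes g :: "real \<Rightarrow> complex ^ 'n \<Rightarrow> complex ^ 'm"
  assumes cont: "continuous_on (K \<times> U) (\<lambda>(s, x). g s x)"
    and hol: "\<And>s. s \<in> K \<Longrightarrow> holomorphic_map_on (g s) U"
  shows "continuous_on (K \<times> U) (\<lambda>(s, x). Blinfun (frechet_derivative (g s) (at x)))"
proof (rule continuous_on_blinfun_componentwise)
  fix v :: "complex ^ 'n"
  show "continuous_on (K \<times> U) (\<lambda>p. blinfun_apply (case p of (s, x) \<Rightarrow> Blinfun (frechet_derivative (g s) (at x))) v)"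
    using continuous_on_frechet_derivative_param[OF assms, of v]
    by (rule continuous_on_eq)
      (auto simp: bounded_linear_Blinfun_apply holomorphic_map_bounded_linear[OF hol])
qed

text \<open>Differentiation under the integral sign; the derivative of the integral is complex linear as an
  integral of complex-linear maps.\<close>

lemma holomorphic_map_integral:
  fixes g :: "real \<Rightarrow> complex ^ 'n \<Rightarrow> complex ^ 'm"
  assumes cont: "continuous_on ({0..1} \<times> U) (\<lambda>(s, x). g s x)"
    and hol: "\<And>s. s \<in> {0..1} \<Longrightarrow> holomorphic_map_on (g s) U"
  shows "holomorphic_map_on (\<lambda>x. integral {0..1} (\<lambda>s. g s x)) U"
    and "x \<in> U \<Longrightarrow> frechet_derivative (\<lambda>x. integral {0..1} (\<lambda>s. g s x)) (at x) v
           = integral {0..1} (\<lambda>s. frechet_derivative (g s) (at x) v)"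
    and "x \<in> U \<Longrightarrow> (\<lambda>s. frechet_derivative (g s) (at x) v) integrable_on {0..1}"
proof -
  have U: "open U" using hol[of 0] holomorphic_map_openD by auto
  define G where "G = (\<lambda>x s. Blinfun (frechet_derivative (g s) (at x)))"
  have Gapp: "blinfun_apply (G x s) = frechet_derivative (g s) (at x)" if "s \<in> {0..1}" "x \<in> U" for s x
    unfolding G_def by (rule bounded_linear_Blinfun_apply[OF holomorphic_map_bounded_linear[OF hol[OF that(1)] that(2)]])
  have swap: "prod.swap ` (U \<times> cbox 0 (1::real)) \<subseteq> {0..1} \<times> U" by auto
  \<comment> \<open>The Leibniz rule expects the integration variable as the second argument.\<close>
  have contG: "continuous_on (U \<times> cbox 0 1) (\<lambda>(x, s). G x s)"
    using continuous_on_compose2[OF continuous_on_blinfun_frechet_derivative[OF cont hol],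
        where f = prod.swap and s = "U \<times> cbox 0 1"] swap
    by (simp add: G_def case_prod_beta' continuous_on_swap)
  have Gint: "(\<lambda>s. G x s) integrable_on {0..1}" if "x \<in> U" for x
  proof (rule integrable_continuous_interval)
    show "continuous_on {0..1} (G x)"
      using continuous_on_compose2[OF contG continuous_on_Pair[OF continuous_on_const[of _ x] continuous_on_id[of "{0..1}"]]] that
      by auto
  qed
  have Gi: "blinfun_apply (integral {0..1} (G x)) v = integral {0..1} (\<lambda>s. frechet_derivative (g s) (at x) v)"
    and Gi': "(\<lambda>s. frechet_derivative (g s) (at x) v) integrable_on {0..1}" if "x \<in> U" for x v
  proof -
    have eq: "blinfun_apply (G x s) v = frechet_derivative (g s) (at x) v" if "s \<in> {0..1}" for s
      using Gapp[OF that \<open>x \<in> U\<close>] by simp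
    have bl: "bounded_linear (\<lambda>F. blinfun_apply F v)" by (rule blinfun.bounded_linear_left)
    have ieq: "integral {0..1} (\<lambda>s. blinfun_apply (G x s) v) = integral {0..1} (\<lambda>s. frechet_derivative (g s) (at x) v)"
      by (rule integral_cong) (rule eq)
    show "blinfun_apply (integral {0..1} (G x)) v = integral {0..1} (\<lambda>s. frechet_derivative (g s) (at x) v)"
      using integral_linear[OF Gint[OF that] bl] ieq by (simp add: o_def)
    show "(\<lambda>s. frechet_derivative (g s) (at x) v) integrable_on {0..1}"
      using integrable_eq[OF integrable_linear[OF Gint[OF that] bl]] eq by (simp add: o_def)
  qed
  have D: "((\<lambda>x. integral {0..1} (\<lambda>s. g s x)) has_derivative
        (\<lambda>v. integral {0..1} (\<lambda>s. frechet_derivative (g s) (at x) v))) (at x)" if x: "x \<in> U" for x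
  proof -
    obtain \<delta> where \<delta>: "\<delta> > 0" "ball x \<delta> \<subseteq> U" using U x open_contains_ball by blast
    have "((\<lambda>y. integral (cbox 0 1) (\<lambda>s. g s y)) has_derivative blinfun_apply (integral (cbox 0 1) (G x)))
        (at x within ball x \<delta>)"
    proof (rule leibniz_rule)
      fix y s assume y: "y \<in> ball x \<delta>" and s: "s \<in> cbox (0::real) 1"
      then have "y \<in> U" using \<delta> by auto
      with s have "((\<lambda>y. g s y) has_derivative blinfun_apply (G y s)) (at y)"
        using Gapp[of s y] holomorphic_map_has_derivative[OF hol[of s]] by simp
      then show "((\<lambda>y. g s y) has_derivative blinfun_apply (G y s)) (at y within ball x \<delta>)"
        by (rule has_derivative_at_withinI)
    next
      fix y assume "y \<in> ball x \<delta>"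
      then have "y \<in> U" using \<delta> by auto
      then have "continuous_on {0..1} (\<lambda>s. g s y)"
        using continuous_on_compose2[OF cont continuous_on_Pair[OF continuous_on_id[of "{0..1}"] continuous_on_const[of _ y]]]
        by auto
      then show "(\<lambda>s. g s y) integrable_on cbox 0 1"
        using integrable_continuous_interval by auto
    next
      show "continuous_on (ball x \<delta> \<times> cbox 0 1) (\<lambda>(x, s). G x s)"
        using contG by (rule continuous_on_subset) (use \<delta> in auto)
    qed (use \<delta> in auto)
    then have "((\<lambda>y. integral {0..1} (\<lambda>s. g s y)) has_derivative blinfun_apply (integral {0..1} (G x))) (at x)"
      using \<delta> at_within_open[of x "ball x \<delta>"] by simp
    moreover have "blinfun_apply (integral {0..1} (G x)) = (\<lambda>v. integral {0..1} (\<lambda>s. frechet_derivative (g s) (at x) v))"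
      using Gi[OF x] by auto
    ultimately show ?thesis by simp
  qed
  show "x \<in> U \<Longrightarrow> frechet_derivative (\<lambda>x. integral {0..1} (\<lambda>s. g s x)) (at x) v
           = integral {0..1} (\<lambda>s. frechet_derivative (g s) (at x) v)"
    using frechet_derivative_at[OF D] by metis
  show "x \<in> U \<Longrightarrow> (\<lambda>s. frechet_derivative (g s) (at x) v) integrable_on {0..1}"
    by (rule Gi')
  show "holomorphic_map_on (\<lambda>x. integral {0..1} (\<lambda>s. g s x)) U"
  proof (rule holomorphic_map_onI[OF U D])
    fix x assume x: "x \<in> U"
    show "clinear (\<lambda>v. integral {0..1} (\<lambda>s. frechet_derivative (g s) (at x) v))"
      unfolding clinear_iff
    proof (intro conjI allI)
      fix v w
      have "integral {0..1} (\<lambda>s. frechet_derivative (g s) (at x) (v + w))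
        = integral {0..1} (\<lambda>s. frechet_derivative (g s) (at x) v + frechet_derivative (g s) (at x) w)"
        by (rule integral_cong) (use holomorphic_map_clinear[OF hol x] in \<open>simp add: clinear_iff\<close>)
      then show "integral {0..1} (\<lambda>s. frechet_derivative (g s) (at x) (v + w))
        = integral {0..1} (\<lambda>s. frechet_derivative (g s) (at x) v) + integral {0..1} (\<lambda>s. frechet_derivative (g s) (at x) w)"
        by (simp add: integral_add Gi'[OF x])
    next
      fix c v
      have "integral {0..1} (\<lambda>s. frechet_derivative (g s) (at x) (c *s v))
        = integral {0..1} (\<lambda>s. c *s frechet_derivative (g s) (at x) v)"
        by (rule integral_cong) (use holomorphic_map_clinear[OF hol x] in \<open>simp add: clinear_iff\<close>)
      then show "integral {0..1} (\<lambda>s. frechet_derivative (g s) (at x) (c *s v))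
        = c *s integral {0..1} (\<lambda>s. frechet_derivative (g s) (at x) v)"
        using integral_linear[OF Gi'[OF x] smult.bounded_linear_right[of c]] by (simp add: o_def)
    qed
  qed
qed

text \<open>Near each point the derivative is a circle average of translates of \<open>f\<close>, so it is an integral of
  holomorphic maps.\<close>

lemma holomorphic_map_frechet_derivative:
  assumes hol: "holomorphic_map_on f U"
  shows "holomorphic_map_on (\<lambda>x. frechet_derivative f (at x) v) U"
proof (rule holomorphic_map_local)
  fix x0 assume x0: "x0 \<in> U"
  obtain \<delta> \<epsilon> where \<delta>: "0 < \<delta>" "0 < \<epsilon>" "ball x0 \<delta> \<subseteq> U"
      "\<And>x \<zeta>. x \<in> ball x0 \<delta> \<Longrightarrow> norm \<zeta> \<le> \<epsilon> \<Longrightarrow> x + \<zeta> *s v \<in> U"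
      using uniform_polydisc_radius[OF holomorphic_map_openD[OF hol] x0, of v] by blast
  define a where "a = (\<lambda>s. \<epsilon> * cis (2 * pi * s))"
  have a: "a s \<noteq> 0" "norm (a s) \<le> \<epsilon>" for s using \<delta>(2) by (auto simp: a_def norm_mult)
  have ca: "continuous_on S (\<lambda>q. a (h q))" if "continuous_on S h" for S and h :: "'z::topological_space \<Rightarrow> real"
    unfolding a_def by (intro continuous_intros that)
  let ?g = "\<lambda>s x. (1 / a s) *s f (x + a s *s v)"
  have "holomorphic_map_on (\<lambda>x. integral {0..1} (\<lambda>s. ?g s x)) (ball x0 \<delta>)"
  proof (rule holomorphic_map_integral)
    show "continuous_on ({0..1} \<times> ball x0 \<delta>) (\<lambda>(s, x). ?g s x)"
      unfolding split_beta
      by (intro smult.continuous_on continuous_intros ca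
          continuous_on_compose2[OF holomorphic_map_continuous[OF hol]]) (use a \<delta>(4) in auto)
    fix s :: real
    have "holomorphic_map_on (\<lambda>x. f (x + a s *s v)) (ball x0 \<delta>)"
      by (rule holomorphic_map_on_subset[OF holomorphic_map_affine_preimage(1)[OF hol]])
        (use a \<delta>(4) in auto)
    then show "holomorphic_map_on (?g s) (ball x0 \<delta>)"
      by (rule holomorphic_map_smult)
  qed
  then have "holomorphic_map_on (\<lambda>x. frechet_derivative f (at x) v) (ball x0 \<delta>)"
  proof (rule holomorphic_map_on_cong)
    fix x assume "x \<in> ball x0 \<delta>"
    from cauchy_directional_derivative[OF hol \<delta>(2) \<delta>(4)[OF this]]
    show "integral {0..1} (\<lambda>s. ?g s x) = frechet_derivative f (at x) v"
      by (simp add: a_def)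
  qed
  then show "\<exists>V. x0 \<in> V \<and> V \<subseteq> U \<and> holomorphic_map_on (\<lambda>x. frechet_derivative f (at x) v) V"
    using \<delta> by (intro exI[of _ "ball x0 \<delta>"]) auto
qed


section \<open>Push-forward of holomorphic vector fields\<close>

lemma holomorphic_map_mult_component:
  assumes X: "holomorphic_map_on X U" and f: "holomorphic_map_on f U"
  shows "holomorphic_map_on (\<lambda>x. (X x $ j) *s f x) U"
    and "x \<in> U \<Longrightarrow> ((\<lambda>x. (X x $ j) *s f x) has_derivative
      (\<lambda>v. (X x $ j) *s frechet_derivative f (at x) v + (frechet_derivative X (at x) v $ j) *s f x)) (at x)"
proof -
  show D: "((\<lambda>x. (X x $ j) *s f x) has_derivative
      (\<lambda>v. (X x $ j) *s frechet_derivative f (at x) v + (frechet_derivative X (at x) v $ j) *s f x)) (at x)"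
    if "x \<in> U" for x
    by (intro smult.FDERIV bounded_linear.has_derivative[OF bounded_linear_vec_nth]
        holomorphic_map_has_derivative[OF X that] holomorphic_map_has_derivative[OF f that])
  show "holomorphic_map_on (\<lambda>x. (X x $ j) *s f x) U"
  proof (rule holomorphic_map_onI[OF holomorphic_map_openD[OF X] D])
    fix x assume "x \<in> U"
    with holomorphic_map_clinear[OF X this] holomorphic_map_clinear[OF f this]
    show "clinear (\<lambda>v. (X x $ j) *s frechet_derivative f (at x) v + (frechet_derivative X (at x) v $ j) *s f x)"
      by (auto simp: clinear_iff vec_eq_iff algebra_simps)
  qed
qed

lemma holomorphic_map_sum:
  fixes f :: "'i \<Rightarrow> complex ^ 'n \<Rightarrow> complex ^ 'm"
  assumes "\<And>i. i \<in> I \<Longrightarrow> holomorphic_map_on (f i) U" and U: "open U"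
  shows "holomorphic_map_on (\<lambda>x. \<Sum>i\<in>I. f i x) U"
proof (rule holomorphic_map_onI[OF U])
  fix x assume "x \<in> U"
  then show "((\<lambda>x. \<Sum>i\<in>I. f i x) has_derivative (\<lambda>v. \<Sum>i\<in>I. frechet_derivative (f i) (at x) v)) (at x)"
    using assms by (intro has_derivative_sum holomorphic_map_has_derivative)
  show "clinear (\<lambda>v. \<Sum>i\<in>I. frechet_derivative (f i) (at x) v)"
    using holomorphic_map_clinear[OF assms(1) \<open>x \<in> U\<close>]
    by (simp add: clinear_iff sum.distrib vec.scale_sum_right)
qed

lemma clinear_expansion:
  assumes "clinear f"
  shows "f v = (\<Sum>j\<in>UNIV. (v $ j) *s f (axis j 1))"
proof -
  have "f v = f (\<Sum>j\<in>UNIV. (v $ j) *s axis j 1)" by (simp add: basis_expansion)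
  also have "\<dots> = (\<Sum>j\<in>UNIV. (v $ j) *s f (axis j 1))"
    using assms by (simp add: clinear_sum[OF assms] clinear_iff)
  finally show ?thesis .
qed

text \<open>Expanding \<open>X\<close> in the standard basis writes the map as a sum of products of holomorphic maps. At a
  zero of \<open>X\<close> the second derivatives of \<open>f\<close> are multiplied by zero and disappear.\<close>

lemma holomorphic_map_derivative_applied:
  assumes f: "holomorphic_map_on f U" and X: "holomorphic_map_on X U"
  shows "holomorphic_map_on (\<lambda>x. frechet_derivative f (at x) (X x)) U"
    and "a \<in> U \<Longrightarrow> X a = 0 \<Longrightarrow> frechet_derivative (\<lambda>x. frechet_derivative f (at x) (X x)) (at a) v
           = frechet_derivative f (at a) (frechet_derivative X (at a) v)"
proof -
  note U = holomorphic_map_openD[OF X]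
  let ?F = "\<lambda>j x. frechet_derivative f (at x) (axis j 1)"
  let ?G = "\<lambda>x. \<Sum>j\<in>UNIV. (X x $ j) *s ?F j x"
  have eq: "?G x = frechet_derivative f (at x) (X x)" if "x \<in> U" for x
    by (rule clinear_expansion[OF holomorphic_map_clinear[OF f that], symmetric])
  have F: "holomorphic_map_on (?F j) U" for j by (rule holomorphic_map_frechet_derivative[OF f])
  have "holomorphic_map_on ?G U"
    by (intro holomorphic_map_sum holomorphic_map_mult_component X F U)
  then show "holomorphic_map_on (\<lambda>x. frechet_derivative f (at x) (X x)) U"
    using eq by (rule holomorphic_map_on_cong)
  assume a: "a \<in> U" "X a = 0"
  have "(?G has_derivative (\<lambda>v. \<Sum>j\<in>UNIV. (X a $ j) *s frechet_derivative (?F j) (at a) v + (frechet_derivative X (at a) v $ j) *s ?F j a)) (at a)"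
    by (intro has_derivative_sum holomorphic_map_mult_component(2)[OF X F a(1)])
  then have "(?G has_derivative (\<lambda>v. frechet_derivative f (at a) (frechet_derivative X (at a) v))) (at a)"
    using a(2) by (simp add: clinear_expansion[OF holomorphic_map_clinear[OF f a(1)], symmetric])
  then have "((\<lambda>x. frechet_derivative f (at x) (X x)) has_derivative (\<lambda>v. frechet_derivative f (at a) (frechet_derivative X (at a) v))) (at a)"
    using U a(1) eq by (rule has_derivative_transform_within_open)
  from frechet_derivative_at[OF this]
  show "frechet_derivative (\<lambda>x. frechet_derivative f (at x) (X x)) (at a) v
           = frechet_derivative f (at a) (frechet_derivative X (at a) v)" by metis
qed

lemma biholomorphism_derivative_inverse:
  assumes "biholomorphism U V \<phi> \<psi>"
  shows "x \<in> U \<Longrightarrow> frechet_derivative \<psi> (at (\<phi> x)) (frechet_derivative \<phi> (at x) v) = v"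
    and "y \<in> V \<Longrightarrow> frechet_derivative \<phi> (at (\<psi> y)) (frechet_derivative \<psi> (at y) v) = v"
proof -
  have *: "frechet_derivative g (at (f x)) (frechet_derivative f (at x) v) = v"
    if f: "holomorphic_map_on f A" and g: "holomorphic_map_on g B" and x: "x \<in> A"
      and "f x \<in> B" "\<And>x. x \<in> A \<Longrightarrow> g (f x) = x"
    for f g :: "complex ^ 'a \<Rightarrow> complex ^ 'a" and A B x v
  proof -
    have "((\<lambda>x. g (f x)) has_derivative (\<lambda>v. v)) (at x)"
      using has_derivative_ident holomorphic_map_openD[OF f] x
      by (rule has_derivative_transform_within_open) (use that in auto)
    from frechet_derivative_at[OF this] frechet_derivative_comp[OF f g x \<open>f x \<in> B\<close>, of v]
    show ?thesis by metis
  qed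
  have h: "holomorphic_map_on \<phi> U" "holomorphic_map_on \<psi> V" "homeomorphism U V \<phi> \<psi>"
    using assms by (auto simp: biholomorphism_def)
  then have m: "\<phi> x \<in> V" "\<psi> (\<phi> x) = x" if "x \<in> U" for x
    using that by (auto simp: homeomorphism_def)
  have m': "\<psi> y \<in> U" "\<phi> (\<psi> y) = y" if "y \<in> V" for y
    using that h(3) by (auto simp: homeomorphism_def)
  show "x \<in> U \<Longrightarrow> frechet_derivative \<psi> (at (\<phi> x)) (frechet_derivative \<phi> (at x) v) = v"
    using *[OF h(1,2)] m by blast
  show "y \<in> V \<Longrightarrow> frechet_derivative \<phi> (at (\<psi> y)) (frechet_derivative \<psi> (at y) v) = v"
    using *[OF h(2,1)] m' by blast
qed

text \<open>At a zero of the field, the linear part transforms by conjugation.\<close>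

lemma push_forward_holomorphic:
  assumes bi: "biholomorphism U V \<phi> \<psi>" and X: "holomorphic_map_on X U"
  shows "holomorphic_map_on (push_forward \<phi> \<psi> X) V"
    and "y \<in> V \<Longrightarrow> X (\<psi> y) = 0 \<Longrightarrow> frechet_derivative (push_forward \<phi> \<psi> X) (at y) v
          = frechet_derivative \<phi> (at (\<psi> y)) (frechet_derivative X (at (\<psi> y)) (frechet_derivative \<psi> (at y) v))"
proof -
  have h: "holomorphic_map_on \<phi> U" "holomorphic_map_on \<psi> V" and im: "\<psi> ` V \<subseteq> U"
    using bi by (auto simp: biholomorphism_def homeomorphism_def)
  have eq: "push_forward \<phi> \<psi> X = (\<lambda>y. (\<lambda>x. frechet_derivative \<phi> (at x) (X x)) (\<psi> y))"
    by (simp add: push_forward_def fun_eq_iff)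
  note d = holomorphic_map_derivative_applied[OF h(1) X]
  show "holomorphic_map_on (push_forward \<phi> \<psi> X) V"
    unfolding eq by (rule holomorphic_map_comp[OF h(2) d(1) im])
  assume y: "y \<in> V" "X (\<psi> y) = 0"
  then have "\<psi> y \<in> U" using im by auto
  with y show "frechet_derivative (push_forward \<phi> \<psi> X) (at y) v
          = frechet_derivative \<phi> (at (\<psi> y)) (frechet_derivative X (at (\<psi> y)) (frechet_derivative \<psi> (at y) v))"
    unfolding eq using frechet_derivative_comp[OF h(2) d(1) y(1)] d(2) by simp
qed


section \<open>Equivariance of eigenfunctions of a linear vector field\<close>

definition polydisc :: "real \<Rightarrow> (complex ^ 'n) set" where
  "polydisc R = {x. \<forall>i. norm (x $ i) < R}"

lemma open_polydisc: "open (polydisc R :: (complex ^ 'n) set)"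
proof -
  have "polydisc R = (\<Inter>i. (\<lambda>x :: complex ^ 'n. x $ i) -` ball 0 R)" by (auto simp: polydisc_def)
  then show ?thesis by (auto intro!: open_INT open_vimage_vec_nth)
qed

lemma polydisc_subset:
  fixes U :: "(complex ^ 'n) set"
  assumes "open U" "0 \<in> U"
  obtains R where "0 < R" "polydisc R \<subseteq> U"
proof -
  obtain e where e: "e > 0" "ball 0 e \<subseteq> U" using assms open_contains_ball by blast
  let ?R = "e / real CARD('n)"
  have "polydisc ?R \<subseteq> ball (0 :: complex ^ 'n) e"
  proof
    fix x :: "complex ^ 'n" assume x: "x \<in> polydisc ?R"
    have "norm x \<le> (\<Sum>i\<in>UNIV. norm (x $ i))" by (simp add: norm_vec_def L2_set_le_sum)
    also have "\<dots> < (\<Sum>i\<in>(UNIV :: 'n set). ?R)"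
      by (rule sum_strict_mono) (use x in \<open>auto simp: polydisc_def\<close>)
    also have "\<dots> = e" by simp
    finally show "x \<in> ball 0 e" by simp
  qed
  then show ?thesis using e that[of ?R] by auto
qed

definition vec_upd :: "complex ^ 'n \<Rightarrow> 'n \<Rightarrow> complex \<Rightarrow> complex ^ 'n" where
  "vec_upd x j z = (\<chi> i. if i = j then z else x $ i)"

lemma vec_upd_nth [simp]: "vec_upd x j z $ i = (if i = j then z else x $ i)"
  by (simp add: vec_upd_def)

lemma vec_upd_polydisc: "x \<in> polydisc R \<Longrightarrow> norm z < R \<Longrightarrow> vec_upd x j z \<in> polydisc R"
  by (simp add: polydisc_def)

lemma vec_upd_slice: "vec_upd x j z = vec_upd x j 0 + z *s axis j 1"
  by (simp add: vec_eq_iff axis_def)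

lemma vec_upd_has_derivative: "((\<lambda>x. vec_upd x j z) has_derivative (\<lambda>v. vec_upd v j 0)) (at x)"
  and clinear_vec_upd: "clinear (\<lambda>v. vec_upd v j 0)"
proof -
  show l: "clinear (\<lambda>v. vec_upd v j 0)" by (auto simp: clinear_iff vec_eq_iff)
  have "((\<lambda>x. vec_upd x j 0 + z *s axis j 1) has_derivative (\<lambda>v. vec_upd v j 0)) (at x)"
    using has_derivative_add[OF holomorphic_map_clinear_map(2)[OF l] has_derivative_const] by simp
  then show "((\<lambda>x. vec_upd x j z) has_derivative (\<lambda>v. vec_upd v j 0)) (at x)"
    by (simp add: vec_upd_slice[symmetric])
qed

text \<open>The operator \<open>z d/dz\<close> multiplies the \<open>p\<close>-th Taylor coefficient by \<open>p\<close>.\<close>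

lemma taylor_coeff_euler:
  assumes h: "h holomorphic_on A" "open A" "cball 0 R \<subseteq> A" and R: "0 < R"
  shows "integral {0..1} (\<lambda>s. (R * cis (2 * pi * s)) * deriv h (R * cis (2 * pi * s)) / (R * cis (2 * pi * s)) ^ p)
    = of_nat p * integral {0..1} (\<lambda>s. h (R * cis (2 * pi * s)) / (R * cis (2 * pi * s)) ^ p)"
proof -
  have dh: "deriv h holomorphic_on A" by (rule holomorphic_deriv[OF h(1,2)])
  show ?thesis
  proof (cases p)
    case 0
    have "(\<lambda>z. z * deriv h z) holomorphic_on A" by (intro holomorphic_intros dh)
    from taylor_coeff_circle[OF this h(2,3) R, of 0] show ?thesis using 0 by simp
  next
    case (Suc q)
    have "integral {0..1} (\<lambda>s. (R * cis (2 * pi * s)) * deriv h (R * cis (2 * pi * s)) / (R * cis (2 * pi * s)) ^ p)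
      = integral {0..1} (\<lambda>s. deriv h (R * cis (2 * pi * s)) / (R * cis (2 * pi * s)) ^ q)"
      using R Suc by (intro integral_cong) simp
    also have "\<dots> = (deriv ^^ q) (deriv h) 0 / fact q"
      by (rule taylor_coeff_circle[OF dh h(2,3) R, symmetric])
    also have "\<dots> = of_nat p * ((deriv ^^ p) h 0 / fact p)"
      unfolding Suc by (simp add: funpow_swap1 field_simps del: of_nat_Suc)
    also have "\<dots> = of_nat p * integral {0..1} (\<lambda>s. h (R * cis (2 * pi * s)) / (R * cis (2 * pi * s)) ^ p)"
      by (simp only: taylor_coeff_circle[OF h R])
    finally show ?thesis .
  qed
qed

text \<open>The coefficient of \<open>x\<^sub>j\<^sup>p\<close> in the expansion of \<open>f\<close> with respect to \<open>x\<^sub>j\<close>, as a function of the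
  other variables. The radius \<open>r\<close> of the circle does not affect it.\<close>

definition partial_coeff :: "real \<Rightarrow> 'n \<Rightarrow> nat \<Rightarrow> (complex ^ 'n \<Rightarrow> complex ^ 'm) \<Rightarrow> complex ^ 'n \<Rightarrow> complex ^ 'm" where
  "partial_coeff r j p f x =
     integral {0..1} (\<lambda>s. (1 / (r * cis (2 * pi * s)) ^ p) *s f (vec_upd x j (r * cis (2 * pi * s))))"

context
  fixes f :: "complex ^ 'n \<Rightarrow> complex ^ 'm" and R r :: real and j :: 'n
  assumes f: "holomorphic_map_on f (polydisc R)" and r: "0 < r" "r < R"
begin

lemma partial_slice_holomorphic:
  assumes "x \<in> polydisc R"
  shows "(\<lambda>z. f (vec_upd x j z) $ i) holomorphic_on ball 0 R"
    and "norm z < R \<Longrightarrow> deriv (\<lambda>z. f (vec_upd x j z) $ i) z = frechet_derivative f (at (vec_upd x j z)) (axis j 1) $ i"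
proof -
  have sl: "(\<lambda>z. f (vec_upd x j z) $ i) = (\<lambda>z. f (vec_upd x j 0 + z *s axis j 1) $ i)"
    by (rule ext, subst vec_upd_slice) simp
  have m: "vec_upd x j 0 + z *s axis j 1 \<in> polydisc R" if "norm z < R" for z
    using vec_upd_polydisc[OF assms that] vec_upd_slice[of x j z] by metis
  show "(\<lambda>z. f (vec_upd x j z) $ i) holomorphic_on ball 0 R"
    unfolding sl by (rule holomorphic_on_subset[OF holomorphic_slice(3)[OF f]]) (use m in auto)
  show "norm z < R \<Longrightarrow> deriv (\<lambda>z. f (vec_upd x j z) $ i) z = frechet_derivative f (at (vec_upd x j z)) (axis j 1) $ i"
    unfolding sl using DERIV_imp_deriv[OF holomorphic_slice(2)[OF f m]] by (simp add: vec_upd_slice[of x j z])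
qed

lemma circle_in_polydisc: "x \<in> polydisc R \<Longrightarrow> vec_upd x j (r * cis (2 * pi * s)) \<in> polydisc R"
  using r by (intro vec_upd_polydisc) (auto simp: norm_mult)

lemma continuous_on_vec_upd_circle:
  "continuous_on (UNIV \<times> UNIV) (\<lambda>(s, x). vec_upd x j (r * cis (2 * pi * s)))"
proof -
  have "continuous_on (UNIV \<times> UNIV) (\<lambda>p. vec_upd (snd p) j (r * cis (2 * pi * fst p)) $ i)" for i
    by (cases "i = j") (auto intro!: continuous_intros)
  then show ?thesis
    by (simp add: split_beta vec_upd_def continuous_on_vec_lambda)
qed

lemma partial_coeff_integrand:
  shows "continuous_on ({0..1} \<times> polydisc R)
           (\<lambda>(s, x). (1 / (r * cis (2 * pi * s)) ^ p) *s f (vec_upd x j (r * cis (2 * pi * s))))"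
    and "holomorphic_map_on (\<lambda>x. (1 / (r * cis (2 * pi * s)) ^ p) *s f (vec_upd x j (r * cis (2 * pi * s)))) (polydisc R)"
    and "x \<in> polydisc R \<Longrightarrow> frechet_derivative (\<lambda>x. (1 / (r * cis (2 * pi * s)) ^ p) *s f (vec_upd x j (r * cis (2 * pi * s)))) (at x) v
       = (1 / (r * cis (2 * pi * s)) ^ p) *s frechet_derivative f (at (vec_upd x j (r * cis (2 * pi * s)))) (vec_upd v j 0)"
proof -
  have c: "continuous_on ({0..1} \<times> polydisc R) (\<lambda>q. vec_upd (snd q) j (r * cis (2 * pi * fst q)))"
    by (rule continuous_on_subset[OF continuous_on_vec_upd_circle[unfolded split_beta]]) auto
  show "continuous_on ({0..1} \<times> polydisc R)
           (\<lambda>(s, x). (1 / (r * cis (2 * pi * s)) ^ p) *s f (vec_upd x j (r * cis (2 * pi * s))))"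
    unfolding split_beta
    by (intro smult.continuous_on continuous_intros continuous_on_compose2[OF holomorphic_map_continuous[OF f] c])
       (use r circle_in_polydisc in auto)
  have u: "holomorphic_map_on (\<lambda>x. vec_upd x j (r * cis (2 * pi * s))) (polydisc R)"
    by (rule holomorphic_map_onI[OF open_polydisc vec_upd_has_derivative clinear_vec_upd])
  have du: "frechet_derivative (\<lambda>x. vec_upd x j (r * cis (2 * pi * s))) (at x) v = vec_upd v j 0" for x v
    by (simp add: frechet_derivative_at[OF vec_upd_has_derivative, symmetric])
  have im: "(\<lambda>x. vec_upd x j (r * cis (2 * pi * s))) ` polydisc R \<subseteq> polydisc R"
    using circle_in_polydisc by auto
  note hc = holomorphic_map_comp[OF u f im]
  show "holomorphic_map_on (\<lambda>x. (1 / (r * cis (2 * pi * s)) ^ p) *s f (vec_upd x j (r * cis (2 * pi * s)))) (polydisc R)"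
    by (rule holomorphic_map_smult[OF hc])
  show "frechet_derivative (\<lambda>x. (1 / (r * cis (2 * pi * s)) ^ p) *s f (vec_upd x j (r * cis (2 * pi * s)))) (at x) v
       = (1 / (r * cis (2 * pi * s)) ^ p) *s frechet_derivative f (at (vec_upd x j (r * cis (2 * pi * s)))) (vec_upd v j 0)"
    if "x \<in> polydisc R"
    by (simp only: holomorphic_map_smult(2)[OF hc that] du
        frechet_derivative_comp[OF u f that circle_in_polydisc[OF that]])
qed

lemma partial_coeff_holomorphic: "holomorphic_map_on (partial_coeff r j p f) (polydisc R)"
  using holomorphic_map_integral(1)[OF partial_coeff_integrand(1,2)]
  by (simp add: partial_coeff_def[abs_def])

lemma partial_coeff_integrable:
  assumes "x \<in> polydisc R"
  shows "(\<lambda>s. (1 / (r * cis (2 * pi * s)) ^ p) *s f (vec_upd x j (r * cis (2 * pi * s)))) integrable_on {0..1}"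
proof (rule integrable_continuous_interval)
  show "continuous_on {0..1} (\<lambda>s. (1 / (r * cis (2 * pi * s)) ^ p) *s f (vec_upd x j (r * cis (2 * pi * s))))"
    using continuous_on_compose2[OF partial_coeff_integrand(1)
        continuous_on_Pair[OF continuous_on_id[of "{0..1}"] continuous_on_const[of _ x]]] assms
    by auto
qed

lemma partial_coeff_nth:
  assumes "x \<in> polydisc R"
  shows "partial_coeff r j p f x $ i =
    integral {0..1} (\<lambda>s. f (vec_upd x j (r * cis (2 * pi * s))) $ i / (r * cis (2 * pi * s)) ^ p)"
  unfolding partial_coeff_def by (simp add: integral_vec_nth[OF partial_coeff_integrable[OF assms]])

lemma partial_coeff_sums:
  assumes "x \<in> polydisc R" "norm z < R"
  shows "(\<lambda>p. partial_coeff r j p f x $ i * z ^ p) sums (f (vec_upd x j z) $ i)"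
proof -
  note h = partial_slice_holomorphic(1)[OF assms(1), of i]
  have "(\<lambda>p. (deriv ^^ p) (\<lambda>z. f (vec_upd x j z) $ i) 0 / fact p * (z - 0) ^ p) sums (f (vec_upd x j z) $ i)"
    by (rule holomorphic_power_series[OF h]) (use assms in auto)
  moreover have "(deriv ^^ p) (\<lambda>z. f (vec_upd x j z) $ i) 0 / fact p = partial_coeff r j p f x $ i" for p
    unfolding partial_coeff_nth[OF assms(1)]
    by (rule taylor_coeff_circle[OF h]) (use r in auto)
  ultimately show ?thesis by simp
qed

text \<open>The coefficients with respect to \<open>x\<^sub>j\<close> of an eigenfunction of a linear diagonal field satisfy the
  analogous equation for the field without its \<open>j\<close>-th component, with the eigenvalue lowered by \<open>p g\<close>
  since \<open>g x\<^sub>j \<partial>/\<partial>x\<^sub>j\<close> multiplies the \<open>p\<close>-th coefficient by \<open>p g\<close>.\<close>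

lemma partial_coeff_euler:
  assumes x: "x \<in> polydisc R" and v: "v $ j = 0"
    and eq: "\<And>z. norm z < R \<Longrightarrow> frechet_derivative f (at (vec_upd x j z)) v
       + (g * z) *s frechet_derivative f (at (vec_upd x j z)) (axis j 1) = l *s f (vec_upd x j z)"
  shows "frechet_derivative (partial_coeff r j p f) (at x) v = (l - of_nat p * g) *s partial_coeff r j p f x"
proof (rule vec_eq_iff[THEN iffD2], rule allI)
  fix i
  let ?c = "\<lambda>s. r * cis (2 * pi * s)"
  let ?h = "\<lambda>z. f (vec_upd x j z) $ i"
  have c: "norm (?c s) < R" for s using r by (simp add: norm_mult)
  have v0: "vec_upd v j 0 = v" using v by (simp add: vec_eq_iff)
  note h = partial_slice_holomorphic(1)[OF x, of i]
  have int: "(\<lambda>s. ?h (?c s) / ?c s ^ p) integrable_on {0..1}"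
    using integrable_linear[OF partial_coeff_integrable[OF x] bounded_linear_vec_nth] by (simp add: o_def)
  have "continuous_on (cball 0 r) (deriv ?h)"
    using h r by (intro holomorphic_on_imp_continuous_on[OF holomorphic_on_subset[OF holomorphic_deriv[OF h]]]) auto
  then have "continuous_on {0..1} (\<lambda>s. ?c s * deriv ?h (?c s) / ?c s ^ p)"
    by (intro continuous_intros continuous_on_compose2[of "cball 0 r" "deriv ?h" _ ?c])
       (use r in \<open>auto simp: norm_mult\<close>)
  then have int': "(\<lambda>s. ?c s * deriv ?h (?c s) / ?c s ^ p) integrable_on {0..1}"
    by (rule integrable_continuous_interval)
  have "frechet_derivative (partial_coeff r j p f) (at x) v
      = integral {0..1} (\<lambda>s. frechet_derivative (\<lambda>x. (1 / ?c s ^ p) *s f (vec_upd x j (?c s))) (at x) v)"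
    unfolding partial_coeff_def[abs_def]
    by (rule holomorphic_map_integral(2)[OF partial_coeff_integrand(1,2) x])
  also have "\<dots> = integral {0..1} (\<lambda>s. (1 / ?c s ^ p) *s frechet_derivative f (at (vec_upd x j (?c s))) v)"
    by (simp only: partial_coeff_integrand(3)[OF x] v0)
  finally have D: "frechet_derivative (partial_coeff r j p f) (at x) v =
      integral {0..1} (\<lambda>s. (1 / ?c s ^ p) *s frechet_derivative f (at (vec_upd x j (?c s))) v)" .
  have "(\<lambda>s. (1 / ?c s ^ p) *s frechet_derivative f (at (vec_upd x j (?c s))) v) integrable_on {0..1}"
    using holomorphic_map_integral(3)[OF partial_coeff_integrand(1,2) x, of p v]
    by (simp only: partial_coeff_integrand(3)[OF x] v0)
  then have "frechet_derivative (partial_coeff r j p f) (at x) v $ i =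
      integral {0..1} (\<lambda>s. frechet_derivative f (at (vec_upd x j (?c s))) v $ i / ?c s ^ p)"
    unfolding D by (simp add: integral_vec_nth)
  also have "\<dots> = integral {0..1} (\<lambda>s. l * (?h (?c s) / ?c s ^ p) - g * (?c s * deriv ?h (?c s) / ?c s ^ p))"
  proof (rule integral_cong)
    fix s :: real
    have "frechet_derivative f (at (vec_upd x j (?c s))) v $ i = l * ?h (?c s) - g * ?c s * deriv ?h (?c s)"
      using arg_cong[OF eq[OF c[of s]], of "\<lambda>w. w $ i"] partial_slice_holomorphic(2)[OF x c[of s], of i]
      by (simp add: algebra_simps)
    then show "frechet_derivative f (at (vec_upd x j (?c s))) v $ i / ?c s ^ p
       = l * (?h (?c s) / ?c s ^ p) - g * (?c s * deriv ?h (?c s) / ?c s ^ p)"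
      by (simp only:) (simp add: diff_divide_distrib mult_ac)
  qed
  also have "\<dots> = l * integral {0..1} (\<lambda>s. ?h (?c s) / ?c s ^ p) - g * integral {0..1} (\<lambda>s. ?c s * deriv ?h (?c s) / ?c s ^ p)"
    using int int' by (simp only: integral_diff integrable_on_mult_right integral_mult_right)
  also have "integral {0..1} (\<lambda>s. ?c s * deriv ?h (?c s) / ?c s ^ p) = of_nat p * integral {0..1} (\<lambda>s. ?h (?c s) / ?c s ^ p)"
    by (rule taylor_coeff_euler[OF h]) (use r in auto)
  finally show "frechet_derivative (partial_coeff r j p f) (at x) v $ i = ((l - of_nat p * g) *s partial_coeff r j p f x) $ i"
    by (simp add: partial_coeff_nth[OF x] algebra_simps)
qed

end

text \<open>An eigenfunction with eigenvalue \<open>l\<close> of the field \<open>\<Sum>i\<in>J. \<gamma>\<^sub>i x\<^sub>i \<partial>/\<partial>x\<^sub>i\<close> contains, as a function of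
  the variables in \<open>J\<close>, only monomials \<open>x\<^sup>m\<close> with \<open>\<Sum>m\<^sub>i \<gamma>\<^sub>i = l\<close>. If all of these are multiplied by the
  same number \<open>b\<close> under \<open>x\<^sub>i \<mapsto> a\<^sub>i x\<^sub>i\<close>, so is the function. The induction splits off one variable
  at a time; in the induction hypothesis the function, the eigenvalue and \<open>b\<close> must all be general.\<close>

lemma euler_eigenfunction_equivariant:
  fixes f :: "complex ^ 'n \<Rightarrow> complex ^ 'm" and a :: "'n \<Rightarrow> complex"
  assumes "finite J" and a: "\<And>i. norm (a i) = 1"
    and "holomorphic_map_on f (polydisc R)"
    and "\<And>x. x \<in> polydisc R \<Longrightarrow>
      frechet_derivative f (at x) (\<chi> i. if i \<in> J then \<gamma> $ i * x $ i else 0) = l *s f x"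
    and "\<And>m :: 'n \<Rightarrow> nat. (\<Sum>i\<in>J. of_nat (m i) * \<gamma> $ i) = l \<Longrightarrow> (\<Prod>i\<in>J. a i ^ m i) = b"
    and "x \<in> polydisc R"
  shows "f (\<chi> i. if i \<in> J then a i * x $ i else x $ i) = b *s f x"
  using assms(1,3-6)
proof (induction J arbitrary: f l b x rule: finite_induct)
  case empty
  have "clinear (frechet_derivative f (at x))"
    using holomorphic_map_clinear[OF empty.prems(1,4)] .
  then have "frechet_derivative f (at x) 0 = 0" by (metis clinear_iff add_cancel_right_right)
  then have "l *s f x = 0" using empty.prems(2)[OF empty.prems(4)] by (simp add: zero_vec_def)
  moreover have "b = 1" if "l = 0" using empty.prems(3)[of "\<lambda>_. 0"] that by simp
  ultimately show ?case by (cases "l = 0") (auto simp: vec_eq_iff)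
next
  case (insert j J)
  note f = insert.prems(1) and x = insert.prems(4)
  have "0 < R" using x norm_ge_zero le_less_trans unfolding polydisc_def by blast
  \<comment> \<open>Any radius below \<open>R\<close> serves to extract the coefficients.\<close>
  define r where "r = R / 2"
  have r: "0 < r" "r < R" using \<open>0 < R\<close> by (auto simp: r_def)
  let ?T = "\<lambda>x. (\<chi> i. if i \<in> J then a i * x $ i else x $ i)"
  have Tx: "?T x \<in> polydisc R" using x a by (auto simp: polydisc_def norm_mult)
  have nj: "a j \<noteq> 0" using a[of j] by auto
  have step: "partial_coeff r j p f (?T x) = (b / a j ^ p) *s partial_coeff r j p f x" for p
  proof (rule insert.IH[where l = "l - of_nat p * \<gamma> $ j"])
    show "holomorphic_map_on (partial_coeff r j p f) (polydisc R)"
      by (rule partial_coeff_holomorphic[OF f r])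
  next
    fix y :: "complex ^ 'n" assume y: "y \<in> polydisc R"
    show "frechet_derivative (partial_coeff r j p f) (at y) (\<chi> i. if i \<in> J then \<gamma> $ i * y $ i else 0)
        = (l - of_nat p * \<gamma> $ j) *s partial_coeff r j p f y"
    proof (rule partial_coeff_euler[OF f r y])
      fix z :: complex assume z: "norm z < R"
      let ?y = "vec_upd y j z"
      have y': "?y \<in> polydisc R" by (rule vec_upd_polydisc[OF y z])
      have lin: "frechet_derivative f (at ?y) (v + c *s w)
          = frechet_derivative f (at ?y) v + c *s frechet_derivative f (at ?y) w" for v w c
        using holomorphic_map_clinear[OF f y'] by (simp add: clinear_iff)
      have E: "(\<chi> i. if i \<in> insert j J then \<gamma> $ i * ?y $ i else 0)
          = (\<chi> i. if i \<in> J then \<gamma> $ i * y $ i else 0) + (\<gamma> $ j * z) *s axis j 1"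
        using insert.hyps by (auto simp: vec_eq_iff axis_def)
      then show "frechet_derivative f (at ?y) (\<chi> i. if i \<in> J then \<gamma> $ i * y $ i else 0)
          + (\<gamma> $ j * z) *s frechet_derivative f (at ?y) (axis j 1) = l *s f ?y"
        using insert.prems(2)[OF y'] by (simp only: E lin)
    qed (use insert.hyps in simp)
  next
    fix m :: "'n \<Rightarrow> nat" assume m: "(\<Sum>i\<in>J. of_nat (m i) * \<gamma> $ i) = l - of_nat p * \<gamma> $ j"
    have "(\<Sum>i\<in>J. of_nat ((m(j := p)) i) * \<gamma> $ i) = (\<Sum>i\<in>J. of_nat (m i) * \<gamma> $ i)"
      "(\<Prod>i\<in>J. a i ^ (m(j := p)) i) = (\<Prod>i\<in>J. a i ^ m i)"
      using insert.hyps by (auto intro!: sum.cong prod.cong)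
    then have "a j ^ p * (\<Prod>i\<in>J. a i ^ m i) = b"
      using insert.prems(3)[of "m(j := p)"] insert.hyps m by simp
    then show "(\<Prod>i\<in>J. a i ^ m i) = b / a j ^ p" using nj by (simp add: field_simps)
  qed (rule x)
  show ?case
  proof (rule vec_eq_iff[THEN iffD2], rule allI)
    fix i
    have xj: "norm (x $ j) < R" using x by (simp add: polydisc_def)
    then have axj: "norm (a j * x $ j) < R" by (simp add: norm_mult a)
    have "(\<lambda>p. partial_coeff r j p f (?T x) $ i * (a j * x $ j) ^ p) sums (f (vec_upd (?T x) j (a j * x $ j)) $ i)"
      by (rule partial_coeff_sums[OF f r Tx axj])
    moreover have "(\<lambda>p. b * (partial_coeff r j p f x $ i * (x $ j) ^ p)) sums (b * f (vec_upd x j (x $ j)) $ i)"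
      by (intro sums_mult partial_coeff_sums[OF f r x xj])
    moreover have "partial_coeff r j p f (?T x) $ i * (a j * x $ j) ^ p = b * (partial_coeff r j p f x $ i * (x $ j) ^ p)" for p
      unfolding step using nj by (simp add: power_mult_distrib)
    ultimately have "f (vec_upd (?T x) j (a j * x $ j)) $ i = b * f (vec_upd x j (x $ j)) $ i"
      by (simp add: sums_unique2)
    moreover have "vec_upd (?T x) j (a j * x $ j) = (\<chi> i. if i \<in> insert j J then a i * x $ i else x $ i)"
      "vec_upd x j (x $ j) = x" by (auto simp: vec_eq_iff)
    ultimately show "f (\<chi> i. if i \<in> insert j J then a i * x $ i else x $ i) $ i = (b *s f x) $ i" by simp
  qed
qed


section \<open>Uniqueness of the semisimple part\<close>

lemma funpow_commute:
  fixes f :: "'a \<Rightarrow> 'a"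
  assumes "\<And>v. f (g v) = g (f v)"
  shows "(f ^^ m) (g v) = g ((f ^^ m) v)"
  by (induction m) (auto simp: assms)

lemma funpow_commute_funpow:
  fixes f g :: "'a \<Rightarrow> 'a"
  assumes "\<And>v. f (g v) = g (f v)"
  shows "(f ^^ m) ((g ^^ l) v) = (g ^^ l) ((f ^^ m) v)"
  by (intro funpow_commute funpow_commute[symmetric] assms)

lemma funpow_matrix_mul:
  fixes N :: "complex ^ 'n ^ 'n"
  shows "(((**) N ^^ m) (mat 1)) *v v = ((*v) N ^^ m) v"
proof (induction m)
  case (Suc m)
  have "((**) N ^^ Suc m) (mat 1) *v v = N *v (((**) N ^^ m) (mat 1) *v v)"
    by (simp add: matrix_vector_mul_assoc)
  then show ?case by (simp add: Suc)
qed simp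

lemma matrix_vector_smult: "A *v (c *s v) = c *s (A *v (v :: complex ^ 'n))"
  using matrix_vector_mul_linear_gen[of A] by (simp add: Vector_Spaces.linear_iff)

lemma diagonal_matrix_mul_left: "(diagonal_matrix \<delta> ** M) $ i $ j = \<delta> $ i * M $ i $ j"
proof -
  show ?thesis by (simp add: matrix_matrix_mult_def diagonal_matrix_def mult_delta_left)
qed

lemma diagonal_matrix_mul_right: "(M ** diagonal_matrix \<delta>) $ i $ j = M $ i $ j * \<delta> $ j"
proof -
  show ?thesis by (simp add: matrix_matrix_mult_def diagonal_matrix_def mult_delta_right)
qed

lemma diagonal_matrix_vec: "(diagonal_matrix \<delta> *v v) $ i = \<delta> $ i * v $ i"
proof -
  show ?thesis by (simp add: matrix_vector_mult_def diagonal_matrix_def mult_delta_left)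
qed

lemma matrix_vector_mul_axis: "(A *v axis i 1) $ a = (A :: complex ^ 'n ^ 'm) $ a $ i"
  by (simp add: matrix_vector_mult_def axis_def mult_delta_right)

lemma matrix_inv_invertible:
  fixes P :: "complex ^ 'n ^ 'n"
  assumes "invertible P"
  shows "P ** matrix_inv P = mat 1" "matrix_inv P ** P = mat 1"
    "P *v (matrix_inv P *v v) = v" "matrix_inv P *v (P *v v) = v"
proof -
  show *: "P ** matrix_inv P = mat 1" "matrix_inv P ** P = mat 1"
    using someI_ex[of "\<lambda>B. P ** B = mat 1 \<and> B ** P = mat 1"] assms
    unfolding invertible_def matrix_inv_def by auto
  show "P *v (matrix_inv P *v v) = v" "matrix_inv P *v (P *v v) = v"
    using * by (simp_all add: matrix_vector_mul_assoc)
qed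

lemma diagonalizes_eq:
  assumes "diagonalizes P S \<gamma>"
  shows "S *v v = matrix_inv P *v (diagonal_matrix \<gamma> *v (P *v v))"
proof -
  have P: "invertible P" "P ** S ** matrix_inv P = diagonal_matrix \<gamma>"
    using assms by (auto simp: diagonalizes_def)
  have "matrix_inv P *v (diagonal_matrix \<gamma> *v (P *v v))
      = matrix_inv P *v (P *v (S *v (matrix_inv P *v (P *v v))))"
    unfolding P(2)[symmetric] by (simp add: matrix_vector_mul_assoc matrix_mul_assoc)
  then show ?thesis by (simp add: matrix_inv_invertible[OF P(1)])
qed

lemma funpow_eigenvector:
  fixes L :: "complex ^ 'n \<Rightarrow> complex ^ 'n"
  assumes "L u = c *s u" "\<And>a v. L (a *s v) = a *s L v"
  shows "(L ^^ m) u = c ^ m *s u"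
  by (induction m) (auto simp: assms)

text \<open>On an eigenvector of \<open>S\<close> the operators \<open>A - c\<close> and \<open>N\<close> have the same powers, because \<open>N\<close>
  preserves the eigenspace.\<close>

lemma jordan_shift_eigenvector:
  fixes A S N :: "complex ^ 'n ^ 'n"
  assumes "A = S + N" "S ** N = N ** S" "S *v p = c *s p"
  shows "((\<lambda>v. A *v v - c *s v) ^^ m) p = ((*v) N ^^ m) p"
    and "S *v (((*v) N ^^ m) p) = c *s ((*v) N ^^ m) p"
proof -
  have SN: "S *v (N *v v) = N *v (S *v v)" for v
    using assms(2) by (simp add: matrix_vector_mul_assoc)
  have S: "S *v (((*v) N ^^ m) p) = c *s ((*v) N ^^ m) p" for m
    by (induction m) (simp_all add: assms(3) SN matrix_vector_smult)
  then show "S *v (((*v) N ^^ m) p) = c *s ((*v) N ^^ m) p" .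
  show "((\<lambda>v. A *v v - c *s v) ^^ m) p = ((*v) N ^^ m) p"
    by (induction m) (simp_all add: assms(1) matrix_vector_mult_add_rdistrib S)
qed

text \<open>On a nonzero vector in the kernel of \<open>N\<close> the matrices \<open>S + N\<close> and \<open>S\<close> coincide.\<close>

lemma nilpotent_last_power:
  fixes N :: "complex ^ 'n ^ 'n"
  assumes "((*v) N ^^ q) v = 0" "v \<noteq> 0"
  obtains l where "((*v) N ^^ l) v \<noteq> 0" "N *v ((*v) N ^^ l) v = 0"
proof -
  define l where "l = (LEAST l. ((*v) N ^^ l) v = 0)"
  have l: "((*v) N ^^ l) v = 0" unfolding l_def by (rule LeastI[of _ q]) (rule assms)
  then obtain k where k: "l = Suc k" using assms(2) by (cases l) auto
  have "((*v) N ^^ k) v \<noteq> 0" using not_less_Least[of k "\<lambda>l. ((*v) N ^^ l) v = 0"] k l_def by auto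
  then show ?thesis using that[of k] l k by simp
qed

text \<open>The projection \<open>E\<close> of \<open>p\<close> to another eigenspace of \<open>S\<close>, with eigenvalue \<open>e\<close>, is still annihilated
  by \<open>(A - c)\<^sup>m\<close>, since \<open>E\<close> commutes with \<open>A\<close>. If it were nonzero, its last nonzero image under powers
  of \<open>N\<close> would be an eigenvector of \<open>A - c\<close> with the nonzero eigenvalue \<open>e - c\<close>.\<close>

lemma jordan_generalized_eigenvector:
  fixes A :: "complex ^ 'n ^ 'n"
  assumes J: "jordan_decomposition A S N" and p: "((\<lambda>v. A *v v - c *s v) ^^ m) p = 0"
  shows "S *v p = c *s p"
proof -
  have A: "A = S + N" and SN: "S ** N = N ** S" and "nilpotent_matrix N" "semisimple_matrix S"
    using J by (auto simp: jordan_decomposition_def)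
  then obtain q Q \<delta> where q: "((**) N ^^ q) (mat 1) = 0" and D: "diagonalizes Q S \<delta>"
    by (auto simp: nilpotent_matrix_def semisimple_matrix_def)
  have Q: "invertible Q" and QS: "Q ** S ** matrix_inv Q = diagonal_matrix \<delta>"
    using D by (auto simp: diagonalizes_def)
  note Qi = matrix_inv_invertible[OF Q]
  have Nq: "((*v) N ^^ q) v = 0" for v by (simp add: funpow_matrix_mul[symmetric] q)
  let ?L = "\<lambda>v. A *v v - c *s v"
  define M where "M = Q ** N ** matrix_inv Q"
  have "M ** diagonal_matrix \<delta> = Q ** (N ** S) ** matrix_inv Q"
    unfolding M_def QS[symmetric]
    by (metis Qi(2) matrix_mul_assoc matrix_mul_rid)
  moreover have "diagonal_matrix \<delta> ** M = Q ** (S ** N) ** matrix_inv Q"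
    unfolding M_def QS[symmetric]
    by (metis Qi(2) matrix_mul_assoc matrix_mul_rid)
  ultimately have "M ** diagonal_matrix \<delta> = diagonal_matrix \<delta> ** M" using SN by simp
  then have Mij: "M $ i $ j * \<delta> $ j = \<delta> $ i * M $ i $ j" for i j
    by (metis diagonal_matrix_mul_left diagonal_matrix_mul_right)
  have zero: "(Q *v p) $ i = 0" if i: "\<delta> $ i \<noteq> c" for i
  proof (rule ccontr)
    assume ne: "(Q *v p) $ i \<noteq> 0"
    define e where "e = \<delta> $ i"
    define I where "I = diagonal_matrix (\<chi> k. if \<delta> $ k = e then 1 else 0)"
    \<comment> \<open>the projection to the eigenspace of \<open>S\<close> for the eigenvalue \<open>e\<close> along the other eigenspaces\<close>
    define E where "E = matrix_inv Q ** I ** Q"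
    have QE: "Q ** E = I ** Q" unfolding E_def
      by (metis Qi(1) matrix_mul_assoc matrix_mul_lid)
    have "M ** I = I ** M"
    proof -
      have "M $ a $ b * (if \<delta> $ b = e then 1 else 0) = (if \<delta> $ a = e then 1 else 0) * M $ a $ b" for a b
        using Mij[of a b] by (cases "M $ a $ b = 0") auto
      then show ?thesis
        by (simp add: vec_eq_iff I_def diagonal_matrix_mul_left diagonal_matrix_mul_right)
    qed
    then have "matrix_inv Q ** (M ** I) ** Q = matrix_inv Q ** (I ** M) ** Q" by simp
    moreover have "matrix_inv Q ** (M ** I) ** Q = N ** E"
      unfolding M_def E_def by (metis Qi(2) matrix_mul_assoc matrix_mul_lid)
    moreover have "matrix_inv Q ** (I ** M) ** Q = E ** N"
      unfolding M_def E_def by (metis Qi(2) matrix_mul_assoc matrix_mul_rid)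
    ultimately have NE: "N ** E = E ** N" by simp
    have SE: "S *v (E *v v) = e *s (E *v v)" and ES: "E *v (S *v v) = e *s (E *v v)" for v
    proof -
      have dv: "diagonal_matrix \<delta> *v (I *v w) = e *s (I *v w)" for w
        by (simp add: vec_eq_iff I_def diagonal_matrix_vec)
      have dv': "I *v (diagonal_matrix \<delta> *v w) = e *s (I *v w)" for w
        by (simp add: vec_eq_iff I_def diagonal_matrix_vec)
      have Ev: "E *v w = matrix_inv Q *v (I *v (Q *v w))" for w
        by (simp add: E_def matrix_vector_mul_assoc matrix_mul_assoc)
      show "S *v (E *v v) = e *s (E *v v)"
        unfolding diagonalizes_eq[OF D, of "E *v v"] by (simp add: Ev Qi dv matrix_vector_smult)
      show "E *v (S *v v) = e *s (E *v v)"
        unfolding diagonalizes_eq[OF D, of v] by (simp add: Ev Qi dv' matrix_vector_smult)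
    qed
    have NEv: "N *v (E *v v) = E *v (N *v v)" for v using NE by (simp add: matrix_vector_mul_assoc)
    have LE: "?L (E *v v) = E *v (?L v)" for v
      by (simp add: A matrix_vector_mult_add_rdistrib matrix_vector_mult_diff_distrib vec.add
          matrix_vector_right_distrib SE ES NEv matrix_vector_smult)
    have NS: "N *v (S *v v) = S *v (N *v v)" for v using SN by (simp add: matrix_vector_mul_assoc)
    have LN: "?L (N *v v) = N *v (?L v)" for v
      by (simp add: A matrix_vector_mult_add_rdistrib matrix_vector_mult_diff_distrib
          matrix_vector_right_distrib NS matrix_vector_smult)
    let ?v = "E *v p"
    have "(Q *v ?v) $ i = (Q *v p) $ i"
      by (simp add: matrix_vector_mul_assoc QE) (simp add: matrix_vector_mul_assoc[symmetric] I_def diagonal_matrix_vec e_def)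
    then have "?v \<noteq> 0" using ne by auto
    then obtain l where l: "((*v) N ^^ l) ?v \<noteq> 0" "N *v ((*v) N ^^ l) ?v = 0"
      using nilpotent_last_power[OF Nq] by metis
    let ?u = "((*v) N ^^ l) ?v"
    have "S *v ?u = e *s ?u" by (rule jordan_shift_eigenvector(2)[OF A SN SE])
    then have "?L ?u = (e - c) *s ?u"
      using l by (simp add: A matrix_vector_mult_add_rdistrib vec.scale_left_diff_distrib)
    then have "(?L ^^ m) ?u = (e - c) ^ m *s ?u"
      by (rule funpow_eigenvector) (simp add: matrix_vector_smult vec_eq_iff algebra_simps)
    moreover have "(?L ^^ m) ?u = ((*v) N ^^ l) ((?L ^^ m) ?v)"
      by (rule funpow_commute_funpow[where f = ?L and g = "(*v) N"]) (rule LN)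
    moreover have "(?L ^^ m) ?v = 0" using funpow_commute[where f = ?L and g = "(*v) E" and v = p and m = m] LE p by simp
    moreover have "((*v) N ^^ l) 0 = 0" by (induction l) auto
    ultimately have "(e - c) ^ m *s ?u = 0" by simp
    then show False using l(1) i by (simp add: e_def)
  qed
  have "diagonal_matrix \<delta> *v (Q *v p) = c *s (Q *v p)"
    using zero by (auto simp: vec_eq_iff diagonal_matrix_vec)
  then show ?thesis
    by (simp add: diagonalizes_eq[OF D, of p] matrix_vector_smult Qi)
qed

text \<open>The eigenvectors of \<open>S\<close> are generalized eigenvectors of \<open>A\<close>, hence eigenvectors of \<open>S'\<close> with the
  same eigenvalues, and they form a basis.\<close>

lemma jordan_semisimple_part_unique:
  fixes A :: "complex ^ 'n ^ 'n"
  assumes "jordan_decomposition A S N" "jordan_decomposition A S' N'"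
  shows "S = S'"
proof -
  have A: "A = S + N" and SN: "S ** N = N ** S" and "nilpotent_matrix N" "semisimple_matrix S"
    using assms(1) by (auto simp: jordan_decomposition_def)
  then obtain q Q \<delta> where q: "((**) N ^^ q) (mat 1) = 0" and D: "diagonalizes Q S \<delta>"
    by (auto simp: nilpotent_matrix_def semisimple_matrix_def)
  have Q: "invertible Q" using D by (auto simp: diagonalizes_def)
  note Qi = matrix_inv_invertible[OF Q]
  have "S *v (matrix_inv Q *v axis i 1) = S' *v (matrix_inv Q *v axis i 1)" for i
  proof -
    let ?p = "matrix_inv Q *v axis i 1"
    have "diagonal_matrix \<delta> *v axis i 1 = \<delta> $ i *s axis i 1"
      by (simp add: vec_eq_iff diagonal_matrix_vec axis_def)
    then have Sp: "S *v ?p = \<delta> $ i *s ?p"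
      by (simp add: diagonalizes_eq[OF D, of ?p] Qi matrix_vector_smult)
    have "((\<lambda>v. A *v v - \<delta> $ i *s v) ^^ q) ?p = 0"
      by (simp only: jordan_shift_eigenvector(1)[OF A SN Sp] funpow_matrix_mul[symmetric] q) simp
    from jordan_generalized_eigenvector[OF assms(2) this] Sp show ?thesis by simp
  qed
  then have "(S ** matrix_inv Q) *v axis i 1 = (S' ** matrix_inv Q) *v axis i 1" for i
    by (simp add: matrix_vector_mul_assoc)
  then have *: "((S ** matrix_inv Q) *v axis i 1) $ a = ((S' ** matrix_inv Q) *v axis i 1) $ a" for a i
    by (simp only:)
  have "(S ** matrix_inv Q) $ a $ i = (S' ** matrix_inv Q) $ a $ i" for a i
    using *[of i a] by (simp add: matrix_vector_mul_axis)
  then have "S ** matrix_inv Q = S' ** matrix_inv Q" by (simp add: vec_eq_iff)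
  then have "S ** matrix_inv Q ** Q = S' ** matrix_inv Q ** Q" by simp
  then show ?thesis by (simp add: matrix_mul_assoc[symmetric] Qi)
qed

lemma jordan_decomposition_conj:
  fixes A B C :: "complex ^ 'n ^ 'n"
  assumes J: "jordan_decomposition A S N" and BC: "B ** C = mat 1" "C ** B = mat 1"
  shows "jordan_decomposition (B ** A ** C) (B ** S ** C) (B ** N ** C)"
proof -
  have A: "A = S + N" and SN: "S ** N = N ** S" and "nilpotent_matrix N" "semisimple_matrix S"
    using J by (auto simp: jordan_decomposition_def)
  then obtain q Q \<delta> where q: "((**) N ^^ q) (mat 1) = 0" and D: "diagonalizes Q S \<delta>"
    by (auto simp: nilpotent_matrix_def semisimple_matrix_def)
  have iQ: "invertible Q" and QS: "Q ** S ** matrix_inv Q = diagonal_matrix \<delta>"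
    using D by (auto simp: diagonalizes_def)
  note Qi = matrix_inv_invertible[OF iQ]
  have m: "(B ** X ** C) ** (B ** Y ** C) = B ** (X ** Y) ** C" for X Y :: "complex ^ 'n ^ 'n"
    by (metis BC(2) matrix_mul_assoc matrix_mul_rid)
  have "((**) (B ** N ** C) ^^ k) (mat 1) = B ** (((**) N ^^ k) (mat 1)) ** C" for k
    by (induction k) (simp_all add: BC m)
  then have "nilpotent_matrix (B ** N ** C)"
    unfolding nilpotent_matrix_def using q by (intro exI[of _ q]) simp
  moreover have "semisimple_matrix (B ** S ** C)"
  proof -
    have inv: "(Q ** C) ** (B ** matrix_inv Q) = mat 1" "(B ** matrix_inv Q) ** (Q ** C) = mat 1"
      by (metis BC Qi matrix_mul_assoc matrix_mul_rid)+
    then have "invertible (Q ** C)" unfolding invertible_def by blast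
    moreover from this have "matrix_inv (Q ** C) = B ** matrix_inv Q"
      using inv by (metis matrix_inv_invertible(2) matrix_mul_assoc matrix_mul_lid matrix_mul_rid)
    moreover have "Q ** C ** (B ** S ** C) ** (B ** matrix_inv Q) = diagonal_matrix \<delta>"
      unfolding QS[symmetric] by (metis BC(2) matrix_mul_assoc matrix_mul_rid)
    ultimately show ?thesis unfolding semisimple_matrix_def diagonalizes_def by metis
  qed
  moreover have "B ** A ** C = B ** S ** C + B ** N ** C"
    by (simp add: A vec_eq_iff matrix_matrix_mult_def sum.distrib algebra_simps)
  ultimately show ?thesis unfolding jordan_decomposition_def by (simp add: m SN)
qed

section \<open>Integral relations between the eigenvalues\<close>

text \<open>As long as the numbers \<open>\<beta>\<close> satisfy an integral relation, one of them can be eliminated if the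
  others are divided by its coefficient; the process stops by finiteness.\<close>

lemma integral_basis_step:
  fixes z :: "'i \<Rightarrow> complex" and \<beta> :: "'i \<Rightarrow> complex" and K :: "'i set"
  assumes "finite K" "\<forall>i\<in>I. z i = (\<Sum>k\<in>K. of_int (q i k) * \<beta> k)"
  shows "\<exists>K q \<beta>. finite (K :: 'i set) \<and> (\<forall>i\<in>I. z i = (\<Sum>k\<in>K. of_int (q i k) * \<beta> k)) \<and>
    (\<forall>c :: 'i \<Rightarrow> int. (\<Sum>k\<in>K. of_int (c k) * \<beta> k) = 0 \<longrightarrow> (\<forall>k\<in>K. c k = 0))"
  using assms
proof (induction "card K" arbitrary: K q \<beta> rule: less_induct)
  case less
  show ?case
  proof (cases "\<forall>c :: 'i \<Rightarrow> int. (\<Sum>k\<in>K. of_int (c k) * \<beta> k) = 0 \<longrightarrow> (\<forall>k\<in>K. c k = 0)")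
    case True
    with less.prems show ?thesis by (intro exI[of _ K] exI[of _ q] exI[of _ \<beta>]) simp
  next
    case False
    then obtain c :: "'i \<Rightarrow> int" and k0 where c: "(\<Sum>k\<in>K. of_int (c k) * \<beta> k) = 0" "k0 \<in> K" "c k0 \<noteq> 0"
      by blast
    let ?K = "K - {k0}"
    have split: "sum f K = f k0 + sum f ?K" for f :: "'i \<Rightarrow> complex"
      using less.prems(1) c(2) by (rule sum.remove)
    have b0: "\<beta> k0 = - (\<Sum>k\<in>?K. of_int (c k) * \<beta> k) / of_int (c k0)"
      using c(1,3) unfolding split by (simp add: field_simps eq_neg_iff_add_eq_0)
    show ?thesis
    proof (rule less.hyps[where K = ?K and q = "\<lambda>i k. q i k * c k0 - q i k0 * c k" and \<beta> = "\<lambda>k. \<beta> k / of_int (c k0)"])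
      show "card ?K < card K" by (rule card_Diff1_less[OF less.prems(1) c(2)])
      show "\<forall>i\<in>I. z i = (\<Sum>k\<in>?K. of_int (q i k * c k0 - q i k0 * c k) * (\<beta> k / of_int (c k0)))"
      proof
        fix i assume "i \<in> I"
        then have "z i = of_int (q i k0) * \<beta> k0 + (\<Sum>k\<in>?K. of_int (q i k) * \<beta> k)"
          using less.prems(2) split by simp
        also have "\<dots> = (\<Sum>k\<in>?K. of_int (q i k) * \<beta> k - of_int (q i k0) * (of_int (c k) * \<beta> k) / of_int (c k0))"
          unfolding b0 by (simp add: sum_subtractf sum_divide_distrib[symmetric] sum_distrib_left[symmetric])
        also have "\<dots> = (\<Sum>k\<in>?K. of_int (q i k * c k0 - q i k0 * c k) * (\<beta> k / of_int (c k0)))"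
          using c(3) by (intro sum.cong refl) (simp add: field_simps)
        finally show "z i = (\<Sum>k\<in>?K. of_int (q i k * c k0 - q i k0 * c k) * (\<beta> k / of_int (c k0)))" .
      qed
    qed (use less.prems(1) in auto)
  qed
qed

text \<open>Finitely many complex numbers are integral combinations of numbers that are linearly independent
  over \<open>\<int>\<close>. With this, an integral linear relation between complex numbers splits into relations
  between the integral coefficients.\<close>

lemma integral_basis:
  fixes z :: "'i \<Rightarrow> complex"
  assumes "finite I"
  obtains K :: "'i set" and q \<beta> where "finite K" "\<And>i. i \<in> I \<Longrightarrow> z i = (\<Sum>k\<in>K. of_int (q i k) * \<beta> k)"
    "\<And>c k. (\<Sum>k\<in>K. of_int (c k) * \<beta> k) = 0 \<Longrightarrow> k \<in> K \<Longrightarrow> c k = 0"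
proof -
  have "\<forall>i\<in>I. z i = (\<Sum>k\<in>I. of_int (if k = i then 1 else 0) * z k)"
  proof
    fix i assume i: "i \<in> I"
    have "(\<Sum>k\<in>I. of_int (if k = i then 1 else 0) * z k) = (\<Sum>k\<in>I. if k = i then z k else 0)"
      by (intro sum.cong) auto
    then show "z i = (\<Sum>k\<in>I. of_int (if k = i then 1 else 0) * z k)" using assms i by simp
  qed
  from integral_basis_step[where I = I and z = z and q = "\<lambda>i k. if k = i then 1 else 0", OF assms this]
  show ?thesis
  proof (elim exE conjE)
    fix K :: "'i set" and q :: "'i \<Rightarrow> 'i \<Rightarrow> int" and \<beta> :: "'i \<Rightarrow> complex"
    assume K: "finite K" "\<forall>i\<in>I. z i = (\<Sum>k\<in>K. of_int (q i k) * \<beta> k)"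
      "\<forall>c :: 'i \<Rightarrow> int. (\<Sum>k\<in>K. of_int (c k) * \<beta> k) = 0 \<longrightarrow> (\<forall>k\<in>K. c k = 0)"
    show ?thesis
    proof (rule that[OF K(1)])
      show "z i = (\<Sum>k\<in>K. of_int (q i k) * \<beta> k)" if "i \<in> I" for i
        by (rule bspec[OF K(2) that])
      show "c k = 0" if "(\<Sum>k\<in>K. of_int (c k) * \<beta> k) = 0" "k \<in> K" for c k
        by (rule bspec[OF mp[OF spec[OF K(3)] that(1)] that(2)])
    qed
  qed
qed

lemma lattice_basis_expansion:
  assumes "lattice_basis r \<rho> L" "x \<in> L"
  obtains n where "x = (\<Sum>k<r. n k *s \<rho> k)"
proof -
  have i: "inj_on \<rho> {..<r}" and "x \<in> int_vec.span (\<rho> ` {..<r})"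
    using assms by (auto simp: lattice_basis_def)
  then obtain u where "x = (\<Sum>v\<in>\<rho> ` {..<r}. u v *s v)"
    using int_vec.span_finite[of "\<rho> ` {..<r}"] by auto
  then have "x = (\<Sum>k<r. u (\<rho> k) *s \<rho> k)" by (simp add: sum.reindex[OF i])
  then show ?thesis by (rule that)
qed

lemma lattice_basis_mem: "lattice_basis r \<rho> L \<Longrightarrow> k < r \<Longrightarrow> \<rho> k \<in> L"
  using int_vec.span_base[of "\<rho> k" "\<rho> ` {..<r}"] by (auto simp: lattice_basis_def)

lemma lattice_basis_int_independent:
  assumes "lattice_basis r \<rho> L" "(\<Sum>k<r. n k *s \<rho> k) = 0" "k < r"
  shows "n k = 0"
proof -
  have i: "inj_on \<rho> {..<r}" and ind: "int_vec.independent (\<rho> ` {..<r})"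
    using assms by (auto simp: lattice_basis_def)
  let ?u = "\<lambda>v. n (the_inv_into {..<r} \<rho> v)"
  have u: "?u (\<rho> k) = n k" if "k < r" for k using the_inv_into_f_f[OF i, of k] that by simp
  have "(\<Sum>v\<in>\<rho> ` {..<r}. ?u v *s v) = 0"
    using assms(2) by (simp add: sum.reindex[OF i] u cong: sum.cong_simp)
  then have "?u (\<rho> k) = 0"
    by (rule int_vec.independentD[OF ind, rotated 2]) (use assms(3) in auto)
  then show ?thesis using u assms(3) by simp
qed

text \<open>Linear independence over \<open>\<int>\<close> of integer vectors implies linear independence over \<open>\<complex>\<close>: by
  expanding the coefficients in an integral basis, a complex relation decomposes into integral ones.\<close>

lemma lattice_basis_complex_independent:
  fixes z :: "nat \<Rightarrow> complex"
  assumes b: "lattice_basis r \<rho> L" and z: "\<And>j. (\<Sum>k<r. z k * of_int (\<rho> k $ j)) = 0" and "k < r"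
  shows "z k = 0"
proof -
  obtain K :: "nat set" and q \<beta> where K: "finite K" "\<And>i. i \<in> {..<r} \<Longrightarrow> z i = (\<Sum>b\<in>K. of_int (q i b) * \<beta> b)"
    "\<And>c b. (\<Sum>b\<in>K. of_int (c b) * \<beta> b) = 0 \<Longrightarrow> b \<in> K \<Longrightarrow> c b = 0"
    by (rule integral_basis[OF finite_lessThan[of r], of z]) (rule that)
  have "(\<Sum>k<r. q k b * \<rho> k $ j) = 0" if "b \<in> K" for b j
  proof (rule K(3)[OF _ that])
    have "(\<Sum>b\<in>K. of_int (\<Sum>k<r. q k b * \<rho> k $ j) * \<beta> b) = (\<Sum>b\<in>K. \<Sum>k<r. of_int (q k b) * \<beta> b * of_int (\<rho> k $ j))"
      by (simp add: sum_distrib_left sum_distrib_right mult_ac)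
    also have "\<dots> = (\<Sum>k<r. z k * of_int (\<rho> k $ j))"
      by (subst sum.swap) (simp add: K(2) sum_distrib_right)
    finally show "(\<Sum>b\<in>K. of_int (\<Sum>k<r. q k b * \<rho> k $ j) * \<beta> b) = 0" using z by simp
  qed
  then have "(\<Sum>k<r. q k b *s \<rho> k) = 0" if "b \<in> K" for b using that by (simp add: vec_eq_iff)
  then have "q k b = 0" if "b \<in> K" for b
    using lattice_basis_int_independent[OF b _ \<open>k < r\<close>, of "\<lambda>k. q k b"] that by simp
  then show ?thesis using K(2)[of k] \<open>k < r\<close> by simp
qed

lemma resonance_lattice_iff:
  "\<rho> \<in> resonance_lattice \<gamma> \<longleftrightarrow> (\<forall>c\<in>resonances \<gamma>. (\<Sum>j\<in>UNIV. \<rho> $ j * c $ j) = 0) \<and>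
     (\<forall>j k. \<gamma> $ j = \<gamma> $ k \<longrightarrow> \<rho> $ j = \<rho> $ k)"
  by (simp add: resonance_lattice_def)

text \<open>The vector \<open>\<gamma>\<close> satisfies the homogeneous linear equations with integral coefficients that define
  the lattice. Expanding its entries in an integral basis \<open>\<beta>\<close> gives one integer vector for each \<open>\<beta>\<^sub>b\<close>,
  and each of these satisfies the same equations.\<close>

lemma eigenvalues_in_span_of_lattice:
  fixes \<gamma> :: "complex ^ 'n"
  assumes b: "lattice_basis r \<rho> (resonance_lattice \<gamma>)"
  obtains \<kappa> :: "nat \<Rightarrow> complex" where "\<And>j. \<gamma> $ j = (\<Sum>k<r. \<kappa> k * of_int (\<rho> k $ j))"
proof -
  obtain K :: "'n set" and q \<beta> where K: "finite K" "\<And>j. j \<in> UNIV \<Longrightarrow> \<gamma> $ j = (\<Sum>b\<in>K. of_int (q j b) * \<beta> b)"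
    "\<And>c b. (\<Sum>b\<in>K. of_int (c b) * \<beta> b) = 0 \<Longrightarrow> b \<in> K \<Longrightarrow> c b = 0"
    by (rule integral_basis[OF finite[of UNIV], of "\<lambda>j. \<gamma> $ j"]) (rule that)
  have mem: "(\<chi> j. q j b) \<in> resonance_lattice \<gamma>" if "b \<in> K" for b
    unfolding resonance_lattice_iff
  proof (intro conjI ballI allI impI)
    fix c assume "c \<in> resonances \<gamma>"
    then have "0 = (\<Sum>j\<in>UNIV. of_int (c $ j) * \<gamma> $ j)" by (simp add: resonances_def)
    also have "\<dots> = (\<Sum>j\<in>UNIV. \<Sum>b\<in>K. of_int (q j b * c $ j) * \<beta> b)"
      by (simp add: K(2) sum_distrib_left mult_ac)
    also have "\<dots> = (\<Sum>b\<in>K. of_int (\<Sum>j\<in>UNIV. q j b * c $ j) * \<beta> b)"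
      by (subst sum.swap) (simp add: sum_distrib_right)
    finally have "(\<Sum>b\<in>K. of_int (\<Sum>j\<in>UNIV. q j b * c $ j) * \<beta> b) = 0" by simp
    from K(3)[where c = "\<lambda>b. \<Sum>j\<in>UNIV. q j b * c $ j", OF this that]
    have "(\<Sum>j\<in>UNIV. q j b * c $ j) = 0" .
    then show "(\<Sum>j\<in>UNIV. (\<chi> j. q j b) $ j * c $ j) = 0" by simp
  next
    fix i j assume "\<gamma> $ i = \<gamma> $ j"
    then have "(\<Sum>b\<in>K. of_int (q i b - q j b) * \<beta> b) = 0"
      by (simp add: K(2) algebra_simps sum_subtractf)
    from K(3)[where c = "\<lambda>b. q i b - q j b", OF this that] show "(\<chi> j. q j b) $ i = (\<chi> j. q j b) $ j" by simp
  qed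
  have "\<exists>n. \<forall>j. q j b = (\<Sum>k<r. n k * \<rho> k $ j)" if bK: "b \<in> K" for b
  proof -
    obtain n where "(\<chi> j. q j b) = (\<Sum>k<r. n k *s \<rho> k)"
      using lattice_basis_expansion[OF b mem[OF bK]] by blast
    then have "q j b = (\<Sum>k<r. n k * \<rho> k $ j)" for j by (simp add: vec_eq_iff)
    then show ?thesis by blast
  qed
  then have "\<exists>n. \<forall>b\<in>K. \<forall>j. q j b = (\<Sum>k<r. n b k * \<rho> k $ j)" by (intro bchoice) blast
  then obtain n where n: "\<And>b j. b \<in> K \<Longrightarrow> q j b = (\<Sum>k<r. n b k * \<rho> k $ j)" by blast
  have "\<gamma> $ j = (\<Sum>k<r. (\<Sum>b\<in>K. of_int (n b k) * \<beta> b) * of_int (\<rho> k $ j))" for j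
  proof -
    have "\<gamma> $ j = (\<Sum>b\<in>K. \<Sum>k<r. of_int (n b k) * \<beta> b * of_int (\<rho> k $ j))"
      by (subst K(2)) (auto intro!: sum.cong simp: n sum_distrib_left sum_distrib_right mult_ac)
    then show ?thesis by (subst (asm) sum.swap) (simp add: sum_distrib_right)
  qed
  then show ?thesis by (rule that)
qed

text \<open>According to whether the degree of \<open>m\<close> is 0, 1 or larger, the relation is supplied by the resonance
  \<open>e\<^sub>k\<close> (here \<open>\<gamma>\<^sub>k = 0\<close>), by an equality \<open>\<gamma>\<^sub>l = \<gamma>\<^sub>k\<close> of eigenvalues, or by the resonance \<open>m - e\<^sub>k\<close>.\<close>

lemma resonant_monomial:
  fixes m :: "'n::finite \<Rightarrow> nat" and \<gamma> :: "complex ^ 'n"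
  assumes m: "(\<Sum>i\<in>UNIV. of_nat (m i) * \<gamma> $ i) = \<gamma> $ k" and \<rho>: "\<rho> \<in> resonance_lattice \<gamma>"
  shows "(\<Sum>i\<in>UNIV. int (m i) * \<rho> $ i) = \<rho> $ k"
proof -
  have res: "(\<Sum>j\<in>UNIV. \<rho> $ j * c $ j) = 0" if "c \<in> resonances \<gamma>" for c
    using \<rho> that unfolding resonance_lattice_iff by blast
  have eq: "\<gamma> $ i = \<gamma> $ j \<Longrightarrow> \<rho> $ i = \<rho> $ j" for i j
    using \<rho> unfolding resonance_lattice_iff by blast
  have pick: "(\<Sum>i\<in>UNIV. (if i = k then 1 else 0) * f i) = (f k :: 'z :: semiring_1)" for f and k :: 'n
  proof -
    have "(\<Sum>i\<in>UNIV. (if i = k then 1 else 0) * f i) = (\<Sum>i\<in>UNIV. if i = k then f i else 0)"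
      by (intro sum.cong) auto
    then show ?thesis by simp
  qed
  consider "sum m UNIV = 0" | "sum m UNIV = 1" | "sum m UNIV \<ge> 2" by linarith
  then show ?thesis
  proof cases
    case 1
    then have m0: "m i = 0" for i by simp
    then have "\<gamma> $ k = 0" using m by simp
    let ?c = "(\<chi> i. if i = k then 1 else 0) :: int ^ 'n"
    have "(\<Sum>j\<in>UNIV. of_int (?c $ j) * \<gamma> $ j) = (\<Sum>i\<in>UNIV. (if i = k then 1 else 0) * \<gamma> $ i)"
      by (intro sum.cong) auto
    moreover have "{j. ?c $ j < 0} = {}" by auto
    ultimately have "?c \<in> resonances \<gamma>"
      using \<open>\<gamma> $ k = 0\<close> unfolding resonances_def by (auto simp: pick)
    from res[OF this] have "\<rho> $ k = 0" using pick[of k "\<lambda>i. \<rho> $ i"] by (simp add: mult.commute)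
    then show ?thesis using m0 by simp
  next
    case 2
    then obtain l where l: "m l = 1" "\<And>i. i \<noteq> l \<Longrightarrow> m i = 0"
      using sum_eq_Suc0_iff[of UNIV m] by auto
    have mi: "m i = (if i = l then 1 else 0)" for i using l by auto
    have "(\<Sum>i\<in>UNIV. of_nat (m i) * \<gamma> $ i) = (\<Sum>i\<in>UNIV. (if i = l then 1 else 0) * \<gamma> $ i)"
      by (intro sum.cong) (auto simp: mi)
    then have "\<gamma> $ l = \<gamma> $ k" using m by (simp add: pick)
    moreover have "(\<Sum>i\<in>UNIV. int (m i) * \<rho> $ i) = (\<Sum>i\<in>UNIV. (if i = l then 1 else 0) * \<rho> $ i)"
      by (intro sum.cong) (auto simp: mi)
    ultimately show ?thesis using eq[of l k] by (simp add: pick)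
  next
    case 3
    let ?c = "(\<chi> i. int (m i) - (if i = k then 1 else 0)) :: int ^ 'n"
    have "(\<Sum>j\<in>UNIV. of_int (?c $ j) * \<gamma> $ j)
        = (\<Sum>j\<in>UNIV. of_nat (m j) * \<gamma> $ j) - (\<Sum>i\<in>UNIV. (if i = k then 1 else 0) * \<gamma> $ i)"
      unfolding sum_subtractf[symmetric] by (intro sum.cong) (auto simp: algebra_simps)
    then have "(\<Sum>j\<in>UNIV. of_int (?c $ j) * \<gamma> $ j) = 0" by (simp add: m pick)
    moreover have "(\<Sum>j\<in>UNIV. ?c $ j) \<ge> 1"
    proof -
      have "(\<Sum>j\<in>UNIV. ?c $ j) = int (sum m UNIV) - 1" by (simp add: sum_subtractf)
      then show ?thesis using 3 by linarith
    qed
    moreover have "card {j. ?c $ j < 0} \<le> 1"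
    proof -
      \<comment> \<open>Subtracting \<open>e\<^sub>k\<close> can make at most the \<open>k\<close>-th entry negative.\<close>
      have "{j. ?c $ j < 0} \<subseteq> {k}" by auto
      then show ?thesis using card_mono[of "{k}"] by simp
    qed
    ultimately have "?c \<in> resonances \<gamma>" by (auto simp: resonances_def)
    from res[OF this] have "0 = (\<Sum>i\<in>UNIV. int (m i) * \<rho> $ i) - (\<Sum>i\<in>UNIV. (if i = k then 1 else 0) * \<rho> $ i)"
      unfolding sum_subtractf[symmetric] by (simp add: algebra_simps)
    then show ?thesis by (simp add: pick)
  qed
qed


section \<open>The linear torus action\<close>

definition torus_mult :: "nat \<Rightarrow> (nat \<Rightarrow> int ^ 'n) \<Rightarrow> (nat \<Rightarrow> real) \<Rightarrow> complex ^ 'n \<Rightarrow> complex ^ 'n" where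
  "torus_mult r \<rho> t x = (\<chi> j. cis (\<Sum>k<r. t k * of_int (\<rho> k $ j)) * x $ j)"

lemma torus_mult_nth [simp]: "torus_mult r \<rho> t x $ j = cis (\<Sum>k<r. t k * of_int (\<rho> k $ j)) * x $ j"
  by (simp add: torus_mult_def)

lemma clinear_torus_mult: "clinear (torus_mult r \<rho> t)"
  by (simp add: clinear_iff vec_eq_iff algebra_simps)

lemma torus_mult_cong:
  assumes "torus_eq r s t"
  shows "torus_mult r \<rho> s x = torus_mult r \<rho> t x"
proof -
  have "\<exists>n. t k = s k + of_int n * (2 * pi)" if "k < r" for k
    using assms that unfolding torus_eq_def rcong_altdef by auto
  then obtain n where n: "\<And>k. k < r \<Longrightarrow> t k = s k + of_int (n k) * (2 * pi)" by metis
  have "cis (\<Sum>k<r. t k * of_int (\<rho> k $ j)) = cis (\<Sum>k<r. s k * of_int (\<rho> k $ j))" for j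
  proof -
    have "(\<Sum>k<r. t k * of_int (\<rho> k $ j)) = (\<Sum>k<r. s k * of_int (\<rho> k $ j) + 2 * pi * of_int (n k * \<rho> k $ j))"
      by (intro sum.cong refl) (simp add: n algebra_simps)
    also have "\<dots> = (\<Sum>k<r. s k * of_int (\<rho> k $ j)) + 2 * pi * of_int (\<Sum>k<r. n k * \<rho> k $ j)"
      by (simp add: sum.distrib sum_distrib_left)
    also have "cis \<dots> = cis (\<Sum>k<r. s k * of_int (\<rho> k $ j)) * cis (2 * pi * of_int (\<Sum>k<r. n k * \<rho> k $ j))"
      by (simp only: cis_mult)
    also have "cis (2 * pi * of_int (\<Sum>k<r. n k * \<rho> k $ j)) = 1" by (rule cis_multiple_2pi) (rule Ints_of_int)
    finally show ?thesis by simp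
  qed
  then show ?thesis by (simp add: vec_eq_iff)
qed

lemma torus_mult_zero: "torus_mult r \<rho> (\<lambda>_. 0) x = x"
  by (simp add: vec_eq_iff)

lemma torus_mult_add: "torus_mult r \<rho> (\<lambda>k. s k + t k) x = torus_mult r \<rho> s (torus_mult r \<rho> t x)"
  by (simp add: vec_eq_iff algebra_simps sum.distrib cis_mult)

lemma torus_mult_polydisc: "torus_mult r \<rho> t x \<in> polydisc R \<longleftrightarrow> x \<in> polydisc R"
  by (simp add: polydisc_def norm_mult)

lemma continuous_on_torus_mult:
  assumes "continuous_on A t" "continuous_on A f"
  shows "continuous_on A (\<lambda>p. torus_mult r \<rho> (t p) (f p))"
proof -
  have "continuous_on A (\<lambda>p. t p k)" for k
    using continuous_on_compose2[OF continuous_on_product_coordinates assms(1)] by simp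
  then show ?thesis
    unfolding torus_mult_def
    by (intro continuous_on_vec_lambda continuous_intros continuous_on_cis assms)
qed

lemma has_vector_derivative_vec_lambda:
  fixes g :: "real \<Rightarrow> 'n::finite \<Rightarrow> complex"
  assumes "\<And>j. ((\<lambda>s. g s j) has_vector_derivative g' j) (at s)"
  shows "((\<lambda>s. \<chi> j. g s j) has_vector_derivative (\<chi> j. g' j)) (at s)"
proof -
  have "((\<lambda>s. \<Sum>j\<in>UNIV. g s j *s axis j 1) has_vector_derivative (\<Sum>j\<in>UNIV. g' j *s axis j (1 :: complex))) (at s)"
    by (intro has_vector_derivative_sum bounded_linear.has_vector_derivative[OF smult.bounded_linear_left] assms)
  then show ?thesis using basis_expansion[of "\<chi> j. g _ j"] basis_expansion[of "\<chi> j. g' j"] by simp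
qed

lemma torus_mult_circle_has_vector_derivative:
  assumes "k < r"
  shows "((\<lambda>s. torus_mult r \<rho> ((\<lambda>_. 0)(k := s)) x) has_vector_derivative
     \<i> *s (\<chi> j. of_int (\<rho> k $ j) * torus_mult r \<rho> ((\<lambda>_. 0)(k := s)) x $ j)) (at s)"
proof -
  have sum: "(\<Sum>i<r. ((\<lambda>_. 0)(k := s)) i * of_int (\<rho> i $ j)) = s * of_int (\<rho> k $ j)" for s :: real and j
  proof -
    have "(\<Sum>i<r. ((\<lambda>_. 0)(k := s)) i * of_int (\<rho> i $ j)) = (\<Sum>i<r. if i = k then s * of_int (\<rho> k $ j) else 0)"
      by (intro sum.cong) auto
    then show ?thesis using assms by simp
  qed
  have tm: "torus_mult r \<rho> ((\<lambda>_. 0)(k := s)) x = (\<chi> j. cis (s * of_int (\<rho> k $ j)) * x $ j)" for s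
    unfolding torus_mult_def by (simp only: sum)
  have "((\<lambda>s. cis (s * of_int (\<rho> k $ j)) * x $ j) has_vector_derivative
      \<i> * (of_int (\<rho> k $ j) * (cis (s * of_int (\<rho> k $ j)) * x $ j))) (at s)" for j
  proof -
    have "((\<lambda>s. exp (\<i> * of_real s * of_int (\<rho> k $ j)) * x $ j) has_vector_derivative
      \<i> * (of_int (\<rho> k $ j) * (cis (s * of_int (\<rho> k $ j)) * x $ j))) (at s)"
      by (rule has_vector_derivative_real_field)
         (auto intro!: derivative_eq_intros simp: cis_conv_exp mult_ac)
    then show ?thesis by (simp add: cis_conv_exp mult_ac)
  qed
  then show ?thesis
    using has_vector_derivative_vec_lambda[of "\<lambda>s j. cis (s * of_int (\<rho> k $ j)) * x $ j"
        "\<lambda>j. \<i> * (of_int (\<rho> k $ j) * (cis (s * of_int (\<rho> k $ j)) * x $ j))" s]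
    unfolding tm by (simp add: vector_scalar_mult_def)
qed

text \<open>If \<open>t\<close> acts trivially, then the combination of the \<open>\<rho>\<^sub>k\<close> with coefficients \<open>t\<^sub>k / 2\<pi>\<close> is an integer
  vector. It satisfies the equations that define the lattice, so it is an integral combination of the
  \<open>\<rho>\<^sub>k\<close>; by independence over the complex numbers the \<open>t\<^sub>k / 2\<pi>\<close> are integers.\<close>

lemma torus_mult_effective:
  fixes \<gamma> :: "complex ^ 'n"
  assumes b: "lattice_basis r \<rho> (resonance_lattice \<gamma>)" and "0 < R"
    and id: "\<And>x. x \<in> polydisc R \<Longrightarrow> torus_mult r \<rho> t x = x"
  shows "torus_eq r t (\<lambda>_. 0)"
proof -
  \<comment> \<open>A point without vanishing coordinates detects all weights.\<close>
  let ?x = "(\<chi> j. of_real (R / 2)) :: complex ^ 'n"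
  have "?x \<in> polydisc R" using \<open>0 < R\<close> by (simp add: polydisc_def)
  from id[OF this] have cis1: "cis (\<Sum>k<r. t k * of_int (\<rho> k $ j)) = 1" for j
    using \<open>0 < R\<close> by (simp add: vec_eq_iff)
  have "cos (\<Sum>k<r. t k * of_int (\<rho> k $ j)) = 1" for j
    using cis1[of j] by (metis cis.sel(1) one_complex.sel(1))
  then have "\<exists>m :: int. (\<Sum>k<r. t k * of_int (\<rho> k $ j)) = of_int m * 2 * pi" for j
    unfolding cos_one_2pi_int .
  then obtain m where m: "\<And>j. (\<Sum>k<r. t k * of_int (\<rho> k $ j)) = of_int (m j) * 2 * pi" by metis
  define a where "a = (\<lambda>k. t k / (2 * pi))"
  have ma: "of_int (m j) = (\<Sum>k<r. a k * of_int (\<rho> k $ j))" for j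
    using m[of j] by (simp add: a_def sum_divide_distrib[symmetric])
  have mem: "\<rho> k \<in> resonance_lattice \<gamma>" if "k < r" for k by (rule lattice_basis_mem[OF b that])
  have "(\<chi> j. m j) \<in> resonance_lattice \<gamma>"
    unfolding resonance_lattice_iff
  proof (intro conjI ballI allI impI)
    fix c assume c: "c \<in> resonances \<gamma>"
    have "real_of_int (\<Sum>j\<in>UNIV. m j * c $ j) = (\<Sum>j\<in>UNIV. \<Sum>k<r. a k * of_int (\<rho> k $ j * c $ j))"
      by (simp add: ma sum_distrib_left sum_distrib_right mult_ac)
    also have "\<dots> = (\<Sum>k<r. a k * of_int (\<Sum>j\<in>UNIV. \<rho> k $ j * c $ j))"
      by (subst sum.swap) (simp add: sum_distrib_left)
    also have "\<dots> = 0"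
    proof (rule sum.neutral, rule ballI)
      fix k assume "k \<in> {..<r}"
      then have "(\<Sum>j\<in>UNIV. \<rho> k $ j * c $ j) = 0"
        using mem[of k] c unfolding resonance_lattice_iff by blast
      then show "a k * of_int (\<Sum>j\<in>UNIV. \<rho> k $ j * c $ j) = 0" by (simp only: of_int_0 mult_zero_right)
    qed
    finally have "(\<Sum>j\<in>UNIV. m j * c $ j) = 0" by (simp only: of_int_eq_0_iff)
    then show "(\<Sum>j\<in>UNIV. (\<chi> j. m j) $ j * c $ j) = 0" by simp
  next
    fix i j assume "\<gamma> $ i = \<gamma> $ j"
    then have "\<rho> k $ i = \<rho> k $ j" if "k < r" for k
      using mem[OF that] unfolding resonance_lattice_iff by blast
    then have "real_of_int (m i) = of_int (m j)" unfolding ma by simp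
    then show "(\<chi> j. m j) $ i = (\<chi> j. m j) $ j" by simp
  qed
  then obtain n where "(\<chi> j. m j) = (\<Sum>k<r. n k *s \<rho> k)" by (rule lattice_basis_expansion[OF b])
  then have mn: "m j = (\<Sum>k<r. n k * \<rho> k $ j)" for j by (simp add: vec_eq_iff)
  have "(\<Sum>k<r. complex_of_real (a k - of_int (n k)) * of_int (\<rho> k $ j)) = 0" for j
  proof -
    have "(\<Sum>k<r. (a k - of_int (n k)) * of_int (\<rho> k $ j)) = 0"
      using ma[of j] unfolding mn by (simp add: algebra_simps sum_subtractf)
    then have "complex_of_real (\<Sum>k<r. (a k - of_int (n k)) * of_int (\<rho> k $ j)) = 0" by (simp only: of_real_0)
    then show ?thesis by simp
  qed
  from lattice_basis_complex_independent[where z = "\<lambda>k. complex_of_real (a k - of_int (n k))", OF b this]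
  have "complex_of_real (a k - of_int (n k)) = 0" if "k < r" for k using that by blast
  then have "a k - of_int (n k) = 0" if "k < r" for k using that of_real_eq_0_iff by blast
  then have "t k = of_int (n k) * (2 * pi)" if "k < r" for k
    using that by (simp add: a_def field_simps)
  then have "[t k = 0] (rmod (2 * pi))" if "k < r" for k
    using that unfolding rcong_altdef by (intro exI[of _ "- n k"]) auto
  then show ?thesis by (simp add: torus_eq_def)
qed

lemma prod_cis: "(\<Prod>i\<in>I. cis (f i)) = cis (\<Sum>i\<in>I. f i)"
  by (induction I rule: infinite_finite_induct) (auto simp: cis_mult)

text \<open>The commutation hypothesis says that the \<open>k\<close>-th component of \<open>W\<close> is an eigenfunction of the linear
  field with eigenvalue \<open>\<gamma>\<^sub>k\<close>, and the torus multiplies all admissible monomials by the same factor.\<close>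

lemma normal_form_torus_equivariant:
  fixes W :: "complex ^ 'n \<Rightarrow> complex ^ 'n"
  assumes b: "lattice_basis r \<rho> (resonance_lattice \<gamma>)"
    and W: "holomorphic_map_on W (polydisc R)"
    and comm: "\<And>x. x \<in> polydisc R \<Longrightarrow>
      frechet_derivative W (at x) (diagonal_matrix \<gamma> *v x) = diagonal_matrix \<gamma> *v W x"
    and x: "x \<in> polydisc R"
  shows "W (torus_mult r \<rho> t x) = torus_mult r \<rho> t (W x)"
proof (rule vec_eq_iff[THEN iffD2], rule allI)
  fix k
  let ?\<theta> = "\<lambda>j. \<Sum>l<r. t l * of_int (\<rho> l $ j)"
  \<comment> \<open>A scalar component is embedded as a constant vector, to stay within vector-valued maps.\<close>
  let ?p = "\<lambda>w :: complex ^ 'n. (\<chi> i. w $ k) :: complex ^ 'n"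
  have p: "clinear ?p" by (simp add: clinear_iff vec_eq_iff)
  note ph = holomorphic_map_clinear_map[OF p]
  have dp: "frechet_derivative ?p (at w) = ?p" for w using frechet_derivative_at[OF ph(2)] by simp
  have f: "holomorphic_map_on (\<lambda>x. ?p (W x)) (polydisc R)"
    by (rule holomorphic_map_comp[OF W ph(1)]) simp
  have "?p (W (\<chi> i. if i \<in> UNIV then cis (?\<theta> i) * x $ i else x $ i)) = cis (?\<theta> k) *s ?p (W x)"
  proof (rule euler_eigenfunction_equivariant[where \<gamma> = \<gamma> and l = "\<gamma> $ k", OF finite _ f])
    fix y :: "complex ^ 'n" assume y: "y \<in> polydisc R"
    have E: "(\<chi> i. if i \<in> UNIV then \<gamma> $ i * y $ i else 0) = diagonal_matrix \<gamma> *v y"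
      by (simp add: vec_eq_iff diagonal_matrix_vec)
    show "frechet_derivative (\<lambda>x. ?p (W x)) (at y) (\<chi> i. if i \<in> UNIV then \<gamma> $ i * y $ i else 0)
        = \<gamma> $ k *s ?p (W y)"
      unfolding E frechet_derivative_comp[OF W ph(1) y UNIV_I] comm[OF y] dp
      by (simp add: vec_eq_iff diagonal_matrix_vec)
  next
    fix m :: "'n \<Rightarrow> nat" assume m: "(\<Sum>i\<in>UNIV. of_nat (m i) * \<gamma> $ i) = \<gamma> $ k"
    have "(\<Prod>i\<in>UNIV. cis (?\<theta> i) ^ m i) = (\<Prod>i\<in>UNIV. cis (of_nat (m i) * ?\<theta> i))"
      by (intro prod.cong refl) (rule Complex.DeMoivre)
    also have "\<dots> = cis (\<Sum>i\<in>UNIV. of_nat (m i) * ?\<theta> i)"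
      by (rule prod_cis)
    also have "(\<Sum>i\<in>UNIV. of_nat (m i) * ?\<theta> i) = (\<Sum>l<r. t l * of_int (\<Sum>i\<in>UNIV. int (m i) * \<rho> l $ i))"
      by (simp add: sum_distrib_left mult_ac) (rule sum.swap)
    also have "\<dots> = ?\<theta> k"
      by (intro sum.cong refl) (simp add: resonant_monomial[OF m lattice_basis_mem[OF b]])
    finally show "(\<Prod>i\<in>UNIV. cis (?\<theta> i) ^ m i) = cis (?\<theta> k)" .
  qed (use x in auto)
  then show "W (torus_mult r \<rho> t x) $ k = torus_mult r \<rho> t (W x) $ k"
    by (simp add: torus_mult_def vec_eq_iff)
qed

lemma frechet_derivative_cong_open:
  assumes "open A" "x \<in> A" "\<And>y. y \<in> A \<Longrightarrow> f y = g y"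
  shows "frechet_derivative f (at x) = frechet_derivative g (at x)"
proof -
  have "(f has_derivative f') (at x) \<longleftrightarrow> (g has_derivative f') (at x)" for f'
    using has_derivative_transform_within_open[OF _ assms(1,2)] assms(3) by metis
  then show ?thesis by (simp add: frechet_derivative_def)
qed

text \<open>The linear torus action preserves polydiscs, so it can be transported by the coordinates. The
  normalization of \<open>\<Phi>\<close> at 0 produces the prescribed linear part.\<close>

lemma torus_action_of_normal_coordinates:
  fixes X :: "complex ^ 'n \<Rightarrow> complex ^ 'n"
  assumes b: "lattice_basis r \<rho> (resonance_lattice \<gamma>)" and P: "invertible P" and R: "0 < R"
    and bi: "biholomorphism U (polydisc R) \<Phi> \<Psi>" and "0 \<in> U" "\<Phi> 0 = 0"
    and dP: "\<And>v. frechet_derivative \<Phi> (at 0) v = P *v v"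
    and X: "holomorphic_map_on X U"
    and comm: "\<And>y. y \<in> polydisc R \<Longrightarrow> frechet_derivative (push_forward \<Phi> \<Psi> X) (at y) (diagonal_matrix \<gamma> *v y)
       = diagonal_matrix \<gamma> *v push_forward \<Phi> \<Psi> X y"
  defines "\<alpha> \<equiv> \<lambda>t x. \<Psi> (torus_mult r \<rho> t (\<Phi> x))"
  shows "holomorphic_torus_action r U \<alpha>" "effective_action r U \<alpha>" "action_preserves U \<alpha> X"
    "\<alpha> t 0 = 0" "linear_part_generated_by r \<alpha> (\<lambda>k. torus_generator P (\<rho> k))"
proof -
  let ?T = "torus_mult r \<rho>" and ?W = "push_forward \<Phi> \<Psi> X"
  have h: "holomorphic_map_on \<Phi> U" "holomorphic_map_on \<Psi> (polydisc R)"
    and \<Phi>: "\<And>x. x \<in> U \<Longrightarrow> \<Phi> x \<in> polydisc R" "\<And>x. x \<in> U \<Longrightarrow> \<Psi> (\<Phi> x) = x"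
    and \<Psi>: "\<And>y. y \<in> polydisc R \<Longrightarrow> \<Psi> y \<in> U" "\<And>y. y \<in> polydisc R \<Longrightarrow> \<Phi> (\<Psi> y) = y"
    using bi by (auto simp: biholomorphism_def homeomorphism_def)
  have T\<Phi>: "?T t (\<Phi> x) \<in> polydisc R" if "x \<in> U" for t x using \<Phi>(1)[OF that] by (simp add: torus_mult_polydisc)
  have Th: "holomorphic_map_on (?T t) (polydisc R)" for t
    using holomorphic_map_on_subset[OF holomorphic_map_clinear_map(1)[OF clinear_torus_mult] open_polydisc] by simp
  have dT: "frechet_derivative (?T t) (at y) = ?T t" for t y
    using frechet_derivative_at[OF holomorphic_map_clinear_map(2)[OF clinear_torus_mult]] by metis
  have T\<Phi>h: "holomorphic_map_on (\<lambda>x. ?T t (\<Phi> x)) U" for t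
    by (rule holomorphic_map_comp[OF h(1) Th]) (use \<Phi> in auto)
  have \<alpha>h: "holomorphic_map_on (\<alpha> t) U" for t
    unfolding \<alpha>_def by (rule holomorphic_map_comp[OF T\<Phi>h h(2)]) (use T\<Phi> in auto)
  have d\<alpha>: "frechet_derivative (\<alpha> t) (at x) v = frechet_derivative \<Psi> (at (?T t (\<Phi> x))) (?T t (frechet_derivative \<Phi> (at x) v))"
    if "x \<in> U" for t x v
    unfolding \<alpha>_def
    by (simp add: frechet_derivative_comp[OF T\<Phi>h h(2) that T\<Phi>[OF that]]
        frechet_derivative_comp[OF h(1) Th that \<Phi>(1)[OF that]] dT)
  have T0: "?T t 0 = 0" for t by (simp add: vec_eq_iff)
  have zero: "(0 :: complex ^ 'n) \<in> polydisc R" "\<Psi> 0 = 0" using \<Phi>[OF \<open>0 \<in> U\<close>] \<open>\<Phi> 0 = 0\<close> by auto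
  show "\<alpha> t 0 = 0" for t by (simp add: \<alpha>_def \<open>\<Phi> 0 = 0\<close> T0 zero)
  show "holomorphic_torus_action r U \<alpha>"
    unfolding holomorphic_torus_action_def
  proof (intro conjI allI ballI impI \<alpha>h)
    show "\<alpha> s x = \<alpha> t x" if "torus_eq r s t" for s t x
      by (simp add: \<alpha>_def torus_mult_cong[OF that])
    show "\<alpha> t ` U \<subseteq> U" for t using T\<Phi> \<Psi> by (auto simp: \<alpha>_def)
    show "\<alpha> (\<lambda>_. 0) x = x" if "x \<in> U" for x using \<Phi>[OF that] by (simp add: \<alpha>_def torus_mult_zero)
    show "\<alpha> (\<lambda>k. s k + t k) x = \<alpha> s (\<alpha> t x)" if "x \<in> U" for s t x
      using T\<Phi>[OF that] \<Psi> by (simp add: \<alpha>_def torus_mult_add)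
    show "continuous_on (UNIV \<times> U) (\<lambda>(t, x). \<alpha> t x)"
      unfolding split_beta \<alpha>_def
    proof (rule continuous_on_compose2[OF holomorphic_map_continuous[OF h(2)]])
      show "continuous_on (UNIV \<times> U) (\<lambda>p. ?T (fst p) (\<Phi> (snd p)))"
        by (intro continuous_on_torus_mult continuous_on_compose2[OF holomorphic_map_continuous[OF h(1)]]
            continuous_on_fst continuous_on_snd continuous_on_id) auto
    qed (use T\<Phi> in auto)
  qed
  show "effective_action r U \<alpha>"
    unfolding effective_action_def
  proof (intro allI impI)
    fix t assume a: "\<forall>x\<in>U. \<alpha> t x = x"
    show "torus_eq r t (\<lambda>_. 0)"
    proof (rule torus_mult_effective[OF b R])
      fix y :: "complex ^ 'n" assume y: "y \<in> polydisc R"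
      then have "\<Phi> (\<alpha> t (\<Psi> y)) = y" using a \<Psi> by simp
      moreover have "?T t y \<in> polydisc R" using y by (simp add: torus_mult_polydisc)
      ultimately show "?T t y = y" using y \<Psi> by (simp add: \<alpha>_def)
    qed
  qed
  show "action_preserves U \<alpha> X"
    unfolding action_preserves_def
  proof (intro allI ballI)
    fix t x assume x: "x \<in> U"
    let ?z = "?T t (\<Phi> x)"
    have W: "?W (\<Phi> x) = frechet_derivative \<Phi> (at x) (X x)" using \<Phi>[OF x] by (simp add: push_forward_def)
    have "?W ?z = ?T t (?W (\<Phi> x))"
      by (rule normal_form_torus_equivariant[OF b push_forward_holomorphic(1)[OF bi X] comm \<Phi>(1)[OF x]])
    then have "frechet_derivative (\<alpha> t) (at x) (X x) = frechet_derivative \<Psi> (at ?z) (?W ?z)"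
      by (simp add: d\<alpha>[OF x] W)
    also have "\<dots> = frechet_derivative \<Psi> (at (\<Phi> (\<Psi> ?z))) (frechet_derivative \<Phi> (at (\<Psi> ?z)) (X (\<Psi> ?z)))"
      using \<Psi> T\<Phi>[OF x] by (simp add: push_forward_def)
    also have "\<dots> = X (\<Psi> ?z)"
      by (rule biholomorphism_derivative_inverse(1)[OF bi]) (use \<Psi> T\<Phi>[OF x] in auto)
    finally show "frechet_derivative (\<alpha> t) (at x) (X x) = X (\<alpha> t x)" by (simp add: \<alpha>_def)
  qed
  note Pi = matrix_inv_invertible[OF P]
  have d\<Psi>: "frechet_derivative \<Psi> (at 0) w = matrix_inv P *v w" for w
    using biholomorphism_derivative_inverse(1)[OF bi \<open>0 \<in> U\<close>, of "matrix_inv P *v w"]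
    by (simp add: dP Pi \<open>\<Phi> 0 = 0\<close>)
  have d0: "frechet_derivative (\<alpha> t) (at 0) z = matrix_inv P *v ?T t (P *v z)" for t z
    by (simp add: d\<alpha>[OF \<open>0 \<in> U\<close>] \<open>\<Phi> 0 = 0\<close> T0 d\<Psi> dP)
  show "linear_part_generated_by r \<alpha> (\<lambda>k. torus_generator P (\<rho> k))"
    unfolding linear_part_generated_by_def d0
  proof (intro allI impI)
    fix k z s assume "k < r"
    from bounded_linear.has_vector_derivative[OF matrix_vector_mul_bounded_linear
        torus_mult_circle_has_vector_derivative[OF this, of \<rho> "P *v z" s], of "matrix_inv P"]
    show "((\<lambda>s. matrix_inv P *v ?T ((\<lambda>_. 0)(k := s)) (P *v z)) has_vector_derivative
        \<i> *s torus_generator P (\<rho> k) (matrix_inv P *v ?T ((\<lambda>_. 0)(k := s)) (P *v z))) (at s)"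
      by (simp add: torus_generator_def Pi matrix_vector_smult)
  qed
qed


section \<open>From a normal form to a torus action\<close>

text \<open>Used with \<open>M\<close> the matrix that diagonalizes the semisimple part in the normalizing coordinates.\<close>

lemma biholomorphism_linear_change:
  fixes M Mi :: "complex ^ 'n ^ 'n"
  assumes bi: "biholomorphism U V \<phi> \<psi>" and M: "\<And>v. M *v (Mi *v v) = v" "\<And>v. Mi *v (M *v v) = v"
    and opA: "open A" and AV: "\<forall>y\<in>A. Mi *v y \<in> V"
  defines "\<Phi> \<equiv> \<lambda>x. M *v \<phi> x" and "\<Psi> \<equiv> \<lambda>y. \<psi> (Mi *v y)"
  shows "biholomorphism (\<Psi> ` A) A \<Phi> \<Psi>" "\<Psi> ` A \<subseteq> U"
    and "x \<in> U \<Longrightarrow> frechet_derivative \<Phi> (at x) v = M *v frechet_derivative \<phi> (at x) v"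
    and "y \<in> A \<Longrightarrow> push_forward \<Phi> \<Psi> X y = M *v push_forward \<phi> \<psi> X (Mi *v y)"
    and "holomorphic_map_on X U \<Longrightarrow> y \<in> A \<Longrightarrow> frechet_derivative (push_forward \<Phi> \<Psi> X) (at y) v
      = M *v frechet_derivative (push_forward \<phi> \<psi> X) (at (Mi *v y)) (Mi *v v)"
proof -
  have A: "open A" "\<And>y. y \<in> A \<Longrightarrow> Mi *v y \<in> V" using opA AV by auto
  have h: "holomorphic_map_on \<phi> U" "holomorphic_map_on \<psi> V"
    and \<phi>: "\<And>x. x \<in> U \<Longrightarrow> \<phi> x \<in> V" "\<And>x. x \<in> U \<Longrightarrow> \<psi> (\<phi> x) = x"
    and \<psi>: "\<And>y. y \<in> V \<Longrightarrow> \<psi> y \<in> U" "\<And>y. y \<in> V \<Longrightarrow> \<phi> (\<psi> y) = y"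
    using bi by (auto simp: biholomorphism_def homeomorphism_def)
  have ml: "clinear ((*v) B)" for B :: "complex ^ 'n ^ 'n" by (rule matrix_vector_mul_linear_gen)
  note mh = holomorphic_map_clinear_map[OF ml]
  have md: "frechet_derivative ((*v) B) (at w) = (*v) B" for B :: "complex ^ 'n ^ 'n" and w
    using frechet_derivative_at[OF mh(2)] by simp
  have MiA: "holomorphic_map_on ((*v) Mi) A" by (rule holomorphic_map_on_subset[OF mh(1) A(1)]) simp
  show sub: "\<Psi> ` A \<subseteq> U" using A(2) \<psi>(1) by (auto simp: \<Psi>_def)
  have \<Phi>h: "holomorphic_map_on \<Phi> U" unfolding \<Phi>_def by (rule holomorphic_map_comp[OF h(1) mh(1)]) simp
  have \<Psi>h: "holomorphic_map_on \<Psi> A" unfolding \<Psi>_def by (rule holomorphic_map_comp[OF MiA h(2)]) (use A(2) in auto)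
  have \<Phi>\<Psi>: "\<Phi> (\<Psi> y) = y" if "y \<in> A" for y using A(2)[OF that] \<psi> M by (simp add: \<Phi>_def \<Psi>_def)
  have \<Psi>\<Phi>: "\<Psi> (\<Phi> x) = x" if "x \<in> U" for x using \<phi>[OF that] M by (simp add: \<Phi>_def \<Psi>_def)
  have "\<Psi> ` A = U \<inter> \<Phi> -` A"
  proof (intro equalityI subsetI)
    show "x \<in> U \<inter> \<Phi> -` A" if "x \<in> \<Psi> ` A" for x using that sub \<Phi>\<Psi> by auto
    show "x \<in> \<Psi> ` A" if "x \<in> U \<inter> \<Phi> -` A" for x using that \<Psi>\<Phi> by (metis IntD1 IntD2 imageI vimageD)
  qed
  moreover have "open (U \<inter> \<Phi> -` A)"
    by (rule continuous_open_preimage[OF holomorphic_map_continuous[OF \<Phi>h] holomorphic_map_openD[OF h(1)] A(1)])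
  ultimately have op: "open (\<Psi> ` A)" by simp
  have \<Phi>h': "holomorphic_map_on \<Phi> (\<Psi> ` A)" by (rule holomorphic_map_on_subset[OF \<Phi>h op sub])
  show "biholomorphism (\<Psi> ` A) A \<Phi> \<Psi>"
    unfolding biholomorphism_def
  proof (intro conjI \<Phi>h' \<Psi>h)
    show "homeomorphism (\<Psi> ` A) A \<Phi> \<Psi>"
      by (rule homeomorphismI) (use \<Phi>\<Psi> holomorphic_map_continuous[OF \<Phi>h'] holomorphic_map_continuous[OF \<Psi>h] in auto)
  qed
  show dM: "x \<in> U \<Longrightarrow> frechet_derivative \<Phi> (at x) v = M *v frechet_derivative \<phi> (at x) v" for x v
    unfolding \<Phi>_def using frechet_derivative_comp[OF h(1) mh(1) _ UNIV_I] by (simp add: md)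
  show pf: "push_forward \<Phi> \<Psi> X y = M *v push_forward \<phi> \<psi> X (Mi *v y)" if "y \<in> A" for y
    using dM sub that by (auto simp: push_forward_def \<Psi>_def)
  assume X: "holomorphic_map_on X U" and y: "y \<in> A"
  note Y = push_forward_holomorphic(1)[OF bi X]
  have YMi: "holomorphic_map_on (\<lambda>y. push_forward \<phi> \<psi> X (Mi *v y)) A"
    by (rule holomorphic_map_comp[OF MiA Y]) (use A(2) in auto)
  have "frechet_derivative (push_forward \<Phi> \<Psi> X) (at y) v
      = frechet_derivative (\<lambda>y. M *v push_forward \<phi> \<psi> X (Mi *v y)) (at y) v"
    using frechet_derivative_cong_open[OF A(1) y, of "push_forward \<Phi> \<Psi> X"] pf by metis
  also have "\<dots> = M *v frechet_derivative (push_forward \<phi> \<psi> X) (at (Mi *v y)) (Mi *v v)"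
    by (simp only: frechet_derivative_comp[OF YMi mh(1) y UNIV_I] md
        frechet_derivative_comp[OF MiA Y y A(2)[OF y]])
  finally show "frechet_derivative (push_forward \<Phi> \<Psi> X) (at y) v
      = M *v frechet_derivative (push_forward \<phi> \<psi> X) (at (Mi *v y)) (Mi *v v)" .
qed

lemma linear_part_mult:
  assumes "holomorphic_map_on X U" "0 \<in> U"
  shows "linear_part X *v v = frechet_derivative X (at 0) v"
  unfolding linear_part_def by (rule matrix_works[OF holomorphic_map_clinear[OF assms]])

text \<open>With \<open>B\<close> and \<open>C\<close> the mutually inverse linear parts of \<open>\<phi>\<close> and \<open>\<psi>\<close>, uniqueness of the Jordan
  decomposition gives \<open>S' = B S C\<close>. So \<open>M = P C\<close> diagonalizes \<open>S'\<close>, and the coordinates \<open>M \<phi>\<close> have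
  linear part \<open>P\<close>.\<close>

lemma normalization_imp_torus_action:
  fixes X :: "complex ^ 'n \<Rightarrow> complex ^ 'n" and D :: "(complex ^ 'n) set"
    and S N P :: "complex ^ 'n ^ 'n" and \<gamma> :: "complex ^ 'n"
  assumes X: "holomorphic_map_on X D" and "X 0 = 0"
    and J: "jordan_decomposition (linear_part X) S N" and D: "diagonalizes P S \<gamma>"
    and b: "lattice_basis r \<rho> (resonance_lattice \<gamma>)"
    and nf: "admits_convergent_normalization D X"
  shows "\<exists>U \<alpha>. 0 \<in> U \<and> U \<subseteq> D \<and> holomorphic_torus_action r U \<alpha> \<and> effective_action r U \<alpha> \<and>
       action_preserves U \<alpha> X \<and> (\<forall>t. \<alpha> t 0 = 0) \<and>
       linear_part_generated_by r \<alpha> (\<lambda>k. torus_generator P (\<rho> k))"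
proof -
  obtain U V \<phi> \<psi> where U: "0 \<in> U" "U \<subseteq> D" and bi: "biholomorphism U V \<phi> \<psi>" and "\<phi> 0 = 0"
    and pd: "poincare_dulac_normal_form (push_forward \<phi> \<psi> X)"
    using nf unfolding admits_convergent_normalization_def by blast
  let ?Y = "push_forward \<phi> \<psi> X"
  obtain S' N' where J': "jordan_decomposition (linear_part ?Y) S' N'"
    and ev: "\<forall>\<^sub>F x in nhds 0. lie_bracket ?Y ((*v) S') x = 0"
    using pd unfolding poincare_dulac_normal_form_def by blast
  have h: "holomorphic_map_on \<phi> U" "holomorphic_map_on \<psi> V" and "\<phi> ` U = V" "\<And>x. x \<in> U \<Longrightarrow> \<psi> (\<phi> x) = x"
    using bi by (auto simp: biholomorphism_def homeomorphism_def)
  then have V0: "0 \<in> V" and \<psi>0: "\<psi> 0 = 0" using U(1) \<open>\<phi> 0 = 0\<close> by (metis imageI)+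
  have XU: "holomorphic_map_on X U" by (rule holomorphic_map_on_subset[OF X holomorphic_map_openD[OF h(1)] U(2)])
  note Y = push_forward_holomorphic[OF bi XU]
  have P: "invertible P" and PS: "P ** S ** matrix_inv P = diagonal_matrix \<gamma>"
    using D by (auto simp: diagonalizes_def)
  note Pi = matrix_inv_invertible[OF P]
  define B where "B = linear_part \<phi>"
  define C where "C = linear_part \<psi>"
  have B: "B *v v = frechet_derivative \<phi> (at 0) v" for v unfolding B_def by (rule linear_part_mult[OF h(1) U(1)])
  have C: "C *v v = frechet_derivative \<psi> (at 0) v" for v unfolding C_def by (rule linear_part_mult[OF h(2) V0])
  have BCv: "B *v (C *v v) = v" "C *v (B *v v) = v" for v
    unfolding B C using biholomorphism_derivative_inverse(2)[OF bi V0] biholomorphism_derivative_inverse(1)[OF bi U(1)]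
    by (simp_all add: \<psi>0 \<open>\<phi> 0 = 0\<close>)
  then have BC: "B ** C = mat 1" "C ** B = mat 1"
    by (simp_all add: matrix_eq matrix_vector_mul_assoc[symmetric])
  have "linear_part ?Y = B ** linear_part X ** C"
  proof -
    have "linear_part ?Y *v v = B *v (linear_part X *v (C *v v))" for v
      unfolding linear_part_mult[OF Y(1) V0] linear_part_mult[OF XU U(1)] B C
      using Y(2)[OF V0] by (simp add: \<psi>0 \<open>X 0 = 0\<close>)
    then show ?thesis by (simp add: matrix_eq matrix_vector_mul_assoc matrix_mul_assoc)
  qed
  then have S': "S' = B ** S ** C"
    using jordan_semisimple_part_unique[OF J'] jordan_decomposition_conj[OF J BC] by metis
  obtain V1 where V1: "open V1" "0 \<in> V1" and V1c: "\<And>x. x \<in> V1 \<Longrightarrow> lie_bracket ?Y ((*v) S') x = 0"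
    using ev unfolding eventually_nhds by blast
  define M where "M = P ** C"
  define Mi where "Mi = B ** matrix_inv P"
  have M: "M *v (Mi *v v) = v" "Mi *v (M *v v) = v" for v
    by (simp_all add: M_def Mi_def matrix_vector_mul_assoc[symmetric] BCv Pi)
  have MS: "M *v (S' *v (Mi *v v)) = diagonal_matrix \<gamma> *v v" for v
    by (simp add: M_def Mi_def S' PS[symmetric] matrix_vector_mul_assoc[symmetric] BCv)
  have "open ((*v) Mi -` (V \<inter> V1))"
    using V1(1) holomorphic_map_openD[OF h(2)]
      continuous_on_open_vimage[OF open_UNIV, of "(*v) Mi"] linear_continuous_on[OF matrix_vector_mul_bounded_linear[of Mi], of UNIV]
    by auto
  then obtain R where R: "0 < R" "polydisc R \<subseteq> (*v) Mi -` (V \<inter> V1)"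
    using polydisc_subset[of "(*v) Mi -` (V \<inter> V1)"] V0 V1(2) by auto
  define \<Phi> where "\<Phi> = (\<lambda>x. M *v \<phi> x)"
  define \<Psi> where "\<Psi> = (\<lambda>y. \<psi> (Mi *v y))"
  have RV: "\<forall>y\<in>polydisc R. Mi *v y \<in> V" using R(2) by auto
  note lc = biholomorphism_linear_change[OF bi M open_polydisc RV, folded \<Phi>_def \<Psi>_def]
  have U0: "0 \<in> \<Psi> ` polydisc R"
    by (rule image_eqI[of _ _ 0]) (simp_all add: \<Psi>_def \<psi>0 polydisc_def R(1))
  have XU0: "holomorphic_map_on X (\<Psi> ` polydisc R)"
    using lc(1,2) U(2) holomorphic_map_openD
    by (intro holomorphic_map_on_subset[OF XU]) (auto simp: biholomorphism_def)
  have d\<Phi>: "frechet_derivative \<Phi> (at 0) v = P *v v" for v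
    by (simp add: lc(3)[OF U(1)] B[symmetric] M_def matrix_vector_mul_assoc[symmetric] BCv)
  have comm: "frechet_derivative (push_forward \<Phi> \<Psi> X) (at y) (diagonal_matrix \<gamma> *v y)
       = diagonal_matrix \<gamma> *v push_forward \<Phi> \<Psi> X y" if y: "y \<in> polydisc R" for y
  proof -
    let ?x = "Mi *v y"
    have "frechet_derivative ((*v) S') (at ?x) = (*v) S'"
      using frechet_derivative_at[OF holomorphic_map_clinear_map(2)[OF matrix_vector_mul_linear_gen]] by metis
    then have br: "frechet_derivative ?Y (at ?x) (S' *v ?x) = S' *v ?Y ?x"
      using V1c[of ?x] R(2) y by (auto simp: lie_bracket_def)
    have "frechet_derivative (push_forward \<Phi> \<Psi> X) (at y) (diagonal_matrix \<gamma> *v y)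
        = M *v frechet_derivative ?Y (at ?x) (S' *v ?x)"
      by (simp only: lc(5)[OF XU y] MS[symmetric] M)
    also have "\<dots> = M *v (S' *v (Mi *v (M *v ?Y ?x)))" by (simp only: br M)
    also have "\<dots> = diagonal_matrix \<gamma> *v push_forward \<Phi> \<Psi> X y"
      by (simp only: MS lc(4)[OF y])
    finally show ?thesis .
  qed
  have "\<Phi> 0 = 0" by (simp add: \<Phi>_def \<open>\<phi> 0 = 0\<close>)
  note act = torus_action_of_normal_coordinates[OF b P R(1) lc(1) U0 this d\<Phi> XU0 comm]
  show ?thesis
    by (intro exI[of _ "\<Psi> ` polydisc R"] exI[of _ "\<lambda>t x. \<Psi> (torus_mult r \<rho> t (\<Phi> x))"] conjI allI act U0)
       (use lc(2) U(2) in auto)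
qed


section \<open>Linearization of a torus action by averaging\<close>

text \<open>Only the fractional part of \<open>c\<close> matters. The shifted interval is cut at 1, and the part beyond 1 is
  moved back by one period.\<close>

lemma integral_periodic_shift:
  fixes G :: "real \<Rightarrow> 'a :: banach"
  assumes cont: "continuous_on UNIV G" and per: "\<And>u. G (u + 1) = G u"
  shows "integral {0..1} (\<lambda>u. G (u + c)) = integral {0..1} G"
proof -
  have pn: "G (u + of_nat n) = G u" for u and n :: nat
  proof (induction n)
    case (Suc n)
    have "G (u + of_nat (Suc n)) = G ((u + of_nat n) + 1)" by (simp add: algebra_simps)
    then show ?case by (simp only: per Suc)
  qed simp
  have pern: "G (u + of_int n) = G u" for u and n :: int
  proof (cases "n \<ge> 0")
    case True
    then show ?thesis using pn[of u "nat n"] by simp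
  next
    case False
    then show ?thesis using pn[of "u + of_int n" "nat (- n)"] by simp
  qed
  let ?d = "frac c"
  have d: "0 \<le> ?d" "?d \<le> 1" using frac_lt_1[of c] by (auto simp: less_imp_le)
  have int: "G integrable_on {a..b}" for a b
    by (rule integrable_continuous_interval[OF continuous_on_subset[OF cont]]) simp
  have shift: "integral {a..b} (\<lambda>u. G (u + e)) = integral {a + e..b + e} G" for a b e
    using has_integral_shift_Icc_real[of G e "integral {a + e..b + e} G" a b] int
    by (auto simp: o_def add.commute intro!: integral_unique integrable_integral)
  have "integral {0..1} (\<lambda>u. G (u + c)) = integral {0..1} (\<lambda>u. G (u + ?d))"
  proof (rule integral_cong)
    fix u
    have "G (u + c) = G (u + ?d + of_int \<lfloor>c\<rfloor>)" by (simp add: frac_def)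
    then show "G (u + c) = G (u + ?d)" by (simp only: pern)
  qed
  also have "\<dots> = integral {?d..1 + ?d} G" by (simp add: shift)
  also have "\<dots> = integral {?d..1} G + integral {1..1 + ?d} G"
    using Henstock_Kurzweil_Integration.integral_combine[where a = ?d and c = 1 and b = "1 + ?d" and f = G] d int by simp
  also have "integral {1..1 + ?d} G = integral {0..?d} (\<lambda>u. G (u + 1))"
    using shift[of 0 ?d 1] by (simp add: add.commute)
  also have "\<dots> = integral {0..?d} G" by (simp only: per)
  also have "integral {?d..1} G + integral {0..?d} G = integral {0..1} G"
    using Henstock_Kurzweil_Integration.integral_combine[where a = 0 and c = ?d and b = 1 and f = G] d int by (simp add: add.commute)
  finally show ?thesis .
qed

definition circle_at :: "nat \<Rightarrow> real \<Rightarrow> nat \<Rightarrow> real" where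
  "circle_at k s = (\<lambda>_. 0)(k := s)"

lemma circle_at_add: "circle_at k (s + t) = (\<lambda>i. circle_at k s i + circle_at k t i)"
  by (auto simp: circle_at_def)

lemma circle_at_0: "circle_at k 0 = (\<lambda>_. 0)"
  by (auto simp: circle_at_def)

lemma circle_at_periodic: "torus_eq r (circle_at k (2 * pi * (u + 1))) (circle_at k (2 * pi * u))"
  unfolding torus_eq_def rcong_altdef
proof (intro allI impI)
  fix i
  show "\<exists>n. circle_at k (2 * pi * u) i = circle_at k (2 * pi * (u + 1)) i + of_int n * (2 * pi)"
    by (rule exI[of _ "if i = k then - 1 else 0"]) (simp add: circle_at_def algebra_simps)
qed

lemma continuous_on_circle_at:
  assumes "continuous_on A f" shows "continuous_on A (\<lambda>x. circle_at k (f x))"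
proof (rule continuous_on_coordinatewise_then_product)
  show "continuous_on A (\<lambda>x. circle_at k (f x) i)" for i
    by (cases "i = k") (use assms in \<open>simp_all add: circle_at_def\<close>)
qed

text \<open>In diagonalizing coordinates the equation decouples into scalar equations \<open>h' = \<i> n h\<close>, and
  \<open>exp (- \<i> n s) h s\<close> is constant.\<close>

lemma linear_circle_action_unique:
  fixes P :: "complex ^ 'n ^ 'n" and g :: "real \<Rightarrow> complex ^ 'n"
  assumes P: "invertible P" and "k < r"
    and g: "\<And>s. (g has_vector_derivative \<i> *s torus_generator P (\<rho> k) (g s)) (at s)"
  shows "g s = matrix_inv P *v torus_mult r \<rho> (circle_at k s) (P *v g 0)"
proof -
  note Pi = matrix_inv_invertible[OF P]
  have "(P *v g s) $ j = torus_mult r \<rho> (circle_at k s) (P *v g 0) $ j" for j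
  proof -
    let ?n = "real_of_int (\<rho> k $ j)"
    have sum: "(\<Sum>i<r. circle_at k s i * of_int (\<rho> i $ j)) = s * ?n" for s
    proof -
      have "(\<Sum>i<r. circle_at k s i * of_int (\<rho> i $ j)) = (\<Sum>i<r. if i = k then s * ?n else 0)"
        by (intro sum.cong) (auto simp: circle_at_def)
      then show ?thesis using \<open>k < r\<close> by simp
    qed
    let ?h = "\<lambda>s. (P *v g s) $ j"
    have h: "(?h has_vector_derivative \<i> * ?n * ?h s) (at s)" for s
    proof -
      have "((\<lambda>s. (P *v g s) $ j) has_vector_derivative (P *v (\<i> *s torus_generator P (\<rho> k) (g s))) $ j) (at s)"
        by (intro bounded_linear.has_vector_derivative[OF bounded_linear_vec_nth]
            bounded_linear.has_vector_derivative[OF matrix_vector_mul_bounded_linear] g)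
      then show ?thesis by (simp add: torus_generator_def matrix_vector_smult Pi mult_ac)
    qed
    have "((\<lambda>s. exp (- (\<i> * of_real s * ?n)) * ?h s) has_vector_derivative 0) (at s within UNIV)" for s
    proof -
      have "((\<lambda>s. exp (- (\<i> * of_real s * ?n))) has_vector_derivative - (\<i> * ?n * exp (- (\<i> * of_real s * ?n)))) (at s)"
        by (rule has_vector_derivative_real_field) (auto intro!: derivative_eq_intros)
      from has_vector_derivative_mult[OF this h[of s]] show ?thesis by (simp add: algebra_simps)
    qed
    then obtain c where c: "\<And>s. exp (- (\<i> * of_real s * ?n)) * ?h s = c"
      using has_vector_derivative_zero_constant[of UNIV "\<lambda>s. exp (- (\<i> * of_real s * ?n)) * ?h s"] by auto
    have "?h s = exp (\<i> * of_real s * ?n) * (exp (- (\<i> * of_real s * ?n)) * ?h s)"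
      by (simp add: exp_minus)
    also have "\<dots> = exp (\<i> * of_real s * ?n) * ?h 0" using c[of s] c[of 0] by simp
    finally show ?thesis by (simp add: sum cis_conv_exp mult_ac)
  qed
  then have "P *v g s = torus_mult r \<rho> (circle_at k s) (P *v g 0)" by (simp add: vec_eq_iff)
  then show ?thesis using Pi by metis
qed

definition circle_action ::
    "((nat \<Rightarrow> real) \<Rightarrow> complex ^ 'n \<Rightarrow> complex ^ 'n) \<Rightarrow> nat \<Rightarrow> real \<Rightarrow> complex ^ 'n \<Rightarrow> complex ^ 'n" where
  "circle_action \<alpha> k s x = \<alpha> (circle_at k s) x"

text \<open>For \<open>k < r\<close>, the flow of the real part of \<open>\<i> Z\<^sub>k\<close> in the coordinates in which \<open>P\<close> is the diagonalizing matrix.\<close>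

definition linear_circle ::
    "complex ^ 'n ^ 'n \<Rightarrow> nat \<Rightarrow> (nat \<Rightarrow> int ^ 'n) \<Rightarrow> nat \<Rightarrow> real \<Rightarrow> complex ^ 'n \<Rightarrow> complex ^ 'n" where
  "linear_circle P r \<rho> k s x = matrix_inv P *v torus_mult r \<rho> (circle_at k s) (P *v x)"

lemma clinear_linear_circle: "clinear (linear_circle P r \<rho> k s)"
  unfolding linear_circle_def
  by (intro clinear_comp[OF matrix_vector_mul_linear_gen] clinear_comp[OF clinear_torus_mult] matrix_vector_mul_linear_gen)

context
  fixes U :: "(complex ^ 'n) set" and \<alpha> :: "(nat \<Rightarrow> real) \<Rightarrow> complex ^ 'n \<Rightarrow> complex ^ 'n"
    and P :: "complex ^ 'n ^ 'n" and r :: nat and \<rho> :: "nat \<Rightarrow> int ^ 'n"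
  assumes act: "holomorphic_torus_action r U \<alpha>" and U0: "0 \<in> U" and \<alpha>0: "\<And>t. \<alpha> t 0 = 0"
    and lin: "linear_part_generated_by r \<alpha> (\<lambda>k. torus_generator P (\<rho> k))" and P: "invertible P"
begin

lemma torus_action_domain_open: "open U"
  using act holomorphic_map_openD unfolding holomorphic_torus_action_def by blast

lemma action_holomorphic: "holomorphic_map_on (\<alpha> t) U"
  using act unfolding holomorphic_torus_action_def by blast

lemma action_mem: "x \<in> U \<Longrightarrow> \<alpha> t x \<in> U"
  using act unfolding holomorphic_torus_action_def by blast

lemma action_add: "x \<in> U \<Longrightarrow> \<alpha> (\<lambda>k. s k + t k) x = \<alpha> s (\<alpha> t x)"
  using act unfolding holomorphic_torus_action_def by blast

lemma action_zero: "x \<in> U \<Longrightarrow> \<alpha> (\<lambda>_. 0) x = x"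
  using act unfolding holomorphic_torus_action_def by blast

lemma circle_action_add: "x \<in> U \<Longrightarrow> circle_action \<alpha> k (s + t) x = circle_action \<alpha> k s (circle_action \<alpha> k t x)"
  by (simp add: circle_action_def circle_at_add action_add)

lemma circle_action_commute:
  assumes "x \<in> U"
  shows "circle_action \<alpha> k s (circle_action \<alpha> l t x) = circle_action \<alpha> l t (circle_action \<alpha> k s x)"
proof -
  have "(\<lambda>i. circle_at k s i + circle_at l t i) = (\<lambda>i. circle_at l t i + circle_at k s i)"
    by (simp add: add.commute)
  then show ?thesis using action_add[OF assms] by (metis circle_action_def)
qed

lemma circle_action_periodic:
  assumes "x \<in> U" shows "circle_action \<alpha> k (2 * pi * (u + 1)) x = circle_action \<alpha> k (2 * pi * u) x"
  using act assms circle_at_periodic unfolding holomorphic_torus_action_def circle_action_def by blast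

lemma linear_circle_periodic: "linear_circle P r \<rho> k (2 * pi * (u + 1)) x = linear_circle P r \<rho> k (2 * pi * u) x"
  unfolding linear_circle_def by (simp add: torus_mult_cong[OF circle_at_periodic])

lemma linear_circle_add: "linear_circle P r \<rho> k (s + t) x = linear_circle P r \<rho> k s (linear_circle P r \<rho> k t x)"
  by (simp add: linear_circle_def circle_at_add torus_mult_add matrix_inv_invertible[OF P])

lemma linear_circle_zero: "linear_circle P r \<rho> k 0 x = x"
  by (simp add: linear_circle_def circle_at_0 torus_mult_zero matrix_inv_invertible[OF P])

lemma linear_circle_commute: "linear_circle P r \<rho> k s (linear_circle P r \<rho> l t x) = linear_circle P r \<rho> l t (linear_circle P r \<rho> k s x)"
proof -
  have "torus_mult r \<rho> a (torus_mult r \<rho> b w) = torus_mult r \<rho> b (torus_mult r \<rho> a w)" for a b w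
    by (simp add: vec_eq_iff)
  then show ?thesis by (simp add: linear_circle_def matrix_inv_invertible[OF P])
qed

lemma continuous_on_linear_circle:
  assumes "continuous_on A s" "continuous_on A f"
  shows "continuous_on A (\<lambda>p. linear_circle P r \<rho> k (s p) (f p))"
  unfolding linear_circle_def
  by (intro bounded_linear.continuous_on[OF matrix_vector_mul_bounded_linear] continuous_on_torus_mult
      continuous_on_circle_at assms)

lemma continuous_on_circle_action:
  assumes "continuous_on A s" "continuous_on A f" "f ` A \<subseteq> U"
  shows "continuous_on A (\<lambda>p. circle_action \<alpha> k (s p) (f p))"
proof -
  have "continuous_on (UNIV \<times> U) (\<lambda>(t, x). \<alpha> t x)"
    using act unfolding holomorphic_torus_action_def by blast
  from continuous_on_compose2[OF this continuous_on_Pair[OF continuous_on_circle_at[OF assms(1)] assms(2)]]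
  show ?thesis using assms(3) by (auto simp: circle_action_def)
qed

lemma circle_action_derivative:
  assumes "k < r"
  shows "frechet_derivative (circle_action \<alpha> k s) (at 0) z = linear_circle P r \<rho> k s z"
proof -
  let ?g = "\<lambda>s. frechet_derivative (\<alpha> (circle_at k s)) (at 0) z"
  have "(?g has_vector_derivative \<i> *s torus_generator P (\<rho> k) (?g s)) (at s)" for s
    using lin assms unfolding linear_part_generated_by_def circle_at_def by blast
  from linear_circle_action_unique[where g = ?g and s = s and k = k and r = r and P = P and \<rho> = \<rho>, OF P assms this]
  have "?g s = linear_circle P r \<rho> k s (?g 0)" by (simp add: linear_circle_def)
  moreover have "?g 0 = z"
  proof -
    have "frechet_derivative (\<alpha> (\<lambda>_. 0)) (at 0) = frechet_derivative (\<lambda>x. x) (at 0)"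
      by (rule frechet_derivative_cong_open[OF torus_action_domain_open U0]) (rule action_zero)
    then show ?thesis by (simp add: circle_at_0)
  qed
  ultimately show ?thesis by (simp add: circle_action_def[abs_def])
qed

text \<open>One averaging step. The average over the \<open>m\<close>-th circle is equivariant for this circle by
  translation invariance of the integral of a periodic function. It remains equivariant for the
  earlier circles because the circles commute.\<close>

lemma average_circle:
  fixes m :: nat and f :: "complex ^ 'n \<Rightarrow> complex ^ 'n"
  assumes m: "m < r" and f: "holomorphic_map_on f U" "f 0 = 0" "\<And>v. frechet_derivative f (at 0) v = v"
    and eq: "\<And>k s x. k < m \<Longrightarrow> x \<in> U \<Longrightarrow> f (circle_action \<alpha> k s x) = linear_circle P r \<rho> k s (f x)"
  defines "F \<equiv> \<lambda>x. integral {0..1} (\<lambda>u. linear_circle P r \<rho> m (- (2 * pi * u)) (f (circle_action \<alpha> m (2 * pi * u) x)))"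
  shows "holomorphic_map_on F U" "F 0 = 0" "\<And>v. frechet_derivative F (at 0) v = v"
    "\<And>k s x. k < Suc m \<Longrightarrow> x \<in> U \<Longrightarrow> F (circle_action \<alpha> k s x) = linear_circle P r \<rho> k s (F x)"
proof -
  let ?g = "\<lambda>u x. linear_circle P r \<rho> m (- (2 * pi * u)) (f (circle_action \<alpha> m (2 * pi * u) x))"
  have cm: "circle_action \<alpha> k s x \<in> U" if "x \<in> U" for k s x
    using action_mem[OF that] by (simp add: circle_action_def)
  have ch: "holomorphic_map_on (circle_action \<alpha> k s) U" for k s
    using action_holomorphic by (simp add: circle_action_def[abs_def])
  have fch: "holomorphic_map_on (\<lambda>x. f (circle_action \<alpha> m s x)) U" for s
    by (rule holomorphic_map_comp[OF ch f(1)]) (use cm in auto)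
  note lh = holomorphic_map_clinear_map[OF clinear_linear_circle]
  have dl: "frechet_derivative (linear_circle P r \<rho> k s) (at w) = linear_circle P r \<rho> k s" for k s w
    by (rule frechet_derivative_at[OF lh(2), symmetric])
  have gh: "holomorphic_map_on (?g u) U" for u
    by (rule holomorphic_map_comp[OF fch lh(1)]) simp
  have cg: "continuous_on (UNIV \<times> U) (\<lambda>(u, x). ?g u x)"
    unfolding split_beta
    by (intro continuous_on_linear_circle continuous_on_compose2[OF holomorphic_map_continuous[OF f(1)]]
        continuous_on_circle_action continuous_intros) (use cm in auto)
  have cg': "continuous_on ({0..1} \<times> U) (\<lambda>(u, x). ?g u x)"
    by (rule continuous_on_subset[OF cg]) auto
  have cgx: "continuous_on UNIV (\<lambda>u. ?g u x)" if "x \<in> U" for x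
    using continuous_on_compose2[OF cg continuous_on_Pair[OF continuous_on_id[of UNIV] continuous_on_const[of _ x]]] that
    by auto
  have gi: "(\<lambda>u. ?g u x) integrable_on {0..1}" if "x \<in> U" for x
    by (rule integrable_continuous_interval[OF continuous_on_subset[OF cgx[OF that]]]) simp
  show "holomorphic_map_on F U"
    unfolding F_def by (rule holomorphic_map_integral(1)[OF cg' gh])
  have l0: "linear_circle P r \<rho> k s 0 = 0" for k s
    using clinear_linear_circle[of P r \<rho> k s] unfolding clinear_iff by (metis add_cancel_right_right)
  show "F 0 = 0" by (simp add: F_def circle_action_def \<alpha>0 f(2) l0)
  show "frechet_derivative F (at 0) v = v" for v
  proof -
    have c0: "circle_action \<alpha> m s 0 = 0" for s by (simp add: circle_action_def \<alpha>0)
    have "frechet_derivative (?g u) (at 0) v = v" for u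
    proof -
      have "frechet_derivative (?g u) (at 0) v = linear_circle P r \<rho> m (- (2 * pi * u)) (linear_circle P r \<rho> m (2 * pi * u) v)"
        using frechet_derivative_comp[OF fch lh(1) U0 UNIV_I] frechet_derivative_comp[OF ch f(1) U0]
        by (simp add: dl c0 U0 f(3) circle_action_derivative[OF m])
      then show ?thesis by (simp add: linear_circle_add[symmetric] linear_circle_zero)
    qed
    then show ?thesis
      unfolding F_def by (simp add: holomorphic_map_integral(2)[OF cg' gh U0])
  qed
  show "F (circle_action \<alpha> k s x) = linear_circle P r \<rho> k s (F x)" if k: "k < Suc m" and x: "x \<in> U" for k s x
  proof -
    have L: "linear_circle P r \<rho> k s (F x) = integral {0..1} (\<lambda>u. linear_circle P r \<rho> k s (?g u x))"
      unfolding F_def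
      using integral_linear[OF gi[OF x] has_derivative_bounded_linear[OF lh(2)], of P r \<rho> k s] by (simp add: o_def)
    show ?thesis
    proof (cases "k = m")
      case False
      then have "k < m" using k by simp
      have "?g u (circle_action \<alpha> k s x) = linear_circle P r \<rho> k s (?g u x)" for u
        by (simp only: circle_action_commute[OF x, of m _ k] eq[OF \<open>k < m\<close> cm[OF x]]
            linear_circle_commute[of m _ k])
      then show ?thesis unfolding L unfolding F_def by simp
    next
      case True
      have "?g u (circle_action \<alpha> m s x) = linear_circle P r \<rho> m s (?g (u + s / (2 * pi)) x)" for u
      proof -
        have "2 * pi * (u + s / (2 * pi)) = 2 * pi * u + s" by (simp add: field_simps)
        then show ?thesis
          by (simp add: circle_action_add[OF x] linear_circle_add[symmetric])
      qed
      then have "F (circle_action \<alpha> m s x) = integral {0..1} (\<lambda>u. linear_circle P r \<rho> m s (?g (u + s / (2 * pi)) x))"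
        unfolding F_def by simp
      also have "\<dots> = integral {0..1} (\<lambda>u. linear_circle P r \<rho> m s (?g u x))"
      proof (rule integral_periodic_shift)
        show "continuous_on UNIV (\<lambda>u. linear_circle P r \<rho> m s (?g u x))"
          by (intro continuous_on_linear_circle continuous_on_const cgx[OF x])
        show "linear_circle P r \<rho> m s (?g (u + 1) x) = linear_circle P r \<rho> m s (?g u x)" for u
        proof -
          have "linear_circle P r \<rho> m (- (2 * pi * (u + 1))) w = linear_circle P r \<rho> m (- (2 * pi * u)) w" for w
          proof -
            have "2 * pi * (- u - 1 + 1) = - (2 * pi * u)" "2 * pi * (- u - 1) = - (2 * pi * (u + 1))"
              by (simp_all add: algebra_simps)
            then show ?thesis using linear_circle_periodic[of m "- u - 1" w] by (simp only:)
          qed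
          then show ?thesis by (simp only: circle_action_periodic[OF x])
        qed
      qed
      finally show ?thesis unfolding L using True by simp
    qed
  qed
qed

text \<open>Averaging over one circle after the other replaces an integral over a torus of variable dimension by
  integrals over \<open>[0, 1]\<close>.\<close>

lemma linearizing_map:
  assumes "m \<le> r"
  shows "\<exists>f. holomorphic_map_on f U \<and> f 0 = 0 \<and> (\<forall>v. frechet_derivative f (at 0) v = v) \<and>
    (\<forall>k s x. k < m \<longrightarrow> x \<in> U \<longrightarrow> f (circle_action \<alpha> k s x) = linear_circle P r \<rho> k s (f x))"
  using assms
proof (induction m)
  case 0
  have "holomorphic_map_on (\<lambda>x :: complex ^ 'n. x) U"
    by (rule holomorphic_map_onI[OF torus_action_domain_open has_derivative_ident]) (simp add: clinear_iff)
  then show ?case by (intro exI[of _ "\<lambda>x. x"]) simp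
next
  case (Suc m)
  then obtain f where f: "holomorphic_map_on f U" "f 0 = 0" "\<And>v. frechet_derivative f (at 0) v = v"
    "\<And>k s x. k < m \<Longrightarrow> x \<in> U \<Longrightarrow> f (circle_action \<alpha> k s x) = linear_circle P r \<rho> k s (f x)"
    by auto
  have "m < r" using Suc.prems by simp
  from average_circle[OF this f] show ?case by blast
qed

end


section \<open>From a torus action to a normal form\<close>

text \<open>The derivative of the real inverse function is the inverse of a complex-linear bijection and hence
  complex linear.\<close>

lemma holomorphic_inverse_function:
  fixes f :: "complex ^ 'n \<Rightarrow> complex ^ 'n"
  assumes f: "holomorphic_map_on f U" and "a \<in> U" and id: "\<And>v. frechet_derivative f (at a) v = v"
  obtains U' V g where "a \<in> U'" "U' \<subseteq> U" "f a \<in> V" "biholomorphism U' V f g"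
proof -
  note U = holomorphic_map_openD[OF f]
  define f' where "f' = (\<lambda>x. Blinfun (frechet_derivative f (at x)))"
  have app: "blinfun_apply (f' x) = frechet_derivative f (at x)" if "x \<in> U" for x
    unfolding f'_def by (rule bounded_linear_Blinfun_apply[OF holomorphic_map_bounded_linear[OF f that]])
  have "continuous_on (UNIV \<times> U) (\<lambda>(s :: real, x). f x)"
    unfolding split_beta
    by (rule continuous_on_compose2[OF holomorphic_map_continuous[OF f] continuous_on_snd[OF continuous_on_id]]) auto
  from continuous_on_blinfun_frechet_derivative[of UNIV U "\<lambda>_. f", OF this f]
  have c2: "continuous_on (UNIV \<times> U) (\<lambda>(s :: real, x). f' x)" by (simp add: f'_def)
  have contf': "continuous_on U f'"
    using continuous_on_compose2[OF c2 continuous_on_Pair[OF continuous_on_const[of _ 0] continuous_on_id[of U]]]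
    by auto
  have D: "(f has_derivative blinfun_apply (f' x)) (at x)" if "x \<in> U" for x
    using holomorphic_map_has_derivative[OF f that] app[OF that] by simp
  have "id_blinfun o\<^sub>L f' a = id_blinfun"
    by (rule blinfun_eqI) (simp add: app[OF \<open>a \<in> U\<close>] id)
  from inverse_function_theorem[OF U D contf' \<open>a \<in> U\<close> this]
  obtain U' V g g' where *: "open U'" "U' \<subseteq> U" "a \<in> U'" "open V" "f a \<in> V" "homeomorphism U' V f g"
    "\<And>y. y \<in> V \<Longrightarrow> (g has_derivative (g' y)) (at y)"
    "\<And>y. y \<in> V \<Longrightarrow> g' y = inv (blinfun_apply (f'(g y)))"
    "\<And>y. y \<in> V \<Longrightarrow> bij (blinfun_apply (f'(g y)))" by blast
  have "holomorphic_map_on g V"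
  proof (rule holomorphic_map_onI[OF *(4) *(7)])
    fix y assume y: "y \<in> V"
    then have gy: "g y \<in> U" using *(2,6) by (auto simp: homeomorphism_def)
    let ?L = "frechet_derivative f (at (g y))"
    have L: "clinear ?L" and b: "bij ?L" and g': "g' y = inv ?L"
      using holomorphic_map_clinear[OF f gy] *(8,9)[OF y] app[OF gy] by auto
    have inv: "?L (g' y v) = v" for v using b by (simp add: g' bij_is_surj surj_f_inv_f)
    have inj: "v = w" if "?L v = ?L w" for v w using b that by (meson bij_is_inj injD)
    show "clinear (g' y)"
      unfolding clinear_iff
    proof (intro conjI allI)
      have La: "?L (v + w) = ?L v + ?L w" and Lc: "?L (c *s v) = c *s ?L v" for v w c
        using L by (simp_all add: clinear_iff)
      show "g' y (v + w) = g' y v + g' y w" for v w by (rule inj) (simp only: La inv)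
      show "g' y (c *s v) = c *s g' y v" for c v by (rule inj) (simp only: Lc inv)
    qed
  qed
  moreover have "holomorphic_map_on f U'" by (rule holomorphic_map_on_subset[OF f *(1,2)])
  ultimately have "biholomorphism U' V f g" using *(6) by (simp add: biholomorphism_def)
  with * show ?thesis using that by blast
qed

lemma torus_generator_eq_diagonal:
  "torus_generator P \<rho> z = matrix_inv P *v (diagonal_matrix (\<chi> j. of_int (\<rho> $ j)) *v (P *v z))"
proof -
  have "(\<chi> j. of_int (\<rho> $ j) * (P *v z) $ j) = diagonal_matrix (\<chi> j. of_int (\<rho> $ j)) *v (P *v z)"
    by (simp add: vec_eq_iff diagonal_matrix_vec)
  then show ?thesis by (simp add: torus_generator_def)
qed

lemma semisimple_part_in_span_of_torus_generators:
  assumes D: "diagonalizes P S \<gamma>" and \<kappa>: "\<And>j. \<gamma> $ j = (\<Sum>k<r. \<kappa> k * of_int (\<rho> k $ j))"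
  shows "S *v z = (\<Sum>k<r. \<kappa> k *s torus_generator P (\<rho> k) z)"
proof -
  have "diagonal_matrix \<gamma> *v w = (\<Sum>k<r. \<kappa> k *s (diagonal_matrix (\<chi> j. of_int (\<rho> k $ j)) *v w))" for w
    by (simp add: vec_eq_iff diagonal_matrix_vec \<kappa> sum_distrib_left mult_ac)
  then show ?thesis
    by (simp add: diagonalizes_eq[OF D, of z] torus_generator_eq_diagonal matrix_vector_smult
        clinear_sum[OF matrix_vector_mul_linear_gen])
qed

lemma linear_circle_has_vector_derivative:
  assumes "invertible P" "k < r"
  shows "((\<lambda>s. linear_circle P r \<rho> k s w) has_vector_derivative
     \<i> *s torus_generator P (\<rho> k) (linear_circle P r \<rho> k s w)) (at s)"
proof -
  note Pi = matrix_inv_invertible[OF assms(1)]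
  from bounded_linear.has_vector_derivative[OF matrix_vector_mul_bounded_linear
        torus_mult_circle_has_vector_derivative[OF assms(2), of \<rho> "P *v w" s], of "matrix_inv P"]
  show ?thesis
    unfolding linear_circle_def circle_at_def torus_generator_def by (simp only: Pi matrix_vector_smult)
qed

text \<open>The chain rule applied to both sides of the equivariance of \<open>f\<close>, together with the invariance of \<open>X\<close>.
  The last hypothesis keeps the orbit in the domain of the coordinates; it holds for small \<open>s\<close>.\<close>

lemma push_forward_circle_equivariant:
  fixes X :: "complex ^ 'n \<Rightarrow> complex ^ 'n"
  assumes act: "holomorphic_torus_action r U \<alpha>" and X: "holomorphic_map_on X U"
    and pres: "action_preserves U \<alpha> X"
    and f: "holomorphic_map_on f U"
    and eq: "\<And>s x. x \<in> U \<Longrightarrow> f (circle_action \<alpha> k s x) = linear_circle P r \<rho> k s (f x)"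
    and bi: "biholomorphism U' V f g" and U': "U' \<subseteq> U" and y: "y \<in> V"
    and mem: "circle_action \<alpha> k s (g y) \<in> U'"
  shows "push_forward f g X (linear_circle P r \<rho> k s y) = linear_circle P r \<rho> k s (push_forward f g X y)"
proof -
  let ?c = "circle_action \<alpha> k s" and ?L = "linear_circle P r \<rho> k s" and ?x = "g y"
  have x: "?x \<in> U'" "f ?x = y" and gf: "\<And>x. x \<in> U' \<Longrightarrow> g (f x) = x"
    using bi y by (auto simp: biholomorphism_def homeomorphism_def)
  then have xU: "?x \<in> U" using U' by auto
  have ch: "holomorphic_map_on ?c U" and cm: "?c ` U \<subseteq> U"
    using act by (auto simp: holomorphic_torus_action_def circle_action_def[abs_def])
  note Lh = holomorphic_map_clinear_map[OF clinear_linear_circle]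
  have dL: "frechet_derivative ?L (at w) = ?L" for w by (rule frechet_derivative_at[OF Lh(2), symmetric])
  have "g (?L y) = ?c ?x" using gf[OF mem] eq[OF xU] x(2) by simp
  then have "push_forward f g X (?L y) = frechet_derivative f (at (?c ?x)) (X (?c ?x))"
    by (simp add: push_forward_def)
  also have "X (?c ?x) = frechet_derivative ?c (at ?x) (X ?x)"
    using pres xU unfolding action_preserves_def circle_action_def[abs_def] by simp
  also have "frechet_derivative f (at (?c ?x)) (frechet_derivative ?c (at ?x) (X ?x))
      = frechet_derivative (\<lambda>x. f (?c x)) (at ?x) (X ?x)"
    using cm xU by (intro frechet_derivative_comp[OF ch f xU, symmetric]) auto
  also have "\<dots> = frechet_derivative (\<lambda>x. ?L (f x)) (at ?x) (X ?x)"
    using frechet_derivative_cong_open[OF holomorphic_map_openD[OF f] xU eq] by simp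
  also have "\<dots> = ?L (frechet_derivative f (at ?x) (X ?x))"
    by (simp only: frechet_derivative_comp[OF f Lh(1) xU UNIV_I] dL)
  finally show ?thesis by (simp add: push_forward_def)
qed

text \<open>The linearizing map is taken as the change of coordinates. Differentiating the equivariance of the
  transformed field at \<open>s = 0\<close> gives its commutation with \<open>\<i> Z\<^sub>k\<close>, hence with every complex combination
  of the \<open>Z\<^sub>k\<close>. Since the change of coordinates is tangent to the identity, the linear part of \<open>X\<close> and
  its Jordan decomposition do not change.\<close>

lemma torus_action_imp_normalization:
  fixes X :: "complex ^ 'n \<Rightarrow> complex ^ 'n" and D :: "(complex ^ 'n) set"
    and S N P :: "complex ^ 'n ^ 'n" and \<gamma> :: "complex ^ 'n"
  assumes X: "holomorphic_map_on X D" and X0: "X 0 = 0"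
    and J: "jordan_decomposition (linear_part X) S N" and D: "diagonalizes P S \<gamma>"
    and b: "lattice_basis r \<rho> (resonance_lattice \<gamma>)"
    and U: "0 \<in> U" "U \<subseteq> D" and act: "holomorphic_torus_action r U \<alpha>"
    and pres: "action_preserves U \<alpha> X" and \<alpha>0: "\<And>t. \<alpha> t 0 = 0"
    and lin: "linear_part_generated_by r \<alpha> (\<lambda>k. torus_generator P (\<rho> k))"
  shows "admits_convergent_normalization D X"
proof -
  have P: "invertible P" using D by (auto simp: diagonalizes_def)
  have opU: "open U" using torus_action_domain_open[OF act U(1) \<alpha>0 lin P] .
  have XU: "holomorphic_map_on X U" by (rule holomorphic_map_on_subset[OF X opU U(2)])
  obtain f where f: "holomorphic_map_on f U" "f 0 = 0" "\<And>v. frechet_derivative f (at 0) v = v"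
    and eq: "\<And>k s x. k < r \<Longrightarrow> x \<in> U \<Longrightarrow> f (circle_action \<alpha> k s x) = linear_circle P r \<rho> k s (f x)"
    using linearizing_map[OF act U(1) \<alpha>0 lin P order_refl] by blast
  obtain U' V g where U': "0 \<in> U'" "U' \<subseteq> U" "f 0 \<in> V" and bi: "biholomorphism U' V f g"
    by (rule holomorphic_inverse_function[OF f(1) U(1) f(3)])
  have h: "holomorphic_map_on f U'" "holomorphic_map_on g V" and g: "\<And>y. y \<in> V \<Longrightarrow> g y \<in> U'"
    and gf: "\<And>x. x \<in> U' \<Longrightarrow> g (f x) = x"
    using bi by (auto simp: biholomorphism_def homeomorphism_def)
  have V0: "0 \<in> V" and g0: "g 0 = 0" using U'(3) gf[OF U'(1)] f(2) by auto
  have XU': "holomorphic_map_on X U'"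
    by (rule holomorphic_map_on_subset[OF XU holomorphic_map_openD[OF h(1)] U'(2)])
  let ?Y = "push_forward f g X"
  note Y = push_forward_holomorphic[OF bi XU']
  have comm: "frechet_derivative ?Y (at y) (torus_generator P (\<rho> k) y) = torus_generator P (\<rho> k) (?Y y)"
    if k: "k < r" and y: "y \<in> V" for k y
  proof -
    let ?L = "linear_circle P r \<rho> k"
    let ?T = "{s. circle_action \<alpha> k s (g y) \<in> U'}"
    have gyU: "g y \<in> U" using g[OF y] U'(2) by auto
    have "continuous_on UNIV (\<lambda>s. circle_action \<alpha> k s (g y))"
      by (rule continuous_on_circle_action[OF act U(1) \<alpha>0 lin P continuous_on_id continuous_on_const])
        (use gyU in auto)
    then have T: "open ?T"
      using open_vimage[OF holomorphic_map_openD[OF h(1)]] by (simp add: vimage_def)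
    have T0: "0 \<in> ?T"
      using action_zero[OF act U(1) \<alpha>0 lin P gyU] g[OF y] by (simp add: circle_action_def circle_at_0)
    have L0: "?L 0 w = w" for w by (rule linear_circle_zero[OF act U(1) \<alpha>0 lin P])
    have Ld: "((\<lambda>s. ?L s w) has_vector_derivative \<i> *s torus_generator P (\<rho> k) w) (at 0)" for w
      using linear_circle_has_vector_derivative[OF P k, of \<rho> w 0] by (simp add: L0)
    have dY: "(?Y has_derivative frechet_derivative ?Y (at y)) (at (?L 0 y))"
      using holomorphic_map_has_derivative[OF Y(1) y] by (simp add: L0)
    have "((\<lambda>s. ?Y (?L s y)) has_vector_derivative
        frechet_derivative ?Y (at y) (\<i> *s torus_generator P (\<rho> k) y)) (at 0)"
      using vector_derivative_diff_chain_within[OF Ld[of y], of ?Y "frechet_derivative ?Y (at y)"]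
        has_derivative_at_withinI[OF dY] by (simp add: o_def)
    moreover have "((\<lambda>s. ?Y (?L s y)) has_vector_derivative \<i> *s torus_generator P (\<rho> k) (?Y y)) (at 0)"
    proof (rule has_vector_derivative_transform_within_open[OF Ld T T0])
      fix s assume "s \<in> ?T"
      then show "?L s (?Y y) = ?Y (?L s y)"
        using push_forward_circle_equivariant[OF act XU pres f(1) eq[OF k] bi U'(2) y] by simp
    qed
    ultimately have "frechet_derivative ?Y (at y) (\<i> *s torus_generator P (\<rho> k) y) = \<i> *s torus_generator P (\<rho> k) (?Y y)"
      by (rule vector_derivative_unique_at)
    then have "\<i> *s frechet_derivative ?Y (at y) (torus_generator P (\<rho> k) y) = \<i> *s torus_generator P (\<rho> k) (?Y y)"
      using holomorphic_map_clinear[OF Y(1) y] by (simp add: clinear_iff)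
    then show ?thesis by (simp add: vec_eq_iff)
  qed
  obtain \<kappa> where \<kappa>: "\<And>j. \<gamma> $ j = (\<Sum>k<r. \<kappa> k * of_int (\<rho> k $ j))"
    using eigenvalues_in_span_of_lattice[OF b] by blast
  note Sspan = semisimple_part_in_span_of_torus_generators[OF D \<kappa>]
  have br: "lie_bracket ?Y ((*v) S) y = 0" if y: "y \<in> V" for y
  proof -
    have dS: "frechet_derivative ((*v) S) (at y) = (*v) S"
      using frechet_derivative_at[OF holomorphic_map_clinear_map(2)[OF matrix_vector_mul_linear_gen]] by metis
    have cl: "clinear (frechet_derivative ?Y (at y))" by (rule holomorphic_map_clinear[OF Y(1) y])
    have "frechet_derivative ?Y (at y) (S *v y) = (\<Sum>k<r. frechet_derivative ?Y (at y) (\<kappa> k *s torus_generator P (\<rho> k) y))"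
      unfolding Sspan by (rule clinear_sum[OF cl])
    also have "\<dots> = (\<Sum>k<r. \<kappa> k *s torus_generator P (\<rho> k) (?Y y))"
      using cl comm[OF _ y] by (intro sum.cong) (auto simp: clinear_iff)
    also have "\<dots> = S *v ?Y y" by (rule Sspan[symmetric])
    finally show ?thesis by (simp add: lie_bracket_def dS)
  qed
  have dg: "frechet_derivative g (at 0) v = v" for v
    using biholomorphism_derivative_inverse(1)[OF bi U'(1), of v] by (simp add: f(2,3))
  have "linear_part ?Y *v v = linear_part X *v v" for v
    unfolding linear_part_mult[OF Y(1) V0] linear_part_mult[OF XU U(1)]
    using Y(2)[OF V0] by (simp add: g0 X0 f(3) dg)
  then have "linear_part ?Y = linear_part X" by (simp add: matrix_eq)
  moreover have "\<forall>\<^sub>F y in nhds 0. lie_bracket ?Y ((*v) S) y = 0"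
    unfolding eventually_nhds using holomorphic_map_openD[OF h(2)] V0 br by blast
  ultimately have "poincare_dulac_normal_form ?Y"
    unfolding poincare_dulac_normal_form_def using J by metis
  then show ?thesis
    unfolding admits_convergent_normalization_def
    using U'(1,2) U(2) bi f(2) by (intro exI[of _ U'] exI[of _ V] exI[of _ f] exI[of _ g]) auto
qed

theorem proposition2p1:
  fixes X :: "complex ^ 'n \<Rightarrow> complex ^ 'n" and D :: "(complex ^ 'n) set"
    and S N P :: "complex ^ 'n ^ 'n" and \<gamma> :: "complex ^ 'n"
    and r :: nat and \<rho> :: "nat \<Rightarrow> int ^ 'n"
  assumes "open D" and "0 \<in> D" and "holomorphic_map_on X D" and "X 0 = 0"
    and "jordan_decomposition (linear_part X) S N"
    and "diagonalizes P S \<gamma>"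
    and "r = toric_degree \<gamma>" and "lattice_basis r \<rho> (resonance_lattice \<gamma>)"
  shows "admits_convergent_normalization D X \<longleftrightarrow>
    (\<exists>U \<alpha>. 0 \<in> U \<and> U \<subseteq> D \<and> holomorphic_torus_action r U \<alpha> \<and> effective_action r U \<alpha> \<and>
       action_preserves U \<alpha> X \<and> (\<forall>t. \<alpha> t 0 = 0) \<and>
       linear_part_generated_by r \<alpha> (\<lambda>k. torus_generator P (\<rho> k)))"
proof
  assume "admits_convergent_normalization D X"
  then show "\<exists>U \<alpha>. 0 \<in> U \<and> U \<subseteq> D \<and> holomorphic_torus_action r U \<alpha> \<and> effective_action r U \<alpha> \<and>
       action_preserves U \<alpha> X \<and> (\<forall>t. \<alpha> t 0 = 0) \<and>
       linear_part_generated_by r \<alpha> (\<lambda>k. torus_generator P (\<rho> k))"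
    by (rule normalization_imp_torus_action[OF assms(3-6,8)])
next
  assume "\<exists>U \<alpha>. 0 \<in> U \<and> U \<subseteq> D \<and> holomorphic_torus_action r U \<alpha> \<and> effective_action r U \<alpha> \<and>
       action_preserves U \<alpha> X \<and> (\<forall>t. \<alpha> t 0 = 0) \<and>
       linear_part_generated_by r \<alpha> (\<lambda>k. torus_generator P (\<rho> k))"
  then show "admits_convergent_normalization D X"
    using torus_action_imp_normalization[OF assms(3-6,8)] by blast
qed

end
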